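(* Let $\Omega\subset\mathbb{R}^n$ and let $R,S:\Omega\to\mathbb{R}$ be smooth functions such that $\|R\|_\infty\le\Lambda$ and $\|S\|_\infty\le\gamma$ for some $\Lambda,\gamma>0$. Assume that one of the following holds: (1) $n=3$, $\Omega$ is a bounded convex domain with smooth boundary and slab diameter $\delta$, and (a) either $$\mathrm{Vol}(\Omega)\le\min\left\{1,\left(\frac{8}{4.76\,\pi^{2/3}(4\Lambda+\gamma)}\right)^3\right\}\quad\text{and}\quad \delta\le\min\left\{1,\ 1.25\,\mathrm{Vol}(\Omega)^{1/3},\ \frac{2}{0.75\Lambda+1}\right\},$$ (b) or $$\mathrm{diam}(\Omega)\le\min\left\{1,\ \frac{4}{4.76\,\pi^{2/3}(2.5\Lambda+\gamma)},\ \frac{4}{1.5\Lambda+\sqrt2}\right\}.$$ (2) $n\ge4$ and $\Omega$ is a ball of radius $d$ with $$d\le\min\left\{\frac12,\ \frac{n-1}{C_n(2.5\Lambda+\gamma)},\ \frac{n-1}{1.5\Lambda+\sqrt2}\right\}.$$ Then the nonlinear Dirichlet problem $$\Delta f=-\frac{1}{2(n-1)}\left[e^{2f}R(x)+(n-1)(n-2)|\nabla f|^2\right]+S(x)\ \text{ in }\Omega,\qquad f=0\ \text{ on }\partial\Omega,$$ has a smooth solution $f$.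
   Context: $\Delta$ and $\nabla$ are the Euclidean Laplacian (sum of second derivatives) and gradient. $\|f\|_\infty=\sup_\Omega|f|$. $\mathrm{Vol}(\Omega)$ is the Lebesgue measure of $\Omega$ and $\mathrm{diam}(\Omega)$ its diameter. The slab diameter $\delta$ of $\Omega$ is the smallest distance between two parallel hyperplanes such that $\Omega$ is contained in the region between them. The constant $C_n$, depending only on the dimension $n$, is $$C_n=\sup_{x\in B_1^n}\int_{B_1^n}|\nabla G_1(x,x')|\,dx',$$ where $B_1^n$ is the unit ball of $\mathbb{R}^n$ centered at the origin, $G_1$ is the Green's function of the Dirichlet Laplacian on $B_1^n$, and the gradient is taken in $x$. *)

theory Defs
  imports "HOL-Analysis.Analysis"
begin

(* The notions of differentiability below are meant for open sets S: derivatives are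
   taken at points of S with respect to the whole space and depend only on values on S. *)

primrec higher_differentiable_on ::
    "'a::real_normed_vector set \<Rightarrow> ('a \<Rightarrow> 'b::real_normed_vector) \<Rightarrow> nat \<Rightarrow> bool" where
  "higher_differentiable_on S f 0 \<longleftrightarrow> continuous_on S f"
| "higher_differentiable_on S f (Suc k) \<longleftrightarrow>
     (\<forall>x\<in>S. f differentiable (at x)) \<and>
     (\<forall>v. higher_differentiable_on S (\<lambda>x. frechet_derivative f (at x) v) k)"

definition smooth_on :: "'a::real_normed_vector set \<Rightarrow> ('a \<Rightarrow> 'b::real_normed_vector) \<Rightarrow> bool" where
  "smooth_on S f \<longleftrightarrow> (\<forall>k. higher_differentiable_on S f k)"

definition grad :: "('a::euclidean_space \<Rightarrow> real) \<Rightarrow> 'a \<Rightarrow> 'a" where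
  "grad f x = (\<Sum>b\<in>Basis. frechet_derivative f (at x) b *\<^sub>R b)"

definition laplacian :: "('a::euclidean_space \<Rightarrow> real) \<Rightarrow> 'a \<Rightarrow> real" where
  "laplacian f x =
     (\<Sum>b\<in>Basis. frechet_derivative (\<lambda>y. frechet_derivative f (at y) b) (at x) b)"

definition harmonic_on :: "'a::euclidean_space set \<Rightarrow> ('a \<Rightarrow> real) \<Rightarrow> bool" where
  "harmonic_on S h \<longleftrightarrow> higher_differentiable_on S h 2 \<and> (\<forall>x\<in>S. laplacian h x = 0)"

(* Extended-real valued, so that the supremum is correct for unbounded f as well. *)
definition sup_norm_on :: "'a set \<Rightarrow> ('a \<Rightarrow> real) \<Rightarrow> ereal" where
  "sup_norm_on S f = (SUP x\<in>S. ereal \<bar>f x\<bar>)"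

(* Local defining functions: near each boundary point the set is {\<rho> < 0} with
   \<rho> smooth and without critical points. *)
definition smooth_boundary :: "'a::euclidean_space set \<Rightarrow> bool" where
  "smooth_boundary \<Omega> \<longleftrightarrow>
     (\<forall>p\<in>frontier \<Omega>. \<exists>U \<rho>. open U \<and> p \<in> U \<and> smooth_on U \<rho> \<and>
        (\<forall>x\<in>U. grad \<rho> x \<noteq> 0) \<and> \<Omega> \<inter> U = {x\<in>U. \<rho> x < 0})"

definition slab_diameter :: "'a::euclidean_space set \<Rightarrow> real" where
  "slab_diameter \<Omega> = Inf {setdist {x. u \<bullet> x = a} {x. u \<bullet> x = b} | u a b.
     u \<noteq> 0 \<and> a \<le> b \<and> \<Omega> \<subseteq> {x. a \<le> u \<bullet> x \<and> u \<bullet> x \<le> b}}"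

(* Fundamental solution of the Laplacian, normalised so that its Laplacian is the Dirac
   measure at 0. The value at the singularity x = 0 is irrelevant. *)
definition fundamental_solution :: "'a::euclidean_space \<Rightarrow> real" where
  "fundamental_solution x =
     (let n = real DIM('a) in
      if DIM('a) = 2 then ln (norm x) / (2 * pi)
      else - (norm x powr (2 - n)) / (n * (n - 2) * unit_ball_vol n))"

definition is_green_function :: "'a::euclidean_space set \<Rightarrow> ('a \<Rightarrow> 'a \<Rightarrow> real) \<Rightarrow> bool" where
  "is_green_function \<Omega> G \<longleftrightarrow>
     (\<forall>y\<in>\<Omega>.
        (\<exists>h. harmonic_on \<Omega> h \<and> continuous_on (closure \<Omega>) h \<and>
             (\<forall>x\<in>closure \<Omega>. G x y = fundamental_solution (x - y) + h x)) \<and>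
        (\<forall>x\<in>frontier \<Omega>. G x y = 0))"

(* For bounded \<Omega> the maximum principle determines G x y for x in the closure of \<Omega> and
   y in \<Omega>; the choice only concerns the values elsewhere. *)
definition green_function :: "'a::euclidean_space set \<Rightarrow> 'a \<Rightarrow> 'a \<Rightarrow> real" where
  "green_function \<Omega> = (SOME G. is_green_function \<Omega> G)"

(* The constant C_n, with n = DIM('a). *)
definition green_const :: "'a::euclidean_space itself \<Rightarrow> real" where
  "green_const _ =
     (SUP x\<in>ball (0::'a) 1.
        LINT y:ball (0::'a) 1|lebesgue. norm (grad (\<lambda>z. green_function (ball 0 1) z y) x))"

definition is_smooth_dirichlet_solution ::
    "'a::euclidean_space set \<Rightarrow> ('a \<Rightarrow> real) \<Rightarrow> ('a \<Rightarrow> real) \<Rightarrow> ('a \<Rightarrow> real) \<Rightarrow> bool" where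
  "is_smooth_dirichlet_solution \<Omega> R S f \<longleftrightarrow>
     (let n = real DIM('a) in
      smooth_on \<Omega> f \<and> continuous_on (closure \<Omega>) f \<and>
      (\<forall>x\<in>\<Omega>. laplacian f x =
         - (1 / (2 * (n - 1))) *
           (exp (2 * f x) * R x + (n - 1) * (n - 2) * (norm (grad f x))\<^sup>2) + S x) \<and>
      (\<forall>x\<in>frontier \<Omega>. f x = 0))"

end

theory Submission
  imports Defs "HOL-Library.Function_Algebras"
begin

text \<open>The conformal substitution \<open>u = exp ((n - 2) f / 2)\<close> turns the problem into the semilinear equation
  \<open>\<Delta> u = F(x, u)\<close> with \<open>F(x, t) = (n - 2)/2 \<cdot> (S(x) t - R(x) t\<^sup>p / (2 (n - 1)))\<close>,
  \<open>p = (n + 2)/(n - 2)\<close>, and boundary values 1. If \<open>\<tau>\<close> is a nonnegative quadratic polynomial with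
  negative Laplacian on \<open>\<Omega>\<close> (a parabola across a slab, or \<open>d\<^sup>2 - |x - c|\<^sup>2\<close> on a ball) and
  \<open>\<tau> \<le> D\<^sup>2\<close>, then \<open>exp (\<plusminus>(n - 2) \<tau> / (4 D\<^sup>2))\<close> are a super- and a subsolution as soon as
  \<open>D\<^sup>2 (\<gamma> + p e \<Lambda> / (2 (n - 1)))\<close> is small, and the solution operator of the linear problem is a
  contraction in the sup norm weighted by the supersolution.

  The size conditions on \<open>\<Omega>\<close> give this smallness with room to spare. For the ball this needs a lower
  bound for \<open>C\<^sub>n\<close>: with the explicit Green function, the integral at \<open>x = 0\<close> is at least \<open>1 - 1/n\<close>.

  The linear theory avoids singular integrals. A function \<open>v\<close> solves \<open>\<Delta> v = g\<close> weakly if it equals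
  its average against a radial kernel of compact support minus a corresponding average of \<open>g\<close> over all
  smaller scales; this identity passes to uniform limits, and each application gains one derivative.
  On a ball, polynomial data have polynomial solutions, whence arbitrary continuous data by approximation;
  on a bounded convex domain the problem is solved by balayage, with slabs as barriers.\<close>

section \<open>Higher differentiability\<close>

text \<open>The exponent (n - 2)/2 is forced: for u = exp (\<beta> f) the gradient term coming from
  the Laplacian of ln u / \<beta> matches the one in the equation exactly when \<beta> = (n - 2)/2,
  and then exp (2 f) is a power of u. The supersolution w satisfies \<Delta> w \<le> - \<beta>
  \<kappa> w, while F has Lipschitz constant \<beta> K between the barriers, and the smallness
  condition says K < \<kappa>; hence one function can be both the upper barrier and the weight that
  makes the iteration contract. F is truncated at the barriers, so the right-hand sides of the
  iterates are only known to be continuous, and for such data second derivatives may fail to exist.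
  This is why equations are read through an averaging identity without derivatives; smoothness is
  recovered once, for the limit. Convexity enters through a supporting hyperplane at every boundary
  point, which carries a barrier that vanishes there.\<close>

lemma frechet_derivative_cong_open:
  assumes "open S" "x \<in> S" "\<And>y. y \<in> S \<Longrightarrow> f y = g y"
  shows "frechet_derivative f (at x) = frechet_derivative g (at x)"
    and "f differentiable (at x) \<longleftrightarrow> g differentiable (at x)"
proof -
  have "(f has_derivative D) (at x) \<longleftrightarrow> (g has_derivative D) (at x)" for D
    using has_derivative_transform_within_open[OF _ assms(1,2), of f D UNIV g]
      has_derivative_transform_within_open[OF _ assms(1,2), of g D UNIV f] assms(3) by auto
  then show "frechet_derivative f (at x) = frechet_derivative g (at x)"
    and "f differentiable (at x) \<longleftrightarrow> g differentiable (at x)"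
    unfolding frechet_derivative_def differentiable_def by simp_all
qed

lemma higher_differentiable_on_cong:
  assumes "open S" "\<And>x. x \<in> S \<Longrightarrow> f x = g x" "higher_differentiable_on S f k"
  shows "higher_differentiable_on S g k"
  using assms(2,3)
proof (induction k arbitrary: f g)
  case 0
  then show ?case using continuous_on_cong by force
next
  case (Suc k)
  have "higher_differentiable_on S (\<lambda>x. frechet_derivative g (at x) v) k" for v
  proof (rule Suc.IH)
    show "higher_differentiable_on S (\<lambda>x. frechet_derivative f (at x) v) k"
      using Suc.prems by simp
    show "\<And>x. x \<in> S \<Longrightarrow> frechet_derivative f (at x) v = frechet_derivative g (at x) v"
      using frechet_derivative_cong_open(1)[OF assms(1)] Suc.prems(1) by metis
  qed
  then show ?case
    using Suc.prems frechet_derivative_cong_open(2)[OF assms(1), of _ f g] by simp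
qed

lemma higher_differentiable_on_subset:
  assumes "T \<subseteq> S" "higher_differentiable_on S f k"
  shows "higher_differentiable_on T f k"
  using assms(2)
proof (induction k arbitrary: f)
  case 0 then show ?case using assms(1) continuous_on_subset by auto
next
  case (Suc k) then show ?case using assms(1) by auto
qed

lemma higher_differentiable_on_Suc_imp:
  assumes "higher_differentiable_on S f (Suc k)"
  shows "higher_differentiable_on S f k"
  using assms
proof (induction k arbitrary: f)
  case 0
  then show ?case
    by (auto intro!: continuous_at_imp_continuous_on differentiable_imp_continuous_within)
next
  case (Suc k) then show ?case by auto
qed

lemma higher_differentiable_on_le:
  assumes "j \<le> k" "higher_differentiable_on S f k"
  shows "higher_differentiable_on S f j"
  using assms by (induction k) (auto simp: le_Suc_eq dest: higher_differentiable_on_Suc_imp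
      simp del: higher_differentiable_on.simps(2))

lemma higher_differentiable_on_imp_continuous_on:
  "higher_differentiable_on S f k \<Longrightarrow> continuous_on S f"
  using higher_differentiable_on_le[of 0 k S f] by simp

text \<open>Allows regularity to be proved in a small ball around each point, where one averaging
  scale fits for all points of the ball.\<close>

lemma higher_differentiable_on_local:
  assumes "\<And>x. x \<in> S \<Longrightarrow> \<exists>V. open V \<and> x \<in> V \<and> higher_differentiable_on V f k"
  shows "higher_differentiable_on S f k"
  using assms
proof (induction k arbitrary: f)
  case 0
  have "isCont f x" if "x \<in> S" for x
    using 0[OF that] continuous_on_eq_continuous_at[of _ f] by auto
  then show ?case by (simp add: continuous_at_imp_continuous_on)
next
  case (Suc k)
  have "f differentiable (at x)" if "x \<in> S" for x using Suc.prems[OF that] by auto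
  moreover have "higher_differentiable_on S (\<lambda>x. frechet_derivative f (at x) v) k" for v
    by (rule Suc.IH) (use Suc.prems in fastforce)
  ultimately show ?case by simp
qed

text \<open>Any explicit derivative may stand in for \<open>frechet_derivative\<close>; on an open
  set the two agree, so the recursion can continue with the formula that a calculation
  delivers.\<close>

lemma higher_differentiable_on_SucI:
  assumes "open S" "\<And>x. x \<in> S \<Longrightarrow> (f has_derivative f' x) (at x)"
    and "\<And>v. higher_differentiable_on S (\<lambda>x. f' x v) k"
  shows "higher_differentiable_on S f (Suc k)"
proof -
  have *: "frechet_derivative f (at x) = f' x" if "x \<in> S" for x
    using assms(2)[OF that] frechet_derivative_at by metis
  have "higher_differentiable_on S (\<lambda>x. frechet_derivative f (at x) v) k" for v
    by (rule higher_differentiable_on_cong[OF assms(1) _ assms(3)[of v]]) (simp add: *)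
  then show ?thesis using assms(2) by (auto simp: differentiable_def)
qed

lemma higher_differentiable_on_has_derivative:
  assumes "higher_differentiable_on S f (Suc k)" "x \<in> S"
  shows "(f has_derivative frechet_derivative f (at x)) (at x)"
  using assms frechet_derivative_works by auto

lemma higher_differentiable_on_const:
  "higher_differentiable_on S (\<lambda>x. c) k"
  by (induction k arbitrary: c) auto

lemma higher_differentiable_on_add:
  assumes "open S" "higher_differentiable_on S f k" "higher_differentiable_on S g k"
  shows "higher_differentiable_on S (\<lambda>x. f x + g x) k"
  using assms(2,3)
proof (induction k arbitrary: f g)
  case 0 then show ?case by (simp add: continuous_on_add)
next
  case (Suc k)
  show ?case
  proof (rule higher_differentiable_on_SucI[OF assms(1)])
    show "((\<lambda>x. f x + g x) has_derivative
        (\<lambda>v. frechet_derivative f (at x) v + frechet_derivative g (at x) v)) (at x)"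
      if "x \<in> S" for x
      using Suc.prems that by (intro has_derivative_add higher_differentiable_on_has_derivative)
  qed (use Suc in auto)
qed

lemma higher_differentiable_on_scaleR_const:
  assumes "open S" "higher_differentiable_on S f k"
  shows "higher_differentiable_on S (\<lambda>x. c *\<^sub>R f x) k"
  using assms(2)
proof (induction k arbitrary: f)
  case 0 then show ?case by (simp add: continuous_on_scaleR)
next
  case (Suc k)
  show ?case
  proof (rule higher_differentiable_on_SucI[OF assms(1)])
    show "((\<lambda>x. c *\<^sub>R f x) has_derivative (\<lambda>v. c *\<^sub>R frechet_derivative f (at x) v)) (at x)"
      if "x \<in> S" for x
      using Suc.prems that by (intro has_derivative_scaleR_right higher_differentiable_on_has_derivative)
  qed (use Suc in auto)
qed

lemma higher_differentiable_on_cmult: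
  fixes f :: "'a::real_normed_vector \<Rightarrow> real"
  assumes "open S" "higher_differentiable_on S f k"
  shows "higher_differentiable_on S (\<lambda>x. c * f x) k"
  using higher_differentiable_on_scaleR_const[OF assms, of c] by simp

lemma higher_differentiable_on_diff:
  fixes f :: "'a::real_normed_vector \<Rightarrow> real"
  assumes "open S" "higher_differentiable_on S f k" "higher_differentiable_on S g k"
  shows "higher_differentiable_on S (\<lambda>x. f x - g x) k"
  using higher_differentiable_on_add[OF assms(1,2) higher_differentiable_on_cmult[OF assms(1,3), of "-1"]]
  by simp

lemma higher_differentiable_on_mult:
  fixes f g :: "'a::real_normed_vector \<Rightarrow> real"
  assumes "open S" "higher_differentiable_on S f k" "higher_differentiable_on S g k"
  shows "higher_differentiable_on S (\<lambda>x. f x * g x) k"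
  using assms(2,3)
proof (induction k arbitrary: f g)
  case 0 then show ?case by (simp add: continuous_on_mult)
next
  case (Suc k)
  show ?case
  proof (rule higher_differentiable_on_SucI[OF assms(1)])
    show "((\<lambda>x. f x * g x) has_derivative
        (\<lambda>v. f x * frechet_derivative g (at x) v + frechet_derivative f (at x) v * g x)) (at x)"
      if "x \<in> S" for x
      using Suc.prems that by (intro has_derivative_mult higher_differentiable_on_has_derivative)
    show "higher_differentiable_on S
        (\<lambda>x. f x * frechet_derivative g (at x) v + frechet_derivative f (at x) v * g x) k" for v
      using Suc.prems Suc.prems[THEN higher_differentiable_on_Suc_imp]
      by (intro higher_differentiable_on_add[OF assms(1)] Suc.IH) auto
  qed
qed

lemma higher_differentiable_on_bounded_linear:
  assumes "open S" "bounded_linear f"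
  shows "higher_differentiable_on S f k"
proof (cases k)
  case 0 then show ?thesis using assms(2) by (simp add: linear_continuous_on)
next
  case (Suc j)
  show ?thesis unfolding Suc
    by (rule higher_differentiable_on_SucI[OF assms(1), of _ "\<lambda>_. f"])
      (auto simp: assms(2) bounded_linear_imp_has_derivative higher_differentiable_on_const)
qed

text \<open>The outer function comes with the whole sequence of its derivatives, because the chain
  rule replaces \<open>\<Phi> i\<close> by \<open>\<Phi> (Suc i)\<close> and the induction must
  apply to that one as well.\<close>

lemma higher_differentiable_on_compose:
  fixes f :: "'a::real_normed_vector \<Rightarrow> real" and \<Phi> :: "nat \<Rightarrow> real \<Rightarrow> real"
  assumes "open S" "\<And>x. x \<in> S \<Longrightarrow> f x \<in> U"
    and \<Phi>: "\<And>i t. t \<in> U \<Longrightarrow> (\<Phi> i has_real_derivative \<Phi> (Suc i) t) (at t)"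
    and "higher_differentiable_on S f k"
  shows "higher_differentiable_on S (\<lambda>x. \<Phi> i (f x)) k"
  using assms(4)
proof (induction k arbitrary: i)
  case 0
  have "continuous_on U (\<Phi> i)"
    using \<Phi> by (meson DERIV_isCont continuous_at_imp_continuous_on)
  then show ?case
    using 0 assms(2) continuous_on_compose2[of U "\<Phi> i" S f] by auto
next
  case (Suc k)
  show ?case
  proof (rule higher_differentiable_on_SucI[OF assms(1)])
    show "((\<lambda>x. \<Phi> i (f x)) has_derivative
        (\<lambda>v. \<Phi> (Suc i) (f x) * frechet_derivative f (at x) v)) (at x)" if "x \<in> S" for x
    proof -
      have "(\<Phi> i has_derivative (*) (\<Phi> (Suc i) (f x))) (at (f x))"
        using \<Phi>[OF assms(2)[OF that]] by (simp add: has_field_derivative_def)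
      from has_derivative_compose[OF higher_differentiable_on_has_derivative[OF Suc.prems that] this]
      show ?thesis .
    qed
    show "higher_differentiable_on S (\<lambda>x. \<Phi> (Suc i) (f x) * frechet_derivative f (at x) v) k" for v
      using Suc.prems Suc.prems[THEN higher_differentiable_on_Suc_imp]
      by (intro higher_differentiable_on_mult[OF assms(1)] Suc.IH) auto
  qed
qed

lemma higher_differentiable_on_powr:
  fixes f :: "'a::real_normed_vector \<Rightarrow> real"
  assumes "open S" "\<And>x. x \<in> S \<Longrightarrow> 0 < f x" "higher_differentiable_on S f k"
  shows "higher_differentiable_on S (\<lambda>x. f x powr p) k"
proof -
  \<comment> \<open>The i-th derivative of \<open>t powr p\<close>; the product is the falling
    factorial p (p - 1) ... (p - i + 1).\<close>
  define \<Phi> where "\<Phi> = (\<lambda>i t. (\<Prod>j<i. p - real j) * t powr (p - real i))"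
  have "(\<Phi> i has_real_derivative \<Phi> (Suc i) t) (at t)" if "t \<in> {0<..}" for i t
  proof -
    have "((\<lambda>t. t powr (p - real i)) has_real_derivative (p - real i) * t powr (p - real i - 1)) (at t)"
      using that by (intro has_real_derivative_powr) simp
    from DERIV_cmult[OF this, of "\<Prod>j<i. p - real j"] show ?thesis
      by (simp add: \<Phi>_def mult_ac diff_diff_eq add.commute)
  qed
  from higher_differentiable_on_compose[where \<Phi>=\<Phi> and U="{0<..}" and i=0, OF assms(1) _ this assms(3)]
  show ?thesis using assms(2) by (simp add: \<Phi>_def)
qed

lemma higher_differentiable_on_exp:
  fixes f :: "'a::real_normed_vector \<Rightarrow> real"
  assumes "open S" "higher_differentiable_on S f k"
  shows "higher_differentiable_on S (\<lambda>x. exp (f x)) k"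
  using higher_differentiable_on_compose[where \<Phi>="\<lambda>_. exp" and U=UNIV, OF assms(1) _ _ assms(2)]
  by (auto intro!: derivative_eq_intros)

lemma higher_differentiable_on_ln:
  fixes f :: "'a::real_normed_vector \<Rightarrow> real"
  assumes "open S" "\<And>x. x \<in> S \<Longrightarrow> 0 < f x" "higher_differentiable_on S f k"
  shows "higher_differentiable_on S (\<lambda>x. ln (f x)) k"
proof (cases k)
  case 0
  then show ?thesis using assms(2,3) by (force intro!: continuous_on_ln)
next
  case (Suc j)
  show ?thesis unfolding Suc
  proof (rule higher_differentiable_on_SucI[OF assms(1)])
    show "((\<lambda>x. ln (f x)) has_derivative
        (\<lambda>v. f x powr (-1) * frechet_derivative f (at x) v)) (at x)" if "x \<in> S" for x
    proof -
      have "(f has_derivative frechet_derivative f (at x)) (at x)"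
        using assms(3) that unfolding Suc by (rule higher_differentiable_on_has_derivative)
      from has_derivative_ln[OF assms(2)[OF that] this] show ?thesis
        using assms(2)[OF that]
        by (simp add: powr_minus_divide divide_inverse mult.commute)
    qed
    show "higher_differentiable_on S (\<lambda>x. f x powr (-1) * frechet_derivative f (at x) v) j" for v
      using assms(2,3) higher_differentiable_on_Suc_imp[of S f j] unfolding Suc
      by (intro higher_differentiable_on_mult higher_differentiable_on_powr assms(1)) auto
  qed
qed

section \<open>Gradient and Laplacian of composed functions\<close>

lemma grad_cong_open:
  assumes "open S" "x \<in> S" "\<And>y. y \<in> S \<Longrightarrow> f y = g y"
  shows "grad f x = grad g x"
  by (simp add: grad_def frechet_derivative_cong_open(1)[OF assms])

lemma norm_grad_power2:
  "(norm (grad f x))\<^sup>2 = (\<Sum>b\<in>Basis. (frechet_derivative f (at x) b)\<^sup>2)"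
proof -
  have "(norm (grad f x))\<^sup>2 = (\<Sum>b\<in>Basis. (grad f x \<bullet> b)\<^sup>2)"
    unfolding power2_norm_eq_inner by (subst euclidean_inner) (simp add: power2_eq_square)
  also have "\<dots> = (\<Sum>b\<in>Basis. (frechet_derivative f (at x) b)\<^sup>2)"
    by (intro sum.cong) (auto simp: grad_def inner_sum_left inner_Basis if_distrib sum.delta cong: if_cong)
  finally show ?thesis .
qed

lemma grad_eqI:
  assumes "(f has_derivative (\<lambda>v. w \<bullet> v)) (at x)"
  shows "grad f x = w"
  unfolding grad_def frechet_derivative_at[OF assms, symmetric] by (rule euclidean_representation)

lemma laplacian_eqI:
  assumes "open S" "x \<in> S"
    and "\<And>y. y \<in> S \<Longrightarrow> (f has_derivative f' y) (at y)"
    and "\<And>b. b \<in> Basis \<Longrightarrow> ((\<lambda>y. f' y b) has_derivative f'' b) (at x)"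
  shows "laplacian f x = (\<Sum>b\<in>Basis. f'' b b)"
  unfolding laplacian_def
proof (rule sum.cong)
  fix b :: 'a assume b: "b \<in> Basis"
  have "frechet_derivative f (at y) = f' y" if "y \<in> S" for y
    using assms(3)[OF that] frechet_derivative_at by metis
  then have "frechet_derivative (\<lambda>y. frechet_derivative f (at y) b) (at x)
      = frechet_derivative (\<lambda>y. f' y b) (at x)"
    by (intro frechet_derivative_cong_open(1)[OF assms(1,2)]) simp
  also have "\<dots> = f'' b" using assms(4)[OF b] frechet_derivative_at by metis
  finally show "frechet_derivative (\<lambda>y. frechet_derivative f (at y) b) (at x) b = f'' b b" by simp
qed simp

text \<open>The chain rule used three times: for exponentials (barriers), for the logarithm (return
  from u to f) and for powers (harmonicity of the parts of the Green function).\<close>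

lemma laplacian_compose:
  fixes u :: "'a::euclidean_space \<Rightarrow> real"
  assumes "open S" "x \<in> S" "higher_differentiable_on S u 2"
    and "\<And>y. y \<in> S \<Longrightarrow> (\<psi> has_real_derivative \<psi>' (u y)) (at (u y))"
    and "(\<psi>' has_real_derivative \<psi>'') (at (u x))"
  shows "laplacian (\<lambda>y. \<psi> (u y)) x = \<psi>'' * (norm (grad u x))\<^sup>2 + \<psi>' (u x) * laplacian u x"
    and "grad (\<lambda>y. \<psi> (u y)) x = \<psi>' (u x) *\<^sub>R grad u x"
proof -
  have u1: "(u has_derivative frechet_derivative u (at y)) (at y)" if "y \<in> S" for y
    using assms(3) that by (simp add: numeral_2_eq_2 frechet_derivative_works)
  have u2: "((\<lambda>y. frechet_derivative u (at y) b) has_derivative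
      frechet_derivative (\<lambda>y. frechet_derivative u (at y) b) (at x)) (at x)" for b
    using assms(2,3) by (simp add: numeral_2_eq_2 frechet_derivative_works)
  have d1: "((\<lambda>y. \<psi> (u y)) has_derivative (\<lambda>v. \<psi>' (u y) * frechet_derivative u (at y) v)) (at y)"
    if "y \<in> S" for y
    using has_derivative_compose[OF u1[OF that], of \<psi> "(*) (\<psi>' (u y))"] assms(4)[OF that]
    by (simp add: has_field_derivative_def)
  have d2: "((\<lambda>y. \<psi>' (u y)) has_derivative (\<lambda>v. \<psi>'' * frechet_derivative u (at x) v)) (at x)"
    using has_derivative_compose[OF u1[OF assms(2)], of \<psi>' "(*) \<psi>''"] assms(5)
    by (simp add: has_field_derivative_def)
  have "laplacian (\<lambda>y. \<psi> (u y)) x = (\<Sum>b\<in>Basis. \<psi>' (u x) *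
        frechet_derivative (\<lambda>y. frechet_derivative u (at y) b) (at x) b
        + \<psi>'' * frechet_derivative u (at x) b * frechet_derivative u (at x) b)"
    by (rule laplacian_eqI[OF assms(1,2) d1]) (use has_derivative_mult[OF d2 u2] in auto)
  then show "laplacian (\<lambda>y. \<psi> (u y)) x = \<psi>'' * (norm (grad u x))\<^sup>2 + \<psi>' (u x) * laplacian u x"
    unfolding norm_grad_power2 laplacian_def[of u x] sum_distrib_left
    by (simp add: sum.distrib power2_eq_square mult.assoc add.commute)
  have "frechet_derivative (\<lambda>y. \<psi> (u y)) (at x) = (\<lambda>v. \<psi>' (u x) * frechet_derivative u (at x) v)"
    using d1[OF assms(2)] frechet_derivative_at by metis
  then show "grad (\<lambda>y. \<psi> (u y)) x = \<psi>' (u x) *\<^sub>R grad u x"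
    by (simp add: grad_def scaleR_sum_right)
qed

section \<open>Averaging operators with radial kernels\<close>

text \<open>Bundling \<open>f'\<close> into bounded linear maps reduces joint continuity of the
  derivative to one direction v at a time, which is the form in which it is checked for the kernels
  below.\<close>

lemma leibniz_rule_euclidean:
  fixes f :: "'a::euclidean_space \<Rightarrow> 'w::euclidean_space \<Rightarrow> real"
  assumes V: "open V" "x0 \<in> V"
    and f': "\<And>x w. x \<in> V \<Longrightarrow> w \<in> cbox a b \<Longrightarrow> ((\<lambda>x. f x w) has_derivative f' x w) (at x)"
    and cf: "\<And>x. x \<in> V \<Longrightarrow> continuous_on (cbox a b) (f x)"
    and cf': "\<And>v. continuous_on (V \<times> cbox a b) (\<lambda>(x, w). f' x w v)"
  shows "((\<lambda>x. integral (cbox a b) (f x)) has_derivative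
           (\<lambda>v. integral (cbox a b) (\<lambda>w. f' x0 w v))) (at x0)"
proof -
  obtain e where e: "e > 0" "ball x0 e \<subseteq> V" using V openE by blast
  let ?U = "ball x0 e"
  define fx where "fx = (\<lambda>x w. Blinfun (f' x w))"
  have fx: "blinfun_apply (fx x w) = f' x w" if "x \<in> V" "w \<in> cbox a b" for x w
    unfolding fx_def by (rule bounded_linear_Blinfun_apply[OF has_derivative_bounded_linear[OF f'[OF that]]])
  have cfx: "continuous_on (?U \<times> cbox a b) (\<lambda>(x, w). fx x w)"
  proof (rule continuous_on_blinfun_componentwise)
    fix i :: 'a
    have "continuous_on (?U \<times> cbox a b) (\<lambda>(x, w). f' x w i)"
      by (rule continuous_on_subset[OF cf']) (use e in auto)
    then show "continuous_on (?U \<times> cbox a b) (\<lambda>p. blinfun_apply (case p of (x, w) \<Rightarrow> fx x w) i)"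
      by (rule continuous_on_eq) (use e fx in auto)
  qed
  have "((\<lambda>x. integral (cbox a b) (f x)) has_derivative integral (cbox a b) (fx x0)) (at x0 within ?U)"
  proof (rule leibniz_rule[where fx=fx and f=f and U="?U", OF _ _ cfx])
    show "((\<lambda>x. f x t) has_derivative blinfun_apply (fx x t)) (at x within ?U)"
      if "x \<in> ?U" "t \<in> cbox a b" for x t
      using has_derivative_at_withinI[OF f'[of x t]] fx[of x t] that e by auto
    show "f x integrable_on cbox a b" if "x \<in> ?U" for x
      using cf that e by (intro integrable_continuous) auto
  qed (use e in simp_all)
  moreover have "at x0 within ?U = at x0" by (rule at_within_open) (use e in auto)
  ultimately have 1: "((\<lambda>x. integral (cbox a b) (f x)) has_derivative integral (cbox a b) (fx x0)) (at x0)"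
    by (rule subst[rotated])
  have "fx x0 integrable_on cbox a b"
    by (intro integrable_continuous continuous_on_compose2[OF cfx, of _ "\<lambda>w. (x0, w)", simplified])
       (use e in \<open>auto intro!: continuous_intros\<close>)
  then have "blinfun_apply (integral (cbox a b) (fx x0)) = (\<lambda>v. integral (cbox a b) (\<lambda>w. f' x0 w v))"
    using V fx by (auto simp: blinfun_apply_integral fun_eq_iff intro!: integral_cong)
  with 1 show ?thesis by simp
qed

lemma continuous_on_shifted_product:
  fixes g :: "'a::real_normed_vector \<Rightarrow> real"
  assumes "continuous_on B k" "continuous_on B \<tau>" "continuous_on U g"
    and "\<And>x w. x \<in> V \<Longrightarrow> w \<in> B \<Longrightarrow> x - \<tau> w \<in> U"
  shows "continuous_on (V \<times> B) (\<lambda>(x, w). k w * g (x - \<tau> w))"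
proof -
  have "continuous_on (V \<times> B) (\<lambda>p. k (snd p))"
    by (rule continuous_on_compose2[OF assms(1)]) (auto intro!: continuous_intros)
  moreover have "continuous_on (V \<times> B) (\<lambda>p. \<tau> (snd p))"
    by (rule continuous_on_compose2[OF assms(2)]) (auto intro!: continuous_intros)
  then have "continuous_on (V \<times> B) (\<lambda>p. g (fst p - \<tau> (snd p)))"
    by (intro continuous_on_compose2[OF assms(3)] continuous_intros) (use assms(4) in auto)
  ultimately show ?thesis by (simp add: split_beta continuous_on_mult)
qed

lemma continuous_on_shifted_product_section:
  fixes g :: "'a::real_normed_vector \<Rightarrow> real"
  assumes "continuous_on B k" "continuous_on B \<tau>" "continuous_on U g"
    and "\<And>w. w \<in> B \<Longrightarrow> x - \<tau> w \<in> U"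
  shows "continuous_on B (\<lambda>w. k w * g (x - \<tau> w))"
proof -
  have "continuous_on B (\<lambda>w. x - \<tau> w)"
    by (intro continuous_on_diff continuous_on_const assms(2))
  from continuous_on_compose2[OF assms(3) this] have "continuous_on B (\<lambda>w. g (x - \<tau> w))"
    using assms(4) by auto
  then show ?thesis by (rule continuous_on_mult[OF assms(1)])
qed

lemma has_derivative_shifted_integral:
  fixes g :: "'a::euclidean_space \<Rightarrow> real" and a b :: "'w::euclidean_space"
  assumes V: "open V" "x \<in> V"
    and k: "continuous_on (cbox a b) k" and \<tau>: "continuous_on (cbox a b) \<tau>"
    and sub: "\<And>x w. x \<in> V \<Longrightarrow> w \<in> cbox a b \<Longrightarrow> x - \<tau> w \<in> U"
    and g': "\<And>y. y \<in> U \<Longrightarrow> (g has_derivative g' y) (at y)"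
    and cg': "\<And>v. continuous_on U (\<lambda>y. g' y v)"
  shows "((\<lambda>x. integral (cbox a b) (\<lambda>w. k w * g (x - \<tau> w))) has_derivative
     (\<lambda>v. integral (cbox a b) (\<lambda>w. k w * g' (x - \<tau> w) v))) (at x)"
proof (rule leibniz_rule_euclidean[OF V])
  fix y w assume yw: "y \<in> V" "w \<in> cbox a b"
  have "((\<lambda>x. x - \<tau> w) has_derivative (\<lambda>v. v)) (at y)"
    by (auto intro!: derivative_eq_intros)
  from has_derivative_compose[OF this g'[OF sub[OF yw]]]
  show "((\<lambda>x. k w * g (x - \<tau> w)) has_derivative (\<lambda>v. k w * g' (y - \<tau> w) v)) (at y)"
    by (rule has_derivative_mult_right)
next
  have "continuous_on U g"
    by (intro continuous_at_imp_continuous_on ballI has_derivative_continuous[OF g'])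
  then show "continuous_on (cbox a b) (\<lambda>w. k w * g (y - \<tau> w))" if "y \<in> V" for y
    by (rule continuous_on_shifted_product_section[OF k \<tau>]) (use sub that in auto)
qed (rule continuous_on_shifted_product[OF k \<tau> cg' sub])

text \<open>Here the derivatives fall on g and none is gained. It is applied after one derivative
  has been moved to the kernel, to the integral that results.\<close>

lemma higher_differentiable_on_shifted_integral:
  fixes g :: "'a::euclidean_space \<Rightarrow> real" and a b :: "'w::euclidean_space"
  assumes V: "open V" and k: "continuous_on (cbox a b) k" and \<tau>: "continuous_on (cbox a b) \<tau>"
    and sub: "\<And>x w. x \<in> V \<Longrightarrow> w \<in> cbox a b \<Longrightarrow> x - \<tau> w \<in> U"
    and g: "higher_differentiable_on U g j"
  shows "higher_differentiable_on V (\<lambda>x. integral (cbox a b) (\<lambda>w. k w * g (x - \<tau> w))) j"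
  using g
proof (induction j arbitrary: g)
  case 0
  then show ?case
    using integral_continuous_on_param[OF continuous_on_shifted_product[OF k \<tau> _ sub]] by simp
next
  case (Suc j)
  show ?case
  proof (rule higher_differentiable_on_SucI[OF V])
    show "((\<lambda>x. integral (cbox a b) (\<lambda>w. k w * g (x - \<tau> w))) has_derivative
        (\<lambda>v. integral (cbox a b) (\<lambda>w. k w * frechet_derivative g (at (x - \<tau> w)) v))) (at x)"
      if "x \<in> V" for x
    proof (rule has_derivative_shifted_integral[OF V that k \<tau> sub
          higher_differentiable_on_has_derivative[OF Suc.prems]])
      show "continuous_on U (\<lambda>y. frechet_derivative g (at y) v)" for v
        using Suc.prems by (intro higher_differentiable_on_imp_continuous_on[where k=j]) simp
    qed
    show "higher_differentiable_on V
        (\<lambda>x. integral (cbox a b) (\<lambda>w. k w * frechet_derivative g (at (x - \<tau> w)) v)) j" for v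
      by (rule Suc.IH) (use Suc.prems in simp)
  qed
qed

text \<open>Translation invariance in place of the divergence theorem: by \<open>supp\<close>, small
  shifts along c do not move the support of \<psi> across the boundary of the box, so the integral
  of the shifted function is constant in t, and its derivative at 0 is the integral of
  \<open>\<psi>'\<close>.\<close>

lemma integral_directional_derivative_eq_0:
  fixes \<psi> :: "'w::euclidean_space \<Rightarrow> real"
  assumes \<psi>': "\<And>w. ((\<lambda>t. \<psi> (w + t *\<^sub>R c)) has_real_derivative \<psi>' w) (at 0)"
    and cont: "continuous_on UNIV \<psi>" "continuous_on UNIV \<psi>'"
    and "0 < \<delta>"
    and supp: "\<And>w t. \<bar>t\<bar> < \<delta> \<Longrightarrow> \<psi> w \<noteq> 0 \<Longrightarrow> w \<in> cbox a b \<longleftrightarrow> w - t *\<^sub>R c \<in> cbox a b"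
  shows "integral (cbox a b) \<psi>' = 0"
proof -
  let ?\<Phi> = "\<lambda>t. integral (cbox a b) (\<lambda>w. \<psi> (w + t *\<^sub>R c))"
  have eq: "?\<Phi> t = integral (cbox a b) \<psi>" if "\<bar>t\<bar> < \<delta>" for t
  proof -
    have "?\<Phi> t = integral (cbox (a + t *\<^sub>R c) (b + t *\<^sub>R c)) \<psi>"
      using integral_shift_cbox[of "a + t *\<^sub>R c" "t *\<^sub>R c" "b + t *\<^sub>R c" \<psi>] by simp
    also have "\<dots> = integral UNIV (\<lambda>w. if w \<in> cbox (a + t *\<^sub>R c) (b + t *\<^sub>R c) then \<psi> w else 0)"
      by (simp add: integral_restrict_UNIV)
    also have "\<dots> = integral UNIV (\<lambda>w. if w \<in> cbox a b then \<psi> w else 0)"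
    proof (rule integral_cong)
      fix w
      have "w \<in> cbox (a + t *\<^sub>R c) (b + t *\<^sub>R c) \<longleftrightarrow> w - t *\<^sub>R c \<in> cbox a b"
        by (simp add: mem_box inner_add_left inner_diff_left le_diff_eq diff_le_eq)
      then show "(if w \<in> cbox (a + t *\<^sub>R c) (b + t *\<^sub>R c) then \<psi> w else 0)
          = (if w \<in> cbox a b then \<psi> w else 0)"
        using supp[OF that, of w] by auto
    qed
    finally show ?thesis by (simp add: integral_restrict_UNIV)
  qed
  have "(?\<Phi> has_real_derivative integral (cbox a b) (\<lambda>w. \<psi>' (w + 0 *\<^sub>R c))) (at 0 within {-\<delta><..<\<delta>})"
  proof (rule leibniz_rule_field_derivative[where f="\<lambda>t w. \<psi> (w + t *\<^sub>R c)"
        and fx="\<lambda>t w. \<psi>' (w + t *\<^sub>R c)"])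
    fix t w
    have "((\<lambda>s. \<psi> ((w + t *\<^sub>R c) + s *\<^sub>R c)) has_real_derivative \<psi>' (w + t *\<^sub>R c)) (at (t - t))"
      using \<psi>'[of "w + t *\<^sub>R c"] by simp
    moreover have "((\<lambda>s. s - t) has_real_derivative 1) (at t)"
      by (auto intro!: derivative_eq_intros)
    ultimately have "((\<lambda>s. \<psi> ((w + t *\<^sub>R c) + (s - t) *\<^sub>R c)) has_real_derivative
        \<psi>' (w + t *\<^sub>R c) * 1) (at t)"
      by (rule DERIV_chain2[where g="\<lambda>s. s - t"])
    then have "((\<lambda>s. \<psi> (w + s *\<^sub>R c)) has_real_derivative \<psi>' (w + t *\<^sub>R c)) (at t)"
      by (simp add: scaleR_diff_left)
    then show "((\<lambda>s. \<psi> (w + s *\<^sub>R c)) has_real_derivative \<psi>' (w + t *\<^sub>R c)) (at t within {-\<delta><..<\<delta>})"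
      by (rule has_field_derivative_at_within)
  next
    show "continuous_on ({-\<delta><..<\<delta>} \<times> cbox a b) (\<lambda>(t, w). \<psi>' (w + t *\<^sub>R c))"
      unfolding split_beta by (intro continuous_on_compose2[OF cont(2)] continuous_intros) auto
    show "(\<lambda>w. \<psi> (w + t *\<^sub>R c)) integrable_on cbox a b" for t
      by (intro integrable_continuous continuous_on_compose2[OF cont(1)] continuous_intros) auto
  qed (use \<open>0 < \<delta>\<close> in auto)
  then have 1: "(?\<Phi> has_real_derivative integral (cbox a b) \<psi>') (at 0)"
    using \<open>0 < \<delta>\<close> by (simp add: at_within_open[of 0 "{-\<delta><..<\<delta>}"])
  have 2: "(?\<Phi> has_real_derivative 0) (at 0)"
    by (rule has_field_derivative_transform_within_open[of "\<lambda>_. integral (cbox a b) \<psi>" 0 0 "{-\<delta><..<\<delta>}"])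
       (use \<open>0 < \<delta>\<close> in \<open>auto simp: eq abs_less_iff\<close>)
  from DERIV_unique[OF 1 2] show ?thesis .
qed

section \<open>Polynomial bump kernels and the operators built from them\<close>

definition bump :: "nat \<Rightarrow> 'a::euclidean_space \<Rightarrow> real" where
  "bump k z = max 0 (1 - z \<bullet> z) ^ k"

lemma has_real_derivative_max_power:
  "((\<lambda>t::real. max 0 t ^ Suc (Suc k)) has_real_derivative real (Suc (Suc k)) * max 0 t ^ Suc k) (at t)"
proof (cases t "0::real" rule: linorder_cases)
  case less
  have "((\<lambda>t::real. 0) has_real_derivative 0) (at t)" by simp
  then show ?thesis
    by (rule has_field_derivative_transform_within_open[where S="{..<0}", THEN DERIV_cong])
       (use less in auto)
next
  case greater
  have "((\<lambda>t::real. t ^ Suc (Suc k)) has_real_derivative real (Suc (Suc k)) * t ^ Suc k) (at t)"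
    using DERIV_pow[of "Suc (Suc k)" t] by simp
  then show ?thesis
    by (rule has_field_derivative_transform_within_open[where S="{0<..}", THEN DERIV_cong])
       (use greater in auto)
next
  case equal
  have "((\<lambda>h::real. max 0 h ^ Suc k) \<longlongrightarrow> max 0 0 ^ Suc k) (at 0)"
    by (intro tendsto_intros)
  then have lim: "((\<lambda>h::real. max 0 h ^ Suc k) \<longlongrightarrow> 0) (at 0)" by simp
  \<comment> \<open>The difference quotient at 0 is dominated by \<open>max 0 h ^ Suc k\<close>; the
    exponent starts at 2 so that a positive power survives the division by h.\<close>
  have "((\<lambda>h::real. max 0 h ^ Suc (Suc k) / h) \<longlongrightarrow> 0) (at 0)"
    by (rule Lim_null_comparison[OF _ lim]) (auto intro!: always_eventually simp: max_def)
  then show ?thesis using equal by (simp add: DERIV_def)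
qed

text \<open>The reason for truncated powers of 1 - |z|^2 instead of smooth cut-offs: up to the
  factor z, the gradient of one bump is a multiple of the bump with the next lower exponent. The
  averaging identity rests on this for exponents 3 and 2.\<close>

lemma has_derivative_bump:
  "(bump (Suc (Suc k)) has_derivative
     (\<lambda>v. - (2 * real (Suc (Suc k)) * (z \<bullet> v) * bump (Suc k) z))) (at z)"
proof -
  have "((\<lambda>z::'a. 1 - z \<bullet> z) has_derivative (\<lambda>v. - (2 * (z \<bullet> v)))) (at z)"
    by (auto intro!: derivative_eq_intros simp: inner_commute)
  from has_derivative_compose[OF this
      has_real_derivative_max_power[of k "1 - z \<bullet> z", unfolded has_field_derivative_def]]
  show ?thesis unfolding bump_def by (rule has_derivative_eq_rhs) (simp add: fun_eq_iff)
qed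

lemma continuous_on_bump: "continuous_on S (bump k)"
  unfolding bump_def by (intro continuous_intros)

lemma bump_nonneg: "0 \<le> bump k z"
  by (simp add: bump_def)

lemma bump_eq_0: "1 \<le> norm z \<Longrightarrow> 0 < k \<Longrightarrow> bump k z = 0"
  using power_mono[of 1 "norm z" 2] by (simp add: bump_def power2_norm_eq_inner)

lemma bump_pos: "norm z < 1 \<Longrightarrow> 0 < bump k z"
  using power_strict_mono[of "norm z" 1 2] by (simp add: bump_def power2_norm_eq_inner)

text \<open>The cube contains the ball of radius 2, whereas the kernels live in the unit ball; the
  margin absorbs the translations in the integration by parts. A box rather than a ball suits the
  integral theorems.\<close>

definition kernel_cube :: "'a::euclidean_space set" where
  "kernel_cube = cbox (- (2 *\<^sub>R One)) (2 *\<^sub>R One)"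

text \<open>The first coordinate is a scale s between 0 and 1, so that averages over all smaller
  scales are a single integral over a box.\<close>

definition kernel_box :: "(real \<times> 'a::euclidean_space) set" where
  "kernel_box = cbox (0, - (2 *\<^sub>R One)) (1, 2 *\<^sub>R One)"

text \<open>What is recorded is a C^1 function supported in the closed unit ball together with its
  derivative; symmetry appears only in the concrete kernels.\<close>

definition radial_kernel :: "('a::euclidean_space \<Rightarrow> real) \<Rightarrow> ('a \<Rightarrow> 'a \<Rightarrow> real) \<Rightarrow> bool" where
  "radial_kernel k k' \<longleftrightarrow> (\<forall>z. (k has_derivative k' z) (at z)) \<and>
     (\<forall>v. continuous_on UNIV (\<lambda>z. k' z v)) \<and> (\<forall>z. 1 \<le> norm z \<longrightarrow> k z = 0)"

text \<open>The weight \<open>\<sigma> (fst w)\<close> equals the factor in the shift. Integration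
  by parts at scale s produces r times \<open>\<sigma> s\<close>, so after moving a derivative to
  the kernel only the division by r is left and nothing blows up as s tends to 0. The mean uses the
  constant 1 for \<open>\<sigma>\<close>, the potential uses the identity.\<close>

definition kernel_op ::
    "(real \<Rightarrow> real) \<Rightarrow> ('a::euclidean_space \<Rightarrow> real) \<Rightarrow> real \<Rightarrow> ('a \<Rightarrow> real) \<Rightarrow> 'a \<Rightarrow> real" where
  "kernel_op \<sigma> k r g x = integral kernel_box
     (\<lambda>w. \<sigma> (fst w) * k (snd w) * g (x - (r * \<sigma> (fst w)) *\<^sub>R snd w))"

lemma kernel_box_Times: "kernel_box = {0..1} \<times> kernel_cube"
  by (simp add: kernel_box_def kernel_cube_def cbox_Pair_eq)

lemma compact_kernel_box: "compact kernel_box"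
  by (simp add: kernel_box_def compact_cbox)

lemma compact_kernel_cube: "compact kernel_cube"
  by (simp add: kernel_cube_def compact_cbox)

lemma mem_kernel_cube: "norm z < 2 \<Longrightarrow> z \<in> kernel_cube"
  using Basis_le_norm[of _ z] by (fastforce simp: kernel_cube_def mem_box abs_le_iff)

lemma kernel_cube_scale: "0 \<le> s \<Longrightarrow> s \<le> 1 \<Longrightarrow> z \<in> kernel_cube \<Longrightarrow> s *\<^sub>R z \<in> kernel_cube"
proof -
  assume s: "0 \<le> s" "s \<le> 1" and z: "z \<in> kernel_cube"
  have "convex (kernel_cube :: 'a set)" "(0::'a) \<in> kernel_cube"
    by (auto simp: kernel_cube_def mem_box intro: convex_box)
  from convexD_alt[OF this(1,2) z s] show ?thesis by simp
qed

lemma bounded_kernel_cube: "\<exists>B>0. \<forall>z\<in>(kernel_cube :: 'a::euclidean_space set). norm z \<le> B"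
  using compact_imp_bounded[OF compact_kernel_cube] bounded_pos by blast

lemma integral_kernel_box:
  fixes f :: "real \<times> 'a::euclidean_space \<Rightarrow> real"
  assumes "continuous_on (kernel_box :: (real \<times> 'a::euclidean_space) set) f"
  shows "integral kernel_box f = integral {0..1} (\<lambda>s. integral kernel_cube (\<lambda>z. f (s, z)))"
  using integral_prod_continuous[OF assms[unfolded kernel_box_def]]
  by (simp add: kernel_box_def kernel_cube_def cbox_interval)

lemma integral_kernel_box_snd:
  fixes h :: "'a::euclidean_space \<Rightarrow> real"
  assumes "continuous_on (kernel_cube :: 'a::euclidean_space set) h"
  shows "integral kernel_box (\<lambda>w. h (snd w)) = integral kernel_cube h"
proof -
  have "continuous_on (kernel_box :: (real \<times> 'a) set) (\<lambda>w. h (snd w))"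
    by (rule continuous_on_compose2[OF assms continuous_on_snd[OF continuous_on_id]])
      (auto simp: kernel_box_Times)
  from integral_kernel_box[OF this] show ?thesis by simp
qed

lemma radial_kernel_bump:
  "radial_kernel (bump (Suc (Suc k)))
     (\<lambda>z v. - (2 * real (Suc (Suc k)) * (z \<bullet> v) * bump (Suc k) z))"
  unfolding radial_kernel_def
  by (intro conjI allI impI has_derivative_bump bump_eq_0 continuous_intros continuous_on_bump) auto

lemma radial_kernel_cmult:
  assumes "radial_kernel k k'"
  shows "radial_kernel (\<lambda>z. c * k z) (\<lambda>z v. c * k' z v)"
  using assms unfolding radial_kernel_def
  by (auto intro!: has_derivative_mult_right continuous_on_mult continuous_on_const)

lemma radial_kernel_continuous_on:
  assumes "radial_kernel k k'"
  shows "continuous_on S k"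
proof (rule continuous_at_imp_continuous_on, rule ballI)
  fix z show "isCont k z"
    using assms has_derivative_continuous unfolding radial_kernel_def by blast
qed

lemma radial_kernel_linear:
  assumes "radial_kernel k k'"
  shows "linear (k' z)"
  using assms has_derivative_linear unfolding radial_kernel_def by blast

lemma radial_kernel_derivative_outside:
  assumes "radial_kernel k k'" "1 < norm z"
  shows "k' z v = 0"
proof -
  have op: "open {z::'a. 1 < norm z}"
    by (intro open_Collect_less continuous_intros)
  have "((\<lambda>_. 0::real) has_derivative k' z) (at z)"
  proof (rule has_derivative_transform_within_open[OF _ op])
    show "(k has_derivative k' z) (at z)" using assms unfolding radial_kernel_def by blast
  qed (use assms in \<open>auto simp: radial_kernel_def\<close>)
  then have "k' z = (\<lambda>_. 0)"
    by (rule has_derivative_unique[OF _ has_derivative_const])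
  then show ?thesis by simp
qed

text \<open>The product of k and the shifted h has compact support, so the integral of its
  derivative along v vanishes; the two terms of the product rule are the two sides. The function h
  is known only on U, hence the extension by zero through k.\<close>

lemma kernel_by_parts:
  fixes h :: "'a::euclidean_space \<Rightarrow> real"
  assumes k: "radial_kernel k k'" and U: "open U"
    and sub: "\<And>z. norm z \<le> 1 \<Longrightarrow> x - \<rho> *\<^sub>R z \<in> U"
    and h': "\<And>y. y \<in> U \<Longrightarrow> (h has_derivative h' y) (at y)"
    and ch': "continuous_on U (\<lambda>y. h' y v)"
  shows "integral kernel_cube (\<lambda>z. k' z v * h (x - \<rho> *\<^sub>R z))
       = \<rho> * integral kernel_cube (\<lambda>z. k z * h' (x - \<rho> *\<^sub>R z) v)"
proof -
  define W where "W = (\<lambda>z. x - \<rho> *\<^sub>R z) -` U"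
  have W: "open W"
    unfolding W_def by (rule open_vimage[OF U]) (intro continuous_intros)
  have Wsub: "norm z \<le> 1 \<Longrightarrow> z \<in> W" for z using sub by (simp add: W_def)
  have O: "open {z::'a. 1 < norm z}"
    by (intro open_Collect_less continuous_intros)
  \<comment> \<open>Two open sets: on W the shifted h is under control, on the other one k and its
    derivative vanish. Continuity on both gives continuity everywhere.\<close>
  have cover: "UNIV = W \<union> {z. 1 < norm z}" using Wsub by force
  have ck: "continuous_on S k" for S by (rule radial_kernel_continuous_on[OF k])
  have ck': "continuous_on S (\<lambda>z. k' z v)" for S
    using k continuous_on_subset unfolding radial_kernel_def by blast
  have ch: "continuous_on U h"
    by (intro continuous_at_imp_continuous_on ballI has_derivative_continuous[OF h'])
  have k0: "k z = 0" "k' z v = 0" if "1 < norm z" for z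
    using k radial_kernel_derivative_outside[OF k that] that unfolding radial_kernel_def by auto
  have aff: "continuous_on W (\<lambda>z. x - \<rho> *\<^sub>R z)" by (intro continuous_intros)
  have cW: "continuous_on W (\<lambda>z. h (x - \<rho> *\<^sub>R z))" "continuous_on W (\<lambda>z. h' (x - \<rho> *\<^sub>R z) v)"
    by (rule continuous_on_compose2[OF ch aff]; auto simp: W_def)
       (rule continuous_on_compose2[OF ch' aff]; auto simp: W_def)
  have ext: "continuous_on UNIV f"
    if "continuous_on W f" "\<And>z. 1 < norm z \<Longrightarrow> f z = 0" for f :: "'a \<Rightarrow> real"
  proof -
    have "continuous_on {z. 1 < norm z} f"
      by (rule continuous_on_eq[OF continuous_on_const[of _ 0]]) (use that(2) in auto)
    then show ?thesis unfolding cover by (rule continuous_on_open_Un[OF W O that(1)])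
  qed
  let ?A = "\<lambda>z. k' z v * h (x - \<rho> *\<^sub>R z)" and ?B = "\<lambda>z. k z * h' (x - \<rho> *\<^sub>R z) v"
  have cA: "continuous_on UNIV ?A"
    by (rule ext) (use k0 in \<open>auto intro!: continuous_on_mult ck' cW\<close>)
  have cB: "continuous_on UNIV ?B"
    by (rule ext) (use k0 in \<open>auto intro!: continuous_on_mult ck cW\<close>)
  have "integral (cbox (- (2 *\<^sub>R One)) (2 *\<^sub>R One)) (\<lambda>z. ?A z - \<rho> * ?B z) = 0"
  \<comment> \<open>With this \<open>\<delta>\<close> a shift by t v has length below 1, so a point
    of the unit ball stays in the ball of radius 2 and thus in the cube.\<close>
  proof (rule integral_directional_derivative_eq_0[where \<psi>="\<lambda>z. k z * h (x - \<rho> *\<^sub>R z)"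
        and c=v and \<delta>="1 / (norm v + 1)"])
    show "continuous_on UNIV (\<lambda>z. k z * h (x - \<rho> *\<^sub>R z))"
      by (rule ext) (use k0 in \<open>auto intro!: continuous_on_mult ck cW\<close>)
    show "continuous_on UNIV (\<lambda>z. ?A z - \<rho> * ?B z)"
      by (intro continuous_on_diff cA continuous_on_mult continuous_on_const cB)
    show "0 < 1 / (norm v + 1)" by (simp add: add_nonneg_pos)
    fix z t assume t: "\<bar>t\<bar> < 1 / (norm v + 1)" "k z * h (x - \<rho> *\<^sub>R z) \<noteq> 0"
    then have z: "norm z < 1" using k by (force simp: radial_kernel_def)
    have "\<bar>t\<bar> * norm v \<le> \<bar>t\<bar> * (norm v + 1)" by (simp add: mult_left_mono)
    also have "\<dots> < 1"
      using t(1) norm_ge_zero[of v] by (simp only: pos_less_divide_eq add_nonneg_pos zero_less_one)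
    finally have "norm (z - t *\<^sub>R v) < 2" using z norm_triangle_ineq4[of z "t *\<^sub>R v"] by simp
    then show "z \<in> cbox (- (2 *\<^sub>R One)) (2 *\<^sub>R One) \<longleftrightarrow> z - t *\<^sub>R v \<in> cbox (- (2 *\<^sub>R One)) (2 *\<^sub>R One)"
      using mem_kernel_cube[of z] mem_kernel_cube[of "z - t *\<^sub>R v"] z by (simp add: kernel_cube_def)
  next
    fix z
    let ?P = "\<lambda>t. k (z + t *\<^sub>R v) * h (x - \<rho> *\<^sub>R (z + t *\<^sub>R v))"
    show "(?P has_real_derivative ?A z - \<rho> * ?B z) (at 0)"
    proof (cases "norm z \<le> 1")
      case True
      have l: "((\<lambda>t. z + t *\<^sub>R v) has_derivative (\<lambda>t. t *\<^sub>R v)) (at 0)"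
        by (auto intro!: derivative_eq_intros)
      have "(k has_derivative k' z) (at (z + 0 *\<^sub>R v))"
        using k by (simp add: radial_kernel_def)
      from has_derivative_compose[OF l this]
      have 1: "((\<lambda>t. k (z + t *\<^sub>R v)) has_derivative (\<lambda>t. k' z (t *\<^sub>R v))) (at 0)" .
      have l2: "((\<lambda>t. x - \<rho> *\<^sub>R (z + t *\<^sub>R v)) has_derivative (\<lambda>t. - (\<rho> *\<^sub>R t *\<^sub>R v))) (at 0)"
        by (auto intro!: derivative_eq_intros)
      have "(h has_derivative h' (x - \<rho> *\<^sub>R z)) (at (x - \<rho> *\<^sub>R (z + 0 *\<^sub>R v)))"
        using h'[OF sub[OF True]] by simp
      from has_derivative_compose[OF l2 this]
      have 2: "((\<lambda>t. h (x - \<rho> *\<^sub>R (z + t *\<^sub>R v))) has_derivative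
          (\<lambda>t. h' (x - \<rho> *\<^sub>R z) (- (\<rho> *\<^sub>R t *\<^sub>R v)))) (at 0)" .
      have lk: "linear (k' z)" by (rule radial_kernel_linear[OF k])
      have lh: "linear (h' (x - \<rho> *\<^sub>R z))" by (rule has_derivative_linear[OF h'[OF sub[OF True]]])
      from has_derivative_mult[OF 1 2]
      show ?thesis unfolding has_field_derivative_def
        by (rule has_derivative_eq_rhs)
           (auto simp: fun_eq_iff linear_cmul[OF lk] linear_neg[OF lh] linear_cmul[OF lh] algebra_simps)
    next
      case False
      have op: "open {t. 1 < norm (z + t *\<^sub>R v)}"
        by (intro open_Collect_less continuous_intros)
      have "(?P has_real_derivative 0) (at 0)"
        by (rule has_field_derivative_transform_within_open[OF DERIV_const[of 0] op])
           (use False k0 in auto)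
      then show ?thesis using False k0[of z] by simp
    qed
  qed
  then have "integral kernel_cube (\<lambda>z. ?A z - \<rho> * ?B z) = 0"
    by (simp add: kernel_cube_def)
  moreover have "?A integrable_on kernel_cube" "(\<lambda>z. \<rho> * ?B z) integrable_on kernel_cube"
    unfolding kernel_cube_def
    by (intro integrable_continuous continuous_on_subset[OF cA] subset_UNIV)
       (intro integrable_continuous continuous_on_mult continuous_on_const continuous_on_subset[OF cB] subset_UNIV)
  ultimately show ?thesis
    by (simp add: integral_diff)
qed

lemma higher_differentiable_on_real_polynomial_function:
  fixes p :: "'a::euclidean_space \<Rightarrow> real"
  assumes "real_polynomial_function p"
  shows "higher_differentiable_on UNIV p k"
  using assms
proof (induction rule: real_polynomial_function.induct)
  case (linear h)
  then show ?case by (intro higher_differentiable_on_bounded_linear open_UNIV)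
next
  case (const c)
  show ?case by (rule higher_differentiable_on_const)
next
  case (add f g)
  then show ?case by (intro higher_differentiable_on_add open_UNIV)
next
  case (mult f g)
  then show ?case by (intro higher_differentiable_on_mult open_UNIV)
qed

lemma continuous_on_snd_box:
  assumes "\<And>S. continuous_on S (k :: 'a::euclidean_space \<Rightarrow> real)"
  shows "continuous_on kernel_box (\<lambda>w. k (snd w))"
  by (rule continuous_on_compose2[OF assms[of UNIV] continuous_on_snd[OF continuous_on_id]]) auto

lemma continuous_on_fst_box:
  assumes "continuous_on {0..1} \<sigma>"
  shows "continuous_on kernel_box (\<lambda>w. \<sigma> (fst w))"
  by (rule continuous_on_compose2[OF assms continuous_on_fst[OF continuous_on_id]])
    (auto simp: kernel_box_Times)

lemma continuous_on_kernel_shift: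
  assumes "continuous_on {0..1} \<sigma>"
  shows "continuous_on kernel_box (\<lambda>w. (r * \<sigma> (fst w)) *\<^sub>R snd w)"
  by (intro continuous_on_scaleR continuous_on_mult continuous_on_const
      continuous_on_fst_box[OF assms] continuous_on_snd continuous_on_id)

lemma continuous_on_kernel_section:
  fixes g :: "'a::euclidean_space \<Rightarrow> real"
  assumes "continuous_on {0..1} \<sigma>" "continuous_on kernel_box \<kappa>" "continuous_on U g"
    and "\<And>w. w \<in> kernel_box \<Longrightarrow> x - (r * \<sigma> (fst w)) *\<^sub>R snd w \<in> U"
  shows "continuous_on kernel_box (\<lambda>w. \<kappa> w * g (x - (r * \<sigma> (fst w)) *\<^sub>R snd w))"
  by (rule continuous_on_shifted_product_section[OF assms(2)
        continuous_on_kernel_shift[OF assms(1)] assms(3,4)])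

text \<open>Differentiate under the integral, then integrate by parts at each fixed scale s. The
  result no longer contains the derivative of g, which prepares the passage to continuous g.\<close>

lemma has_derivative_kernel_op_C1:
  fixes g :: "'a::euclidean_space \<Rightarrow> real"
  assumes k: "radial_kernel k k'" and \<sigma>: "continuous_on {0..1} \<sigma>" and "r \<noteq> 0"
    and g: "higher_differentiable_on UNIV g 1"
  shows "(kernel_op \<sigma> k r g has_derivative
    (\<lambda>v. integral kernel_box (\<lambda>w. k' (snd w) v * g (x - (r * \<sigma> (fst w)) *\<^sub>R snd w)) / r)) (at x)"
proof -
  let ?g' = "\<lambda>y. frechet_derivative g (at y)"
  let ?\<tau> = "\<lambda>w. (r * \<sigma> (fst w)) *\<^sub>R snd w"
  have g': "(g has_derivative ?g' y) (at y)" for y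
    using g by (simp add: frechet_derivative_works)
  have cg': "continuous_on S (\<lambda>y. ?g' y v)" for S v
    using g by (auto intro: continuous_on_subset)
  have cg: "continuous_on S g" for S
    using higher_differentiable_on_imp_continuous_on[OF g] continuous_on_subset by blast
  have ck: "\<And>S. continuous_on S k" by (rule radial_kernel_continuous_on[OF k])
  have ck': "\<And>S v. continuous_on S (\<lambda>z. k' z v)"
    using k continuous_on_subset unfolding radial_kernel_def by blast
  have c\<sigma>k: "continuous_on kernel_box (\<lambda>w. \<sigma> (fst w) * k (snd w))"
    by (intro continuous_on_mult continuous_on_fst_box[OF \<sigma>] continuous_on_snd_box ck)
  have "((\<lambda>x. integral kernel_box (\<lambda>w. (\<sigma> (fst w) * k (snd w)) * g (x - ?\<tau> w))) has_derivative
     (\<lambda>v. integral kernel_box (\<lambda>w. (\<sigma> (fst w) * k (snd w)) * ?g' (x - ?\<tau> w) v))) (at x)"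
    unfolding kernel_box_def
    by (rule has_derivative_shifted_integral[where V=UNIV and U=UNIV, OF open_UNIV UNIV_I
          c\<sigma>k[unfolded kernel_box_def] continuous_on_kernel_shift[OF \<sigma>, unfolded kernel_box_def]
          UNIV_I g' cg'])
  moreover have "integral kernel_box (\<lambda>w. (\<sigma> (fst w) * k (snd w)) * ?g' (x - ?\<tau> w) v)
      = integral kernel_box (\<lambda>w. k' (snd w) v * g (x - ?\<tau> w)) / r" for v
  proof -
    have "integral kernel_box (\<lambda>w. (\<sigma> (fst w) * k (snd w)) * ?g' (x - ?\<tau> w) v)
      = integral {0..1} (\<lambda>s. integral kernel_cube
          (\<lambda>z. (\<sigma> s * k z) * ?g' (x - (r * \<sigma> s) *\<^sub>R z) v))"
      by (subst integral_kernel_box[OF continuous_on_kernel_section[OF \<sigma> c\<sigma>k cg'[of UNIV]]]) auto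
    also have "\<dots> = integral {0..1} (\<lambda>s. integral kernel_cube
          (\<lambda>z. k' z v * g (x - (r * \<sigma> s) *\<^sub>R z)) / r)"
    proof (rule integral_cong)
      fix s
      have "integral kernel_cube (\<lambda>z. (\<sigma> s * k z) * ?g' (x - (r * \<sigma> s) *\<^sub>R z) v)
        = \<sigma> s * integral kernel_cube (\<lambda>z. k z * ?g' (x - (r * \<sigma> s) *\<^sub>R z) v)"
        by (simp add: mult.assoc)
      also have "\<dots> = integral kernel_cube (\<lambda>z. k' z v * g (x - (r * \<sigma> s) *\<^sub>R z)) / r"
        using kernel_by_parts[where x=x and \<rho>="r * \<sigma> s" and v=v, OF k open_UNIV UNIV_I g' cg'] \<open>r \<noteq> 0\<close>
        by (simp add: field_simps)
      finally show "integral kernel_cube (\<lambda>z. (\<sigma> s * k z) * ?g' (x - (r * \<sigma> s) *\<^sub>R z) v)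
        = integral kernel_cube (\<lambda>z. k' z v * g (x - (r * \<sigma> s) *\<^sub>R z)) / r" .
    qed
    also have "\<dots> = integral {0..1} (\<lambda>s. integral kernel_cube
          (\<lambda>z. k' z v * g (x - (r * \<sigma> s) *\<^sub>R z))) / r"
      by (simp add: divide_inverse)
    also have "\<dots> = integral kernel_box (\<lambda>w. k' (snd w) v * g (x - ?\<tau> w)) / r"
      by (subst integral_kernel_box[OF continuous_on_kernel_section[OF \<sigma> continuous_on_snd_box[OF ck'] cg[of UNIV]]]) auto
    finally show ?thesis .
  qed
  ultimately show ?thesis unfolding kernel_op_def[abs_def] by simp
qed

text \<open>Expanding v in the basis reduces the bound to finitely many continuous functions on a
  compact cube.\<close>

lemma radial_kernel_derivative_bound:
  assumes "radial_kernel k (k' :: 'a::euclidean_space \<Rightarrow> _)"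
  shows "\<exists>B>0. \<forall>z\<in>kernel_cube. \<forall>v. \<bar>k' z v\<bar> \<le> B * norm v"
proof -
  let ?f = "\<lambda>z. \<Sum>b\<in>Basis. \<bar>k' z b\<bar>"
  have "continuous_on kernel_cube (\<lambda>z. k' z b)" for b
    using assms continuous_on_subset unfolding radial_kernel_def by blast
  then have "continuous_on kernel_cube ?f"
    by (intro continuous_on_sum continuous_on_rabs)
  then have "bounded (?f ` kernel_cube)"
    using compact_kernel_cube compact_continuous_image compact_imp_bounded by blast
  then obtain B where B: "B > 0" "\<And>z. z \<in> kernel_cube \<Longrightarrow> norm (?f z) \<le> B"
    unfolding bounded_pos by blast
  have "\<bar>k' z v\<bar> \<le> B * norm v" if "z \<in> kernel_cube" for z v
  proof -
    have l: "linear (k' z)" by (rule radial_kernel_linear[OF assms])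
    have "k' z v = k' z (\<Sum>b\<in>Basis. (v \<bullet> b) *\<^sub>R b)" by (simp add: euclidean_representation)
    also have "\<dots> = (\<Sum>b\<in>Basis. (v \<bullet> b) * k' z b)" by (simp add: linear_sum[OF l] linear_cmul[OF l])
    finally have "\<bar>k' z v\<bar> \<le> (\<Sum>b\<in>Basis. \<bar>(v \<bullet> b) * k' z b\<bar>)" by (simp add: sum_abs)
    also have "\<dots> \<le> (\<Sum>b\<in>Basis. norm v * \<bar>k' z b\<bar>)"
      by (intro sum_mono) (simp add: abs_mult mult_right_mono Basis_le_norm)
    also have "\<dots> = norm v * ?f z" by (simp add: sum_distrib_left)
    also have "\<dots> \<le> norm v * B" using B(2)[OF that] by (intro mult_left_mono) auto
    finally show ?thesis by (simp add: mult.commute)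
  qed
  with B(1) show ?thesis by blast
qed

lemma integral_kernel_box_bound:
  fixes f :: "real \<times> 'a::euclidean_space \<Rightarrow> real"
  assumes "continuous_on kernel_box f" "\<And>w. w \<in> kernel_box \<Longrightarrow> \<bar>f w\<bar> \<le> B"
  shows "\<bar>integral kernel_box f\<bar> \<le> B * measure lborel (kernel_cube :: 'a set)"
proof -
  have "0 \<in> (kernel_box :: (real \<times> 'a) set)"
    by (auto simp: kernel_box_Times zero_prod_def kernel_cube_def mem_box)
  then have "0 \<le> B" using assms(2)[of 0] by linarith
  then have "norm (integral (cbox (0, - (2 *\<^sub>R One)) (1, 2 *\<^sub>R One)) f)
      \<le> B * measure lborel (cbox (0::real, - (2 *\<^sub>R One)::'a) (1, 2 *\<^sub>R One))"
    using assms unfolding kernel_box_def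
    by (intro integrable_bound integrable_continuous) auto
  then show ?thesis by (simp add: kernel_box_def kernel_cube_def content_Pair)
qed

text \<open>The derivative falls on the kernel, so that a merely continuous \<^term>\<open>g\<close> gains one derivative.\<close>

lemma has_derivative_kernel_op:
  fixes g :: "'a::euclidean_space \<Rightarrow> real"
  assumes k: "radial_kernel k k'" and \<sigma>: "continuous_on {0..1} \<sigma>" and "0 < r"
    and V: "open V" "x0 \<in> V" and cg: "continuous_on U g"
    and sub: "\<And>x w. x \<in> V \<Longrightarrow> w \<in> kernel_box \<Longrightarrow> x - (r * \<sigma> (fst w)) *\<^sub>R snd w \<in> U"
  shows "(kernel_op \<sigma> k r g has_derivative
    (\<lambda>v. integral kernel_box (\<lambda>w. k' (snd w) v * g (x0 - (r * \<sigma> (fst w)) *\<^sub>R snd w)) / r)) (at x0)"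
proof -
  let ?\<tau> = "\<lambda>w. (r * \<sigma> (fst w)) *\<^sub>R snd w"
  obtain e where e: "e > 0" "cball x0 e \<subseteq> V" using V open_contains_cball by blast
  let ?S = "ball x0 e"
  have SV: "x \<in> V" if "x \<in> cball x0 e" for x using e that by auto
  \<comment> \<open>All points at which g is evaluated while x runs through the closed ball. K is
    compact and lies in U, so polynomials approximate g uniformly on it, and for polynomials the
    formula is already known.\<close>
  define K where "K = (\<lambda>p. fst p - ?\<tau> (snd p)) ` (cball x0 e \<times> kernel_box)"
  have ck: "\<And>S. continuous_on S k" by (rule radial_kernel_continuous_on[OF k])
  have ck': "\<And>S v. continuous_on S (\<lambda>z. k' z v)"
    using k continuous_on_subset unfolding radial_kernel_def by blast
  have c\<sigma>k: "continuous_on kernel_box (\<lambda>w. \<sigma> (fst w) * k (snd w))"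
    by (intro continuous_on_mult continuous_on_fst_box[OF \<sigma>] continuous_on_snd_box ck)
  have c\<tau>: "continuous_on kernel_box ?\<tau>" by (rule continuous_on_kernel_shift[OF \<sigma>])
  have "continuous_on (cball x0 e \<times> kernel_box) (\<lambda>p. ?\<tau> (snd p))"
    by (rule continuous_on_compose2[OF c\<tau> continuous_on_snd[OF continuous_on_id]]) auto
  then have "continuous_on (cball x0 e \<times> kernel_box) (\<lambda>p. fst p - ?\<tau> (snd p))"
    by (intro continuous_on_diff continuous_on_fst continuous_on_id)
  then have K: "compact K"
    unfolding K_def by (intro compact_continuous_image compact_Times compact_kernel_box) auto
  have KU: "K \<subseteq> U" using sub SV by (auto simp: K_def)
  have inK: "x - ?\<tau> w \<in> K" if "x \<in> ?S" "w \<in> kernel_box" for x w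
    unfolding K_def using that by (intro image_eqI[of _ _ "(x, w)"]) auto
  have cgK: "continuous_on K g" using cg KU continuous_on_subset by blast
  have "\<exists>p. real_polynomial_function p \<and> (\<forall>y\<in>K. \<bar>g y - p y\<bar> < 1 / real (Suc n))" for n
  proof -
    have pos: "0 < 1 / real (Suc n)" by simp
    obtain q where "real_polynomial_function q" "\<And>y. y \<in> K \<Longrightarrow> \<bar>g y - q y\<bar> < 1 / real (Suc n)"
      by (rule Stone_Weierstrass_real_polynomial_function[OF K cgK pos], rule that, assumption, simp)
    then show ?thesis by (intro exI[of _ q]) simp
  qed
  then obtain p where p0: "\<And>n. real_polynomial_function (p n) \<and> (\<forall>y\<in>K. \<bar>g y - p n y\<bar> < 1 / real (Suc n))"
    using choice[of "\<lambda>n p. real_polynomial_function p \<and> (\<forall>y\<in>K. \<bar>g y - p y\<bar> < 1 / real (Suc n))"]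
    by (auto simp del: of_nat_Suc)
  have p: "real_polynomial_function (p n)" "y \<in> K \<Longrightarrow> \<bar>g y - p n y\<bar> < 1 / real (Suc n)" for n y
    using p0[of n] by auto
  have p1: "higher_differentiable_on UNIV (p n) 1" for n
    by (rule higher_differentiable_on_real_polynomial_function[OF p(1)])
  have cp: "continuous_on S (p n)" for S n
    using higher_differentiable_on_imp_continuous_on[OF p1] continuous_on_subset by blast
  obtain B where B: "B > 0" "\<And>z v. z \<in> kernel_cube \<Longrightarrow> \<bar>k' z v\<bar> \<le> B * norm v"
    using radial_kernel_derivative_bound[OF k] by blast
  have "bounded ((\<lambda>w. \<sigma> (fst w) * k (snd w)) ` kernel_box)"
    using c\<sigma>k compact_kernel_box compact_continuous_image compact_imp_bounded by blast
  then obtain A where A: "A > 0" "\<And>w. w \<in> kernel_box \<Longrightarrow> \<bar>\<sigma> (fst w) * k (snd w)\<bar> \<le> A"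
    unfolding bounded_pos by auto
  define c where "c = measure lborel (kernel_cube :: 'a set)"
  let ?D = "\<lambda>g x v. integral kernel_box (\<lambda>w. k' (snd w) v * g (x - ?\<tau> w)) / r"
  \<comment> \<open>One estimate for both convergences: \<open>\<kappa>\<close> is the weighted
    kernel for the values and the derivative of the kernel for the gradients.\<close>
  have diff: "\<bar>integral kernel_box (\<lambda>w. \<kappa> w * p n (x - ?\<tau> w)) - integral kernel_box (\<lambda>w. \<kappa> w * g (x - ?\<tau> w))\<bar>
      \<le> C * (1 / real (Suc n)) * c"
    if x: "x \<in> ?S" and \<kappa>: "continuous_on kernel_box \<kappa>" "\<And>w. w \<in> kernel_box \<Longrightarrow> \<bar>\<kappa> w\<bar> \<le> C"
    for \<kappa> C n x
  proof -
    have c1: "continuous_on kernel_box (\<lambda>w. \<kappa> w * p n (x - ?\<tau> w))"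
      by (rule continuous_on_shifted_product_section[OF \<kappa>(1) c\<tau> cp[of UNIV]]) auto
    have c2: "continuous_on kernel_box (\<lambda>w. \<kappa> w * g (x - ?\<tau> w))"
      by (rule continuous_on_shifted_product_section[OF \<kappa>(1) c\<tau> cgK inK[OF x]])
    have "integral kernel_box (\<lambda>w. \<kappa> w * p n (x - ?\<tau> w)) - integral kernel_box (\<lambda>w. \<kappa> w * g (x - ?\<tau> w))
       = integral kernel_box (\<lambda>w. \<kappa> w * p n (x - ?\<tau> w) - \<kappa> w * g (x - ?\<tau> w))"
      using c1 c2 unfolding kernel_box_def
      by (intro integral_diff[symmetric] integrable_continuous)
    moreover have "\<bar>\<dots>\<bar> \<le> C * (1 / real (Suc n)) * c"
      unfolding c_def
    proof (rule integral_kernel_box_bound[OF continuous_on_diff[OF c1 c2]])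
      fix w :: "real \<times> 'a" assume w: "w \<in> kernel_box"
      have "\<bar>\<kappa> w * p n (x - ?\<tau> w) - \<kappa> w * g (x - ?\<tau> w)\<bar> = \<bar>\<kappa> w\<bar> * \<bar>g (x - ?\<tau> w) - p n (x - ?\<tau> w)\<bar>"
        unfolding right_diff_distrib[symmetric] abs_mult by (simp only: abs_minus_commute)
      also have "\<dots> \<le> C * (1 / real (Suc n))"
        using \<kappa>(2)[OF w] p(2)[OF inK[OF x w], of n] by (intro mult_mono) auto
      finally show "\<bar>\<kappa> w * p n (x - ?\<tau> w) - \<kappa> w * g (x - ?\<tau> w)\<bar> \<le> C * (1 / real (Suc n))" .
    qed
    ultimately show ?thesis by simp
  qed
  have lim: "(\<lambda>n. kernel_op \<sigma> k r (p n) x) \<longlonglongrightarrow> kernel_op \<sigma> k r g x" if "x \<in> ?S" for x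
  proof (rule LIM_zero_cancel, rule Lim_null_comparison)
    show "\<forall>\<^sub>F n in sequentially. norm (kernel_op \<sigma> k r (p n) x - kernel_op \<sigma> k r g x)
        \<le> A * (1 / real (Suc n)) * c"
      using diff[OF that c\<sigma>k A(2)] by (auto simp: kernel_op_def)
    show "(\<lambda>n. A * (1 / real (Suc n)) * c) \<longlonglongrightarrow> 0"
      using tendsto_mult[OF tendsto_mult[OF tendsto_const[of A] LIMSEQ_inverse_real_of_nat] tendsto_const[of c]]
      by (simp add: inverse_eq_divide)
  qed
  \<comment> \<open>Derivatives that converge uniformly and values that converge at one point give a
    differentiable limit with the limit derivative.\<close>
  have "\<exists>G. \<forall>x\<in>?S. (\<lambda>n. kernel_op \<sigma> k r (p n) x) \<longlonglongrightarrow> G x \<and> (G has_derivative ?D g x) (at x within ?S)"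
  proof (rule has_derivative_sequence)
    show "convex ?S" by simp
    show "x0 \<in> ?S" using e by simp
    show "(kernel_op \<sigma> k r (p n) has_derivative ?D (p n) x) (at x within ?S)" for n x
      by (rule has_derivative_at_withinI[OF has_derivative_kernel_op_C1[OF k \<sigma> less_imp_neq[OF \<open>0 < r\<close>, symmetric] p1]])
    show "(\<lambda>n. kernel_op \<sigma> k r (p n) x0) \<longlonglongrightarrow> kernel_op \<sigma> k r g x0" using lim e by simp
    fix \<epsilon> :: real assume "\<epsilon> > 0"
    have "(\<lambda>n. B * (1 / real (Suc n)) * c / r) \<longlonglongrightarrow> 0"
      using tendsto_divide[OF tendsto_mult[OF tendsto_mult[OF tendsto_const[of B] LIMSEQ_inverse_real_of_nat]
            tendsto_const[of c]] tendsto_const[of r]] \<open>0 < r\<close>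
      by (simp add: inverse_eq_divide)
    then have "\<forall>\<^sub>F n in sequentially. B * (1 / real (Suc n)) * c / r < \<epsilon>"
      using \<open>\<epsilon> > 0\<close> by (rule order_tendstoD)
    then show "\<forall>\<^sub>F n in sequentially. \<forall>x\<in>?S. \<forall>v. norm (?D (p n) x v - ?D g x v) \<le> \<epsilon> * norm v"
    proof (rule eventually_mono, intro ballI allI)
      fix n x v assume n: "B * (1 / real (Suc n)) * c / r < \<epsilon>" and x: "x \<in> ?S"
      have "\<bar>k' (snd w) v\<bar> \<le> B * norm v" if "w \<in> kernel_box" for w :: "real \<times> 'a"
        using that by (intro B(2)) (auto simp: kernel_box_Times)
      from divide_right_mono[OF diff[OF x continuous_on_snd_box[OF ck'] this, of n], of r]
      have "norm (?D (p n) x v - ?D g x v) \<le> B * norm v * (1 / real (Suc n)) * c / r"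
        using \<open>0 < r\<close> by (simp add: diff_divide_distrib[symmetric])
      also have "\<dots> = (B * (1 / real (Suc n)) * c / r) * norm v" by simp
      also have "\<dots> \<le> \<epsilon> * norm v" using n by (intro mult_right_mono) auto
      finally show "norm (?D (p n) x v - ?D g x v) \<le> \<epsilon> * norm v" .
    qed
  qed
  then obtain G where G: "\<forall>x\<in>?S. (\<lambda>n. kernel_op \<sigma> k r (p n) x) \<longlonglongrightarrow> G x
      \<and> (G has_derivative ?D g x) (at x within ?S)" ..
  have eq: "G x = kernel_op \<sigma> k r g x" if "x \<in> ?S" for x
    using LIMSEQ_unique[OF conjunct1[OF bspec[OF G that]] lim[OF that]] .
  have x0S: "x0 \<in> ?S" using e by simp
  have "(G has_derivative ?D g x0) (at x0 within ?S)"
    by (rule conjunct2[OF bspec[OF G x0S]])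
  then have "(G has_derivative ?D g x0) (at x0)"
    unfolding at_within_open[OF x0S open_ball] .
  then show ?thesis
    by (rule has_derivative_transform_within_open[OF _ open_ball[of x0 e] x0S eq])
qed

section \<open>Weak solutions of the Poisson equation\<close>

text \<open>The total mass of the averaging kernel, which makes \<open>mean_op\<close> fix
  constants. The potential is divided by the same number because the identity between the two is
  normalised as a whole.\<close>

definition kernel_mass :: "'a::euclidean_space itself \<Rightarrow> real" where
  "kernel_mass _ = integral (kernel_box :: (real \<times> 'a) set) (\<lambda>w. 6 * bump 2 (snd w))"

text \<open>The kernel \<open>6 * bump 2 z\<close> is what remains of the gradient of
  \<open>bump 3\<close> after the factor -z is taken out. The scale coordinate is a dummy here; it
  only lets the mean and the potential share \<open>kernel_op\<close>.\<close>

definition mean_op :: "real \<Rightarrow> ('a::euclidean_space \<Rightarrow> real) \<Rightarrow> 'a \<Rightarrow> real" where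
  "mean_op r u x = kernel_op (\<lambda>_. 1) (\<lambda>z. 6 * bump 2 z) r u x / kernel_mass TYPE('a)"

definition pot_op :: "real \<Rightarrow> ('a::euclidean_space \<Rightarrow> real) \<Rightarrow> 'a \<Rightarrow> real" where
  "pot_op r g x = r\<^sup>2 * kernel_op (\<lambda>s. s) (bump 3) r g x / kernel_mass TYPE('a)"

text \<open>The whole cube is required, since the integrals run over it. By
  \<open>kernel_cube_scale\<close> all smaller scales then fit too.\<close>

definition fits :: "'a::euclidean_space set \<Rightarrow> real \<Rightarrow> 'a \<Rightarrow> bool" where
  "fits U r x \<longleftrightarrow> 0 < r \<and> (\<forall>z\<in>kernel_cube. x - r *\<^sub>R z \<in> U)"

text \<open>Because the gradient of \<^term>\<open>bump 3\<close> at \<open>z\<close> is \<open>-6 bump 2 z\<close> times \<open>z\<close>, the derivative in \<open>s\<close> of the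
  average of \<open>v\<close> at scale \<open>s\<close> is an average of the Laplacian of \<open>v\<close>. The resulting identity makes
  sense for continuous \<open>v\<close> and \<open>g\<close> and serves as weak form of \<open>\<Delta> v = g\<close>.\<close>

definition weak_solution :: "'a::euclidean_space set \<Rightarrow> ('a \<Rightarrow> real) \<Rightarrow> ('a \<Rightarrow> real) \<Rightarrow> bool" where
  "weak_solution U v g \<longleftrightarrow> continuous_on U v \<and> continuous_on U g \<and>
     (\<forall>x r. fits U r x \<longrightarrow> v x = mean_op r v x - pot_op r g x)"

lemma continuous_on_bump_snd: "continuous_on kernel_box (\<lambda>w. c * bump k (snd w))"
  by (intro continuous_on_mult continuous_on_const continuous_on_snd_box continuous_on_bump)

lemma continuous_on_fst_bump_snd: "continuous_on kernel_box (\<lambda>w. fst w * bump k (snd w))"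
  by (intro continuous_on_mult continuous_on_fst continuous_on_id continuous_on_snd_box continuous_on_bump)

lemma integral_kernel_box_pos:
  fixes f :: "real \<times> 'a::euclidean_space \<Rightarrow> real"
  assumes "continuous_on (kernel_box :: (real \<times> 'a::euclidean_space) set) f"
    and "\<And>w. w \<in> kernel_box \<Longrightarrow> 0 \<le> f w" "w \<in> kernel_box" "0 < f w"
  shows "0 < integral kernel_box f"
proof -
  have ge: "0 \<le> integral kernel_box f"
    using assms(1,2) unfolding kernel_box_def by (intro integral_nonneg integrable_continuous) auto
  have ne: "box (0::real, - (2 *\<^sub>R One) :: 'a) (1, 2 *\<^sub>R One) \<noteq> {}"
    by (auto simp: box_ne_empty Basis_prod_def)
  have "integral kernel_box f \<noteq> 0"
    using integral_cbox_eq_0_iff[of "(0, - (2 *\<^sub>R One))" "(1, 2 *\<^sub>R One)" f] assms ne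
    unfolding kernel_box_def by force
  with ge show ?thesis by simp
qed

lemma zero_mem_kernel_cube: "0 \<in> kernel_cube"
  by (rule mem_kernel_cube) simp

lemma kernel_mass_pos: "0 < kernel_mass TYPE('a::euclidean_space)"
  unfolding kernel_mass_def
proof (rule integral_kernel_box_pos[OF continuous_on_bump_snd])
  show "(0, 0) \<in> (kernel_box :: (real \<times> 'a) set)" by (simp add: kernel_box_Times zero_mem_kernel_cube)
qed (auto simp: bump_nonneg bump_pos)

lemma pot_mass_pos: "0 < integral (kernel_box :: (real \<times> 'a::euclidean_space) set) (\<lambda>w. fst w * bump 3 (snd w))"
proof (rule integral_kernel_box_pos[OF continuous_on_fst_bump_snd])
  show "(1, 0) \<in> (kernel_box :: (real \<times> 'a) set)" by (simp add: kernel_box_Times zero_mem_kernel_cube)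
qed (auto simp: bump_nonneg bump_pos kernel_box_Times)

lemma fits_subset: "fits V r x \<Longrightarrow> V \<subseteq> U \<Longrightarrow> fits U r x"
  by (auto simp: fits_def)

lemma fitsD:
  assumes "fits U r x" "0 \<le> s" "s \<le> 1" "z \<in> kernel_cube"
  shows "x - (r * s) *\<^sub>R z \<in> U"
  using assms kernel_cube_scale[OF assms(2-4)] unfolding fits_def by (metis scaleR_scaleR)

lemma fits_mem: "fits U r x \<Longrightarrow> x \<in> U"
  using fitsD[of U r x 0 0] zero_mem_kernel_cube by simp

lemma fitsD_const:
  "fits U r x \<Longrightarrow> w \<in> kernel_box \<Longrightarrow> x - (r * 1) *\<^sub>R snd w \<in> U"
  by (rule fitsD) (auto simp: kernel_box_Times)

lemma fitsD_fst:
  "fits U r x \<Longrightarrow> w \<in> kernel_box \<Longrightarrow> x - (r * fst w) *\<^sub>R snd w \<in> U"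
  by (rule fitsD) (auto simp: kernel_box_Times)

lemma fits_nhds:
  assumes "open U" "x \<in> U"
  shows "\<exists>e>0. \<forall>r y. 0 < r \<longrightarrow> r < e \<longrightarrow> dist y x < e \<longrightarrow> fits U r y"
proof -
  obtain d where d: "d > 0" "ball x d \<subseteq> U" using assms openE by blast
  obtain B where B: "B > 0" "\<And>z::'a. z \<in> kernel_cube \<Longrightarrow> norm z \<le> B"
    using bounded_kernel_cube by blast
  \<comment> \<open>Moving the centre costs at most e and the scaled cube at most e B, together
    d.\<close>
  define e where "e = d / (B + 1)"
  have e: "e > 0" "e * (B + 1) = d" using d B by (auto simp: e_def)
  have "fits U r y" if r: "0 < r" "r < e" and y: "dist y x < e" for r y
    unfolding fits_def
  proof (intro conjI ballI)
    fix z :: 'a assume z: "z \<in> kernel_cube"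
    have "norm (r *\<^sub>R z) \<le> e * B"
      using r B z e by (simp add: mult_mono)
    moreover have "dist x (y - r *\<^sub>R z) \<le> dist y x + norm (r *\<^sub>R z)"
      using norm_triangle_ineq[of "x - y" "r *\<^sub>R z"] by (simp add: dist_norm norm_minus_commute algebra_simps)
    ultimately have "dist x (y - r *\<^sub>R z) < d" using y e(2) by (simp add: algebra_simps)
    then show "y - r *\<^sub>R z \<in> U" using d by (auto simp: subset_iff)
  qed (use r in auto)
  with e(1) show ?thesis by blast
qed

lemma fits_small:
  assumes "open U" "x \<in> U"
  shows "\<exists>e>0. \<forall>r. 0 < r \<longrightarrow> r < e \<longrightarrow> fits U r x"
  using fits_nhds[OF assms] by (metis dist_self)

lemma continuous_on_mean_integrand:
  assumes "fits U r x" "continuous_on U u"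
  shows "continuous_on kernel_box (\<lambda>w. 1 * (6 * bump 2 (snd w)) * u (x - (r * 1) *\<^sub>R snd w))"
  by (rule continuous_on_kernel_section[where \<sigma>="\<lambda>_. 1", OF continuous_on_const _ assms(2) fitsD_const[OF assms(1)]])
     (simp add: continuous_on_bump_snd)

lemma continuous_on_pot_integrand:
  assumes "fits U r x" "continuous_on U u"
  shows "continuous_on kernel_box (\<lambda>w. fst w * bump 3 (snd w) * u (x - (r * fst w) *\<^sub>R snd w))"
  by (rule continuous_on_kernel_section[where \<sigma>="\<lambda>s. s", OF continuous_on_id continuous_on_fst_bump_snd
        assms(2) fitsD_fst[OF assms(1)]])

lemmas integrable_mean = integrable_continuous[OF continuous_on_mean_integrand[unfolded kernel_box_def], folded kernel_box_def]
lemmas integrable_pot = integrable_continuous[OF continuous_on_pot_integrand[unfolded kernel_box_def], folded kernel_box_def]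

lemma mean_op_mono:
  fixes x :: "'a::euclidean_space"
  assumes "fits U r x" "continuous_on U u" "continuous_on U v" "\<And>y. y \<in> U \<Longrightarrow> u y \<le> v y"
  shows "mean_op r u x \<le> mean_op r v x"
  unfolding mean_op_def kernel_op_def
proof (intro divide_right_mono integral_le integrable_mean[OF assms(1)] assms(2,3))
  fix w :: "real \<times> 'a" assume "w \<in> kernel_box"
  then show "1 * (6 * bump 2 (snd w)) * u (x - (r * 1) *\<^sub>R snd w)
      \<le> 1 * (6 * bump 2 (snd w)) * v (x - (r * 1) *\<^sub>R snd w)"
    using assms(4)[OF fitsD_const[OF assms(1)]] by (intro mult_left_mono) (auto simp: bump_nonneg)
qed (use kernel_mass_pos[where 'a='a] in simp)

lemma pot_op_mono:
  fixes x :: "'a::euclidean_space"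
  assumes "fits U r x" "continuous_on U u" "continuous_on U v" "\<And>y. y \<in> U \<Longrightarrow> u y \<le> v y"
  shows "pot_op r u x \<le> pot_op r v x"
  unfolding pot_op_def kernel_op_def
proof (rule divide_right_mono, rule mult_left_mono, rule integral_le)
  show "(\<lambda>w. fst w * bump 3 (snd w) * u (x - (r * fst w) *\<^sub>R snd w)) integrable_on kernel_box"
    "(\<lambda>w. fst w * bump 3 (snd w) * v (x - (r * fst w) *\<^sub>R snd w)) integrable_on kernel_box"
    by (intro integrable_pot[OF assms(1)] assms(2,3))+
  fix w :: "real \<times> 'a" assume w: "w \<in> kernel_box"
  then show "fst w * bump 3 (snd w) * u (x - (r * fst w) *\<^sub>R snd w)
      \<le> fst w * bump 3 (snd w) * v (x - (r * fst w) *\<^sub>R snd w)"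
    using assms(4)[OF fitsD_fst[OF assms(1) w]]
    by (intro mult_left_mono mult_nonneg_nonneg) (auto simp: bump_nonneg kernel_box_Times)
qed (use kernel_mass_pos[where 'a='a] in simp_all)

lemma mean_op_const: "mean_op r (\<lambda>_. c) x = c"
  using kernel_mass_pos[where 'a='a]
  by (simp add: mean_op_def kernel_op_def kernel_mass_def)

lemma mean_op_diff:
  assumes "fits U r x" "continuous_on U u" "continuous_on U v"
  shows "mean_op r (\<lambda>y. u y - v y) x = mean_op r u x - mean_op r v x"
  using integral_diff[OF integrable_mean[OF assms(1,2)] integrable_mean[OF assms(1,3)]]
  by (simp add: mean_op_def kernel_op_def diff_divide_distrib right_diff_distrib)

lemma pot_op_diff:
  assumes "fits U r x" "continuous_on U u" "continuous_on U v"
  shows "pot_op r (\<lambda>y. u y - v y) x = pot_op r u x - pot_op r v x"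
  using integral_diff[OF integrable_pot[OF assms(1,2)] integrable_pot[OF assms(1,3)]]
  by (simp add: pot_op_def kernel_op_def diff_divide_distrib right_diff_distrib)

lemma mean_op_cong:
  fixes x :: "'a::euclidean_space"
  assumes "fits U r x" "\<And>y. y \<in> U \<Longrightarrow> u y = v y"
  shows "mean_op r u x = mean_op r v x"
proof -
  have "integral kernel_box (\<lambda>w. 1 * (6 * bump 2 (snd w)) * u (x - (r * 1) *\<^sub>R snd w))
      = integral kernel_box (\<lambda>w. 1 * (6 * bump 2 (snd w)) * v (x - (r * 1) *\<^sub>R snd w))"
    using assms(2)[OF fitsD_const[OF assms(1)]] by (intro integral_cong) simp
  then show ?thesis by (simp only: mean_op_def kernel_op_def)
qed

lemma pot_op_cong:
  fixes x :: "'a::euclidean_space"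
  assumes "fits U r x" "\<And>y. y \<in> U \<Longrightarrow> u y = v y"
  shows "pot_op r u x = pot_op r v x"
proof -
  have "integral kernel_box (\<lambda>w. fst w * bump 3 (snd w) * u (x - (r * fst w) *\<^sub>R snd w))
      = integral kernel_box (\<lambda>w. fst w * bump 3 (snd w) * v (x - (r * fst w) *\<^sub>R snd w))"
    using assms(2)[OF fitsD_fst[OF assms(1)]] by (intro integral_cong) simp
  then show ?thesis by (simp only: pot_op_def kernel_op_def)
qed

lemma weak_solution_subset:
  assumes "weak_solution U v g" "V \<subseteq> U"
  shows "weak_solution V v g"
  using assms(1) fits_subset[OF _ assms(2)]
    continuous_on_subset[of U v V] continuous_on_subset[of U g V] assms(2)
  unfolding weak_solution_def by simp

lemma weak_solution_cong:
  assumes "weak_solution U v g" "\<And>x. x \<in> U \<Longrightarrow> v x = v' x" "\<And>x. x \<in> U \<Longrightarrow> g x = g' x"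
  shows "weak_solution U v' g'"
proof -
  have "v' x = mean_op r v' x - pot_op r g' x" if f: "fits U r x" for x r
    using assms(1) f mean_op_cong[OF f assms(2)] pot_op_cong[OF f assms(3)] assms(2)[OF fits_mem[OF f]]
    unfolding weak_solution_def by simp
  moreover have "continuous_on U v'" "continuous_on U g'"
    using assms continuous_on_eq unfolding weak_solution_def by blast+
  ultimately show ?thesis unfolding weak_solution_def by blast
qed

lemma weak_solution_diff:
  assumes "weak_solution U v g" "weak_solution U w h"
  shows "weak_solution U (\<lambda>x. v x - w x) (\<lambda>x. g x - h x)"
  using assms mean_op_diff[of U] pot_op_diff[of U]
  unfolding weak_solution_def by (simp add: continuous_on_diff)

section \<open>Classical solutions, weak solutions and the gain of one derivative\<close>

lemma higher_differentiable_on_2D: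
  assumes "higher_differentiable_on U v 2"
  shows "\<And>y. y \<in> U \<Longrightarrow> (v has_derivative frechet_derivative v (at y)) (at y)"
    and "\<And>y b. y \<in> U \<Longrightarrow> ((\<lambda>y. frechet_derivative v (at y) b) has_derivative
          frechet_derivative (\<lambda>y. frechet_derivative v (at y) b) (at y)) (at y)"
    and "\<And>b c. continuous_on U (\<lambda>y. frechet_derivative (\<lambda>y. frechet_derivative v (at y) b) (at y) c)"
    and "\<And>b. continuous_on U (\<lambda>y. frechet_derivative v (at y) b)"
    and "continuous_on U (laplacian v)" and "continuous_on U v"
proof -
  show "continuous_on U v" by (rule higher_differentiable_on_imp_continuous_on[OF assms])
  show "(v has_derivative frechet_derivative v (at y)) (at y)" if "y \<in> U" for y
    using assms that by (simp add: numeral_2_eq_2 frechet_derivative_works)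
  show "((\<lambda>y. frechet_derivative v (at y) b) has_derivative
          frechet_derivative (\<lambda>y. frechet_derivative v (at y) b) (at y)) (at y)" if "y \<in> U" for y b
    using assms that by (simp add: numeral_2_eq_2 frechet_derivative_works)
  show 1: "continuous_on U (\<lambda>y. frechet_derivative (\<lambda>y. frechet_derivative v (at y) b) (at y) c)" for b c
    using assms by (simp add: numeral_2_eq_2)
  have "higher_differentiable_on U (\<lambda>y. frechet_derivative v (at y) b) 1" for b
    using assms by (simp add: numeral_2_eq_2)
  then show "continuous_on U (\<lambda>y. frechet_derivative v (at y) b)" for b
    by (rule higher_differentiable_on_imp_continuous_on)
  show "continuous_on U (laplacian v)"
    unfolding laplacian_def[abs_def] by (intro continuous_on_sum 1)
qed


lemma weak_solution_laplacian:
  fixes v :: "'a::euclidean_space \<Rightarrow> real"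
  assumes U: "open U" and v: "higher_differentiable_on U v 2"
  shows "weak_solution U v (laplacian v)"
  unfolding weak_solution_def
proof (intro conjI allI impI)
  note v' = higher_differentiable_on_2D[OF v]
  show "continuous_on U v" "continuous_on U (laplacian v)" by (rule v')+
  fix x :: 'a and r assume f: "fits U r x"
  define eta where "eta = (\<lambda>z::'a. 6 * bump 2 z)"
  define M' where "M' = (\<lambda>z b::'a. - (z \<bullet> b) * eta z)"
  have M: "radial_kernel (bump 3) M'"
    using radial_kernel_bump[of 1, where 'a='a]
    by (simp add: M'_def eta_def numeral_3_eq_3 numeral_2_eq_2 mult_ac)
  let ?Dv = "\<lambda>b y. frechet_derivative v (at y) b"
  let ?DDv = "\<lambda>b y. frechet_derivative (?Dv b) (at y) b"
  have ceta: "continuous_on S eta" for S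
    unfolding eta_def by (intro continuous_on_mult continuous_on_const continuous_on_bump)
  have cM': "continuous_on S (\<lambda>z. M' z b)" for S b
    unfolding M'_def by (intro continuous_intros ceta)
  have inU: "x - (r * s) *\<^sub>R z \<in> U" if "s \<in> {0..1}" "z \<in> kernel_cube" for s z
    using fitsD[OF f _ _ that(2)] that(1) by simp
  \<comment> \<open>The unnormalised average at scale r s. At s = 0 it is the mass times v x and at
    s = 1 the mean, so the claim is the fundamental theorem of calculus for
    \<open>\<phi>\<close>.\<close>
  define \<phi> where "\<phi> = (\<lambda>s. integral kernel_cube (\<lambda>z. eta z * v (x - (r * s) *\<^sub>R z)))"
  define \<phi>' where "\<phi>' = (\<lambda>s. r\<^sup>2 * (s * integral kernel_cube
      (\<lambda>z. bump 3 z * laplacian v (x - (r * s) *\<^sub>R z))))"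
  let ?fx = "\<lambda>s z. r * (\<Sum>b\<in>Basis. M' z b * ?Dv b (x - (r * s) *\<^sub>R z))"
  have aff: "continuous_on ({0..1} \<times> kernel_cube) (\<lambda>p. x - (r * fst p) *\<^sub>R snd p)"
    by (intro continuous_intros)
  have comp: "continuous_on ({0..1} \<times> kernel_cube) (\<lambda>p. h (x - (r * fst p) *\<^sub>R snd p))"
    if "continuous_on U h" for h :: "'a \<Rightarrow> real"
    by (rule continuous_on_compose2[OF that aff]) (use inU in auto)
  have sect: "continuous_on kernel_cube (\<lambda>z. h (x - (r * s) *\<^sub>R z))"
    if "continuous_on U h" "s \<in> {0..1}" for h :: "'a \<Rightarrow> real" and s
    by (rule continuous_on_compose2[OF that(1)]) (use inU that(2) in \<open>auto intro!: continuous_intros\<close>)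
  have snd': "continuous_on ({0..1} \<times> kernel_cube) (\<lambda>p. h (snd p))"
    if "\<And>S. continuous_on S h" for h :: "'a \<Rightarrow> real"
    by (rule continuous_on_compose2[OF that[of UNIV] continuous_on_snd[OF continuous_on_id]]) auto
  have deriv: "(\<phi> has_real_derivative \<phi>' s) (at s within {0..1})" if s: "s \<in> {0..1}" for s
  proof -
    have "(\<phi> has_real_derivative integral kernel_cube (?fx s)) (at s within {0..1})"
      unfolding \<phi>_def kernel_cube_def
    proof (rule leibniz_rule_field_derivative[where fx="?fx"])
      fix s :: real and z :: 'a assume sz: "s \<in> {0..1}" "z \<in> cbox (- (2 *\<^sub>R One)) (2 *\<^sub>R One)"
      let ?y = "x - (r * s) *\<^sub>R z"
      have y: "?y \<in> U" using inU sz by (simp add: kernel_cube_def)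
      have l: "((\<lambda>s. x - (r * s) *\<^sub>R z) has_derivative (\<lambda>t. - (r * t) *\<^sub>R z)) (at s within {0..1})"
        by (auto intro!: derivative_eq_intros simp: scaleR_minus_left)
      have lin: "linear (frechet_derivative v (at ?y))"
        by (rule has_derivative_linear[OF v'(1)[OF y]])
      have "frechet_derivative v (at ?y) z = (\<Sum>b\<in>Basis. (z \<bullet> b) * ?Dv b ?y)"
        by (subst euclidean_representation[of z, symmetric], subst linear_sum[OF lin])
           (simp add: linear_cmul[OF lin])
      then have eq: "eta z * (- (r * t) * frechet_derivative v (at ?y) z) = ?fx s z * t" for t
        by (simp add: M'_def sum_distrib_left sum_distrib_right mult_ac sum_negf)
      have "((\<lambda>s. eta z * v (x - (r * s) *\<^sub>R z)) has_derivative
          (\<lambda>t. eta z * frechet_derivative v (at ?y) (- (r * t) *\<^sub>R z))) (at s within {0..1})"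
        by (intro has_derivative_mult_right has_derivative_compose[OF l v'(1)[OF y]])
      then show "((\<lambda>s. eta z * v (x - (r * s) *\<^sub>R z)) has_real_derivative ?fx s z) (at s within {0..1})"
        unfolding has_field_derivative_def linear_cmul[OF lin] real_scaleR_def eq .
    next
      fix s :: real assume "s \<in> {0..1}"
      then show "(\<lambda>z. eta z * v (x - (r * s) *\<^sub>R z)) integrable_on cbox (- (2 *\<^sub>R One)) (2 *\<^sub>R One)"
        using sect[OF v'(6)] unfolding kernel_cube_def
        by (intro integrable_continuous continuous_on_mult ceta)
    next
      show "continuous_on ({0..1} \<times> cbox (- (2 *\<^sub>R One)) (2 *\<^sub>R One)) (\<lambda>(s, z). ?fx s z)"
        unfolding split_beta kernel_cube_def[symmetric]
        by (intro continuous_on_mult continuous_on_const continuous_on_sum snd'[OF cM'] comp v'(4))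
    qed (use s in auto)
    moreover have "integral kernel_cube (?fx s) = \<phi>' s"
    proof -
      have int: "(\<lambda>z. h z * k (x - (r * s) *\<^sub>R z)) integrable_on kernel_cube"
        if "\<And>S. continuous_on S h" "continuous_on U k" for h k :: "'a \<Rightarrow> real"
        using continuous_on_mult[OF that(1) sect[OF that(2) s]]
        unfolding kernel_cube_def by (rule integrable_continuous)
      \<comment> \<open>\<open>M'\<close> is the gradient of \<open>bump 3\<close>; integration by
        parts in each coordinate moves it onto the first derivatives of v, and the sum over the
        basis is the Laplacian.\<close>
      have parts: "integral kernel_cube (\<lambda>z. M' z b * ?Dv b (x - (r * s) *\<^sub>R z))
          = (r * s) * integral kernel_cube (\<lambda>z. bump 3 z * ?DDv b (x - (r * s) *\<^sub>R z))" for b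
      proof (rule kernel_by_parts[OF M U _ v'(2) v'(3)])
        show "x - (r * s) *\<^sub>R z \<in> U" if "norm z \<le> 1" for z
          by (rule inU[OF s mem_kernel_cube]) (use that in simp)
      qed
      have "integral kernel_cube (?fx s) = r * (\<Sum>b\<in>Basis. integral kernel_cube (\<lambda>z. M' z b * ?Dv b (x - (r * s) *\<^sub>R z)))"
        by (simp add: integral_sum int[OF cM' v'(4)])
      also have "\<dots> = r * (\<Sum>b\<in>Basis. (r * s) * integral kernel_cube (\<lambda>z. bump 3 z * ?DDv b (x - (r * s) *\<^sub>R z)))"
        unfolding parts ..
      also have "\<dots> = r\<^sup>2 * (s * (\<Sum>b\<in>Basis. integral kernel_cube (\<lambda>z. bump 3 z * ?DDv b (x - (r * s) *\<^sub>R z))))"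
        by (simp add: sum_distrib_left power2_eq_square mult_ac)
      also have "(\<Sum>b\<in>Basis. integral kernel_cube (\<lambda>z. bump 3 z * ?DDv b (x - (r * s) *\<^sub>R z)))
          = integral kernel_cube (\<lambda>z. \<Sum>b\<in>Basis. bump 3 z * ?DDv b (x - (r * s) *\<^sub>R z))"
        by (rule integral_sum[symmetric]) (auto intro: int[OF continuous_on_bump v'(3)])
      finally show ?thesis by (simp add: \<phi>'_def laplacian_def sum_distrib_left)
    qed
    ultimately show ?thesis by simp
  qed
  then have "(\<phi>' has_integral \<phi> 1 - \<phi> 0) {0..1}"
    by (intro fundamental_theorem_of_calculus) (auto simp: has_real_derivative_iff_has_vector_derivative)
  then have 1: "integral {0..1} \<phi>' = \<phi> 1 - \<phi> 0" by (rule integral_unique)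
  have 2: "integral {0..1} \<phi>' = r\<^sup>2 * kernel_op (\<lambda>s. s) (bump 3) r (laplacian v) x"
    unfolding kernel_op_def
    by (subst integral_kernel_box[OF continuous_on_pot_integrand[OF f v'(5)]]) (simp add: \<phi>'_def mult.assoc)
  have 3: "kernel_op (\<lambda>_. 1) (\<lambda>z. 6 * bump 2 z) r v x = \<phi> 1"
    using integral_kernel_box_snd[of "\<lambda>z. eta z * v (x - r *\<^sub>R z)"]
      continuous_on_mult[OF ceta sect[OF v'(6), of 1]]
    by (simp add: kernel_op_def \<phi>_def eta_def)
  have 4: "kernel_mass TYPE('a) * v x = \<phi> 0"
    using integral_kernel_box_snd[OF ceta] by (simp add: kernel_mass_def \<phi>_def eta_def)
  show "v x = mean_op r v x - pot_op r (laplacian v) x"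
    using 1 2 3 4 kernel_mass_pos[where 'a='a] by (simp add: mean_op_def pot_op_def field_simps)
qed

lemma has_derivative_mean_op:
  fixes x0 :: "'a::euclidean_space"
  assumes "0 < r" "open V" "x0 \<in> V" "continuous_on U g" "\<And>x. x \<in> V \<Longrightarrow> fits U r x"
  shows "((\<lambda>x. kernel_op (\<lambda>_. 1) (\<lambda>z. 6 * bump 2 z) r g x) has_derivative
    (\<lambda>v. integral kernel_box (\<lambda>w. (6 * - (2 * 2 * (snd w \<bullet> v) * bump 1 (snd w)))
        * g (x0 - (r * 1) *\<^sub>R snd w)) / r)) (at x0)"
proof -
  have "radial_kernel (\<lambda>z::'a. 6 * bump 2 z) (\<lambda>z v. 6 * - (2 * 2 * (z \<bullet> v) * bump 1 z))"
    using radial_kernel_cmult[OF radial_kernel_bump[of 0, where 'a='a], of 6] by (simp add: numeral_2_eq_2)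
  from has_derivative_kernel_op[OF this continuous_on_const assms(1-4) fitsD_const[OF assms(5)]]
  show ?thesis .
qed

lemma has_derivative_pot_op:
  fixes x0 :: "'a::euclidean_space"
  assumes "0 < r" "open V" "x0 \<in> V" "continuous_on U g" "\<And>x. x \<in> V \<Longrightarrow> fits U r x"
  shows "((\<lambda>x. kernel_op (\<lambda>s. s) (bump 3) r g x) has_derivative
    (\<lambda>v. integral kernel_box (\<lambda>w. (- (2 * 3 * (snd w \<bullet> v) * bump 2 (snd w)))
        * g (x0 - (r * fst w) *\<^sub>R snd w)) / r)) (at x0)"
proof -
  have "radial_kernel (bump 3 :: 'a \<Rightarrow> _) (\<lambda>z v. - (2 * 3 * (z \<bullet> v) * bump 2 z))"
    using radial_kernel_bump[of 1, where 'a='a] by (simp add: numeral_3_eq_3 numeral_2_eq_2)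
  from has_derivative_kernel_op[OF this continuous_on_id assms(1-4) fitsD_fst[OF assms(5)]]
  show ?thesis .
qed

lemma higher_differentiable_on_divide:
  fixes f :: "'a::real_normed_vector \<Rightarrow> real"
  assumes "open S" "higher_differentiable_on S f k"
  shows "higher_differentiable_on S (\<lambda>x. f x / c) k"
  using higher_differentiable_on_cmult[OF assms, of "1 / c"] by simp

text \<open>In v = mean - potential both terms carry a kernel that can absorb one derivative, and
  the resulting integrals are as smooth as v and g. The scale r is fixed for a whole neighbourhood,
  so the formula may be differentiated in x.\<close>

theorem weak_solution_regularity:
  fixes v :: "'a::euclidean_space \<Rightarrow> real"
  assumes U: "open U" and w: "weak_solution U v g"
    and v: "higher_differentiable_on U v k" and g: "higher_differentiable_on U g k"
  shows "higher_differentiable_on U v (Suc k)"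
proof (rule higher_differentiable_on_local)
  fix x assume "x \<in> U"
  from fits_nhds[OF U this] obtain e where e: "e > 0"
    "\<And>r y. 0 < r \<Longrightarrow> r < e \<Longrightarrow> dist y x < e \<Longrightarrow> fits U r y" by blast
  define r where "r = e / 2"
  have r: "0 < r" "r < e" using e(1) by (auto simp: r_def)
  define V where "V = ball x e"
  have V: "open V" "x \<in> V" using e(1) by (auto simp: V_def)
  have f: "fits U r y" if "y \<in> V" for y
    using e(2)[OF r] that by (simp add: V_def dist_commute)
  have cv: "continuous_on U v" and cg: "continuous_on U g"
    and eq: "\<And>y. y \<in> V \<Longrightarrow> v y = mean_op r v y - pot_op r g y"
    using w f unfolding weak_solution_def by blast+
  have mean: "higher_differentiable_on V (\<lambda>x. kernel_op (\<lambda>_. 1) (\<lambda>z. 6 * bump 2 z) r v x) (Suc k)"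
  proof (rule higher_differentiable_on_SucI[OF V(1) has_derivative_mean_op[OF r(1) V(1) _ cv f]])
    fix h :: 'a
    have "continuous_on kernel_box (\<lambda>w. 6 * - (2 * 2 * (snd w \<bullet> h) * bump 1 (snd w)))"
      by (intro continuous_intros continuous_on_snd_box continuous_on_bump)
    from higher_differentiable_on_shifted_integral[OF V(1) this[unfolded kernel_box_def]
        continuous_on_kernel_shift[OF continuous_on_const, unfolded kernel_box_def]
        fitsD_const[OF f, unfolded kernel_box_def] v]
    show "higher_differentiable_on V (\<lambda>x. integral kernel_box (\<lambda>w. (6 * - (2 * 2 * (snd w \<bullet> h) * bump 1 (snd w)))
        * v (x - (r * 1) *\<^sub>R snd w)) / r) k"
      unfolding kernel_box_def by (rule higher_differentiable_on_divide[OF V(1)])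
  qed
  have pot: "higher_differentiable_on V (\<lambda>x. kernel_op (\<lambda>s. s) (bump 3) r g x) (Suc k)"
  proof (rule higher_differentiable_on_SucI[OF V(1) has_derivative_pot_op[OF r(1) V(1) _ cg f]])
    fix h :: 'a
    have "continuous_on kernel_box (\<lambda>w. - (2 * 3 * (snd w \<bullet> h) * bump 2 (snd w)))"
      by (intro continuous_intros continuous_on_snd_box continuous_on_bump)
    from higher_differentiable_on_shifted_integral[OF V(1) this[unfolded kernel_box_def]
        continuous_on_kernel_shift[OF continuous_on_id, unfolded kernel_box_def]
        fitsD_fst[OF f, unfolded kernel_box_def] g]
    show "higher_differentiable_on V (\<lambda>x. integral kernel_box (\<lambda>w. (- (2 * 3 * (snd w \<bullet> h) * bump 2 (snd w)))
        * g (x - (r * fst w) *\<^sub>R snd w)) / r) k"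
      unfolding kernel_box_def by (rule higher_differentiable_on_divide[OF V(1)])
  qed
  have "higher_differentiable_on V (\<lambda>x. (1 / kernel_mass TYPE('a)) * kernel_op (\<lambda>_. 1) (\<lambda>z. 6 * bump 2 z) r v x
      - (r\<^sup>2 / kernel_mass TYPE('a)) * kernel_op (\<lambda>s. s) (bump 3) r g x) (Suc k)"
    by (intro higher_differentiable_on_diff higher_differentiable_on_cmult V(1) mean pot)
  then have "higher_differentiable_on V v (Suc k)"
    by (rule higher_differentiable_on_cong[OF V(1), rotated]) (simp add: eq mean_op_def pot_op_def)
  with V show "\<exists>V. open V \<and> x \<in> V \<and> higher_differentiable_on V v (Suc k)" by blast
qed

text \<open>A C^2 function satisfies the identity with its own Laplacian, so the potential of h, the
  Laplacian minus g, vanishes at x at every fitting scale. The potential kernel is nonnegative with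
  positive mass, and small scales see only values of h near h x, which forces h x = 0.\<close>

lemma weak_solution_imp_laplacian:
  fixes v :: "'a::euclidean_space \<Rightarrow> real"
  assumes U: "open U" and w: "weak_solution U v g" and v: "higher_differentiable_on U v 2" and x: "x \<in> U"
  shows "laplacian v x = g x"
proof -
  define h where "h = (\<lambda>y. laplacian v y - g y)"
  have "weak_solution U (\<lambda>y. v y - v y) h"
    unfolding h_def by (rule weak_solution_diff[OF weak_solution_laplacian[OF U v] w])
  then have ch: "continuous_on U h" and h0: "\<And>r. fits U r x \<Longrightarrow> pot_op r h x = 0"
    unfolding weak_solution_def by (auto simp: mean_op_const)
  define P where "P = integral (kernel_box :: (real \<times> 'a) set) (\<lambda>w. fst w * bump 3 (snd w))"
  have P: "0 < P" unfolding P_def by (rule pot_mass_pos)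
  have "\<bar>h x\<bar> \<le> \<epsilon>" if "\<epsilon> > 0" for \<epsilon>
  proof -
    have "isCont h x" using ch U x by (simp add: continuous_on_eq_continuous_at)
    then obtain d where d: "d > 0" "\<And>y. dist y x < d \<Longrightarrow> \<bar>h y - h x\<bar> < \<epsilon>"
      using \<open>\<epsilon> > 0\<close> unfolding continuous_at_eps_delta dist_real_def by blast
    define U' where "U' = U \<inter> ball x d"
    have U': "open U'" "x \<in> U'" using U x d by (auto simp: U'_def)
    from fits_small[OF U'] obtain e where e: "e > 0" "\<And>r. 0 < r \<Longrightarrow> r < e \<Longrightarrow> fits U' r x" by blast
    have f: "fits U' (e/2) x" by (rule e(2)) (use e(1) in auto)
    have c: "continuous_on U' h" by (rule continuous_on_subset[OF ch]) (auto simp: U'_def)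
    let ?r = "e / 2"
    have pc: "pot_op ?r (\<lambda>_. c) x = ?r\<^sup>2 * (P * c) / kernel_mass TYPE('a)" for c
      by (simp add: pot_op_def kernel_op_def P_def)
    have up: "pot_op ?r (\<lambda>_. h x - \<epsilon>) x \<le> pot_op ?r h x"
      and lo: "pot_op ?r h x \<le> pot_op ?r (\<lambda>_. h x + \<epsilon>) x"
      using d(2) by (intro pot_op_mono[OF f] c continuous_on_const; force simp: U'_def dist_commute abs_less_iff)+
    have "fits U ?r x" by (rule fits_subset[OF f]) (auto simp: U'_def)
    define q where "q = ?r\<^sup>2 / kernel_mass TYPE('a) * P"
    have q: "0 < q" using e(1) P kernel_mass_pos[where 'a='a] by (simp add: q_def)
    from h0[OF \<open>fits U ?r x\<close>] have "q * (h x - \<epsilon>) \<le> 0" "0 \<le> q * (h x + \<epsilon>)"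
      using up lo unfolding pc by (simp_all add: q_def mult_ac)
    with q have "h x - \<epsilon> \<le> 0" "0 \<le> h x + \<epsilon>"
      by (simp_all add: mult_le_0_iff zero_le_mult_iff)
    then show ?thesis by (simp add: abs_le_iff)
  qed
  then have "\<bar>h x\<bar> \<le> 0" using field_le_epsilon[of "\<bar>h x\<bar>" 0] by simp
  then show ?thesis by (simp add: h_def)
qed

subsection \<open>Maximum principle\<close>

lemma weak_solutionD:
  assumes "weak_solution U v g"
  shows "continuous_on U v" "continuous_on U g" "fits U r x \<Longrightarrow> v x = mean_op r v x - pot_op r g x"
  using assms unfolding weak_solution_def by blast+

text \<open>The inequality is asked only at small scales, how small depending on the point. This
  makes the notion local, so that it passes to open subsets and survives gluing along
  spheres.\<close>

definition weak_subsolution :: "'a::euclidean_space set \<Rightarrow> ('a \<Rightarrow> real) \<Rightarrow> ('a \<Rightarrow> real) \<Rightarrow> bool" where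
  "weak_subsolution U v g \<longleftrightarrow> continuous_on U v \<and> continuous_on U g \<and>
     (\<forall>x\<in>U. \<exists>e>0. \<forall>r. 0 < r \<longrightarrow> r < e \<longrightarrow> fits U r x \<and> v x \<le> mean_op r v x - pot_op r g x)"

definition weak_supersolution :: "'a::euclidean_space set \<Rightarrow> ('a \<Rightarrow> real) \<Rightarrow> ('a \<Rightarrow> real) \<Rightarrow> bool" where
  "weak_supersolution U v g \<longleftrightarrow> continuous_on U v \<and> continuous_on U g \<and>
     (\<forall>x\<in>U. \<exists>e>0. \<forall>r. 0 < r \<longrightarrow> r < e \<longrightarrow> fits U r x \<and> mean_op r v x - pot_op r g x \<le> v x)"

lemma weak_solution_imp_sub_super:
  assumes "open U" "weak_solution U v g"
  shows "weak_subsolution U v g" "weak_supersolution U v g"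
proof -
  have *: "\<exists>e>0. \<forall>r. 0 < r \<longrightarrow> r < e \<longrightarrow> fits U r x \<and> v x = mean_op r v x - pot_op r g x" if "x \<in> U" for x
    using fits_small[OF assms(1) that] assms(2) unfolding weak_solution_def by blast
  have "\<exists>e>0. \<forall>r. 0 < r \<longrightarrow> r < e \<longrightarrow> fits U r x \<and> v x \<le> mean_op r v x - pot_op r g x"
    "\<exists>e>0. \<forall>r. 0 < r \<longrightarrow> r < e \<longrightarrow> fits U r x \<and> mean_op r v x - pot_op r g x \<le> v x" if x: "x \<in> U" for x
  proof -
    obtain e where e: "e > 0" "\<And>r. 0 < r \<Longrightarrow> r < e \<Longrightarrow> fits U r x \<and> v x = mean_op r v x - pot_op r g x"
      using *[OF x] by blast
    show "\<exists>e>0. \<forall>r. 0 < r \<longrightarrow> r < e \<longrightarrow> fits U r x \<and> v x \<le> mean_op r v x - pot_op r g x"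
      by (rule exI[of _ e]) (use e in simp)
    show "\<exists>e>0. \<forall>r. 0 < r \<longrightarrow> r < e \<longrightarrow> fits U r x \<and> mean_op r v x - pot_op r g x \<le> v x"
      by (rule exI[of _ e]) (use e in simp)
  qed
  then show "weak_subsolution U v g" "weak_supersolution U v g"
    using assms(2) unfolding weak_solution_def weak_subsolution_def weak_supersolution_def by blast+
qed

lemma weak_subsolution_subset:
  assumes "weak_subsolution U v g" "open V" "V \<subseteq> U"
  shows "weak_subsolution V v g"
proof -
  have "\<exists>e>0. \<forall>r. 0 < r \<longrightarrow> r < e \<longrightarrow> fits V r x \<and> v x \<le> mean_op r v x - pot_op r g x" if x: "x \<in> V" for x
  proof -
    obtain e where e: "e > 0" "\<And>r. 0 < r \<Longrightarrow> r < e \<Longrightarrow> v x \<le> mean_op r v x - pot_op r g x"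
      using assms(1,3) x unfolding weak_subsolution_def by blast
    obtain e' where e': "e' > 0" "\<And>r. 0 < r \<Longrightarrow> r < e' \<Longrightarrow> fits V r x"
      using fits_small[OF assms(2) x] by blast
    show ?thesis by (rule exI[of _ "min e e'"]) (use e e' in simp)
  qed
  then show ?thesis
    using assms continuous_on_subset[of U v V] continuous_on_subset[of U g V]
    unfolding weak_subsolution_def by simp
qed

lemma weak_supersolution_subset:
  assumes "weak_supersolution U v g" "open V" "V \<subseteq> U"
  shows "weak_supersolution V v g"
proof -
  have "\<exists>e>0. \<forall>r. 0 < r \<longrightarrow> r < e \<longrightarrow> fits V r x \<and> mean_op r v x - pot_op r g x \<le> v x" if x: "x \<in> V" for x
  proof -
    obtain e where e: "e > 0" "\<And>r. 0 < r \<Longrightarrow> r < e \<Longrightarrow> mean_op r v x - pot_op r g x \<le> v x"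
      using assms(1,3) x unfolding weak_supersolution_def by blast
    obtain e' where e': "e' > 0" "\<And>r. 0 < r \<Longrightarrow> r < e' \<Longrightarrow> fits V r x"
      using fits_small[OF assms(2) x] by blast
    show ?thesis by (rule exI[of _ "min e e'"]) (use e e' in simp)
  qed
  then show ?thesis
    using assms continuous_on_subset[of U v V] continuous_on_subset[of U g V]
    unfolding weak_supersolution_def by simp
qed

text \<open>Among the points where the maximum is attained, take one that is extreme in a coordinate
  direction b. Slightly further along b the function is strictly smaller, so its mean at that point
  is strictly below the maximum. This replaces propagating the maximum through a connected
  set.\<close>

lemma submean_maximum_principle:
  fixes d :: "'a::euclidean_space \<Rightarrow> real"
  assumes U: "open U" "bounded U" and d: "continuous_on (closure U) d"
    and sub: "\<And>x. x \<in> U \<Longrightarrow> \<exists>e>0. \<forall>r. 0 < r \<longrightarrow> r < e \<longrightarrow> fits U r x \<and> d x \<le> mean_op r d x"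
    and bd: "\<And>x. x \<in> frontier U \<Longrightarrow> d x \<le> 0" and x: "x \<in> closure U"
  shows "d x \<le> 0"
proof (rule ccontr)
  assume neg: "\<not> d x \<le> 0"
  have cpt: "compact (closure U)" using U(2) by simp
  have "closure U \<noteq> {}" using x by auto
  from continuous_attains_sup[OF cpt this d]
  obtain xm where xm: "xm \<in> closure U" "\<And>y. y \<in> closure U \<Longrightarrow> d y \<le> d xm" by auto
  define K where "K = {y \<in> closure U. d y = d xm}"
  have mpos: "0 < d xm" using xm(2)[OF x] neg by simp
  have "closed K"
    unfolding K_def by (rule continuous_closed_preimage_constant[OF d closed_closure])
  moreover have "bounded K" by (rule bounded_subset[OF bounded_closure[OF U(2)]]) (auto simp: K_def)
  ultimately have cK: "compact K" by (simp add: compact_eq_bounded_closed)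
  have neK: "K \<noteq> {}" using xm(1) by (auto simp: K_def)
  obtain b :: 'a where b: "b \<in> Basis" using nonempty_Basis by blast
  have "continuous_on K (\<lambda>y. y \<bullet> b)" by (intro continuous_intros)
  from continuous_attains_sup[OF cK neK this]
  obtain x0 where x0: "x0 \<in> K" "\<And>y. y \<in> K \<Longrightarrow> y \<bullet> b \<le> x0 \<bullet> b" by auto
  have "x0 \<notin> frontier U" using x0(1) bd[of x0] mpos by (auto simp: K_def)
  then have "x0 \<in> U" using x0(1) closure_Un_frontier[of U] by (auto simp: K_def)
  then obtain e where e: "e > 0" "\<And>r. 0 < r \<Longrightarrow> r < e \<Longrightarrow> fits U r x0 \<and> d x0 \<le> mean_op r d x0"
    using sub by blast
  define r where "r = e / 2"
  have r: "0 < r" "fits U r x0" "d x0 \<le> mean_op r d x0" using e(1) e(2)[of r] by (auto simp: r_def)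
  have dx0: "d x0 = d xm" using x0(1) by (simp add: K_def)
  have cd: "continuous_on U d" by (rule continuous_on_subset[OF d closure_subset])
  let ?u = "\<lambda>y. d xm - d y"
  have cu: "continuous_on U ?u" by (intro continuous_on_diff continuous_on_const cd)
  have inU: "x0 - (r * 1) *\<^sub>R snd w \<in> closure U" if "w \<in> kernel_box" for w
    using fitsD_const[OF r(2) that] closure_subset by blast
  let ?I = "integral kernel_box (\<lambda>w. 1 * (6 * bump 2 (snd w)) * ?u (x0 - (r * 1) *\<^sub>R snd w))"
  have "0 < ?I"
  proof (rule integral_kernel_box_pos[OF continuous_on_mean_integrand[OF r(2) cu]])
    show "0 \<le> 1 * (6 * bump 2 (snd w)) * ?u (x0 - (r * 1) *\<^sub>R snd w)" if "w \<in> kernel_box" for w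
      using xm(2)[OF inU[OF that]] by (simp add: bump_nonneg)
    \<comment> \<open>The sign is negative because the operators evaluate at x - r z, so this w
      samples a point displaced in direction +b.\<close>
    let ?w = "(0::real, - (1/2) *\<^sub>R b)"
    have nb: "norm (- (1/2) *\<^sub>R b) < 1" using b by simp
    show w: "?w \<in> kernel_box"
      using nb mem_kernel_cube[of "- (1/2) *\<^sub>R b"] by (simp add: kernel_box_Times)
    have y: "x0 - (r * 1) *\<^sub>R snd ?w \<in> closure U" by (rule inU[OF w])
    have "(x0 - (r * 1) *\<^sub>R snd ?w) \<bullet> b > x0 \<bullet> b"
      using r(1) b by (simp add: inner_diff_left inner_add_left)
    then have "x0 - (r * 1) *\<^sub>R snd ?w \<notin> K" using x0(2) by fastforce
    then have "d (x0 - (r * 1) *\<^sub>R snd ?w) < d xm"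
      using xm(2)[OF y] y unfolding K_def by force
    then show "0 < 1 * (6 * bump 2 (snd ?w)) * ?u (x0 - (r * 1) *\<^sub>R snd ?w)"
      using bump_pos[OF nb, of 2] by simp
  qed
  then have "0 < mean_op r ?u x0"
    using kernel_mass_pos[where 'a='a] by (simp add: mean_op_def kernel_op_def)
  also have "mean_op r ?u x0 = d xm - mean_op r d x0"
    by (subst mean_op_diff[OF r(2) continuous_on_const cd]) (simp add: mean_op_const)
  finally show False using r(3) dx0 by simp
qed

text \<open>Since \<open>pot_op\<close> is monotone, h \<le> g leaves v - w below its own means at
  small scales, and the maximum principle applies to it.\<close>

theorem weak_comparison:
  fixes v w :: "'a::euclidean_space \<Rightarrow> real"
  assumes U: "open U" "bounded U" and c: "continuous_on (closure U) v" "continuous_on (closure U) w"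
    and v: "weak_subsolution U v g" and w: "weak_supersolution U w h"
    and gh: "\<And>x. x \<in> U \<Longrightarrow> h x \<le> g x"
    and bd: "\<And>x. x \<in> frontier U \<Longrightarrow> v x \<le> w x" and x: "x \<in> closure U"
  shows "v x \<le> w x"
proof -
  have "(\<lambda>x. v x - w x) x \<le> 0"
  proof (rule submean_maximum_principle[OF U _ _ _ x])
    show "continuous_on (closure U) (\<lambda>x. v x - w x)" by (intro continuous_on_diff c)
    show "v x - w x \<le> 0" if "x \<in> frontier U" for x using bd[OF that] by simp
    fix x assume "x \<in> U"
    obtain e where e: "e > 0" "\<And>r. 0 < r \<Longrightarrow> r < e \<Longrightarrow> fits U r x \<and> v x \<le> mean_op r v x - pot_op r g x"
      using v \<open>x \<in> U\<close> unfolding weak_subsolution_def by blast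
    obtain e' where e': "e' > 0" "\<And>r. 0 < r \<Longrightarrow> r < e' \<Longrightarrow> mean_op r w x - pot_op r h x \<le> w x"
      using w \<open>x \<in> U\<close> unfolding weak_supersolution_def by blast
    have cont: "continuous_on U v" "continuous_on U g" "continuous_on U w" "continuous_on U h"
      using v w unfolding weak_subsolution_def weak_supersolution_def by auto
    have "fits U r x \<and> v x - w x \<le> mean_op r (\<lambda>x. v x - w x) x" if r: "0 < r" "r < min e e'" for r
    proof -
      have f: "fits U r x" using e(2) r by simp
      have "pot_op r h x \<le> pot_op r g x" by (rule pot_op_mono[OF f cont(4,2) gh])
      moreover have "mean_op r (\<lambda>x. v x - w x) x = mean_op r v x - mean_op r w x"
        by (rule mean_op_diff[OF f cont(1,3)])
      ultimately show ?thesis using e(2)[of r] e'(2)[of r] r f by simp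
    qed
    moreover have "0 < min e e'" using e(1) e'(1) by simp
    ultimately show "\<exists>e>0. \<forall>r. 0 < r \<longrightarrow> r < e \<longrightarrow> fits U r x \<and> v x - w x \<le> mean_op r (\<lambda>x. v x - w x) x"
      by blast
  qed
  then show ?thesis by simp
qed

subsection \<open>Limits of weak solutions\<close>

lemma abs_mean_op_le:
  fixes x :: "'a::euclidean_space"
  assumes f: "fits U r x" and u: "continuous_on U u" "\<And>y. y \<in> U \<Longrightarrow> \<bar>u y\<bar> \<le> c"
  shows "\<bar>mean_op r u x\<bar> \<le> c"
proof -
  have "mean_op r u x \<le> mean_op r (\<lambda>_. c) x" "mean_op r (\<lambda>_. - c) x \<le> mean_op r u x"
    using u(2) by (intro mean_op_mono[OF f] u continuous_on_const; force simp: abs_le_iff)+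
  then show ?thesis by (simp add: mean_op_const abs_le_iff)
qed

lemma abs_pot_op_le:
  fixes x :: "'a::euclidean_space"
  assumes f: "fits U r x" and u: "continuous_on U u" "\<And>y. y \<in> U \<Longrightarrow> \<bar>u y\<bar> \<le> c"
  shows "\<bar>pot_op r u x\<bar> \<le> pot_op r (\<lambda>_. 1) x * c"
proof -
  have "pot_op r u x \<le> pot_op r (\<lambda>_. c) x" "pot_op r (\<lambda>_. - c) x \<le> pot_op r u x"
    using u(2) by (intro pot_op_mono[OF f] u continuous_on_const; force simp: abs_le_iff)+
  moreover have "pot_op r (\<lambda>_. c) x = pot_op r (\<lambda>_. 1) x * c"
    "pot_op r (\<lambda>_. - c) x = - (pot_op r (\<lambda>_. 1) x * c)"
    by (simp_all add: pot_op_def kernel_op_def)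
  ultimately show ?thesis by (intro abs_leI) linarith+
qed

lemma real_eq_0_if_small:
  fixes a :: real
  assumes small: "\<And>\<epsilon>. 0 < \<epsilon> \<Longrightarrow> \<bar>a\<bar> \<le> \<epsilon> * K" and K: "0 < K"
  shows "a = 0"
proof -
  have "\<bar>a\<bar> \<le> 0 + e" if "e > 0" for e
    using small[of "e / K"] K that by simp
  then have "\<bar>a\<bar> \<le> 0" by (rule field_le_epsilon)
  then show ?thesis by simp
qed

text \<open>At a fixed point and scale both operators are bounded in the sup norm, the mean with
  constant 1 and the potential with constant \<open>pot_op r (\<lambda>_. 1) x\<close>, so the
  identity survives up to every \<epsilon>.\<close>

lemma weak_solution_uniform_limit:
  fixes v :: "'a::euclidean_space \<Rightarrow> real"
  assumes ws: "\<And>n. weak_solution U (vn n) (gn n)"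
    and v: "uniform_limit U vn v sequentially" and g: "uniform_limit U gn g sequentially"
  shows "weak_solution U v g"
proof -
  have cn: "continuous_on U (vn n)" "continuous_on U (gn n)" for n
    using ws[of n] unfolding weak_solution_def by blast+
  have cv: "continuous_on U v"
    by (rule uniform_limit_theorem[OF _ v sequentially_bot], rule always_eventually, rule allI, rule cn(1))
  have cg: "continuous_on U g"
    by (rule uniform_limit_theorem[OF _ g sequentially_bot], rule always_eventually, rule allI, rule cn(2))
  have "v x = mean_op r v x - pot_op r g x" if f: "fits U r x" for x r
  proof -
    let ?p = "pot_op r (\<lambda>_. 1) x"
    have "\<bar>v x - (mean_op r v x - pot_op r g x)\<bar> \<le> \<epsilon> * (2 + \<bar>?p\<bar>)" if \<epsilon>: "\<epsilon> > 0" for \<epsilon>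
    proof -
      have "\<forall>\<^sub>F n in sequentially. (\<forall>y\<in>U. dist (vn n y) (v y) < \<epsilon>) \<and> (\<forall>y\<in>U. dist (gn n y) (g y) < \<epsilon>)"
        by (intro eventually_conj uniform_limitD[OF v \<epsilon>] uniform_limitD[OF g \<epsilon>])
      from eventually_happens'[OF sequentially_bot this] obtain n where
        n: "\<forall>y\<in>U. dist (vn n y) (v y) < \<epsilon>" "\<forall>y\<in>U. dist (gn n y) (g y) < \<epsilon>" by auto
      have nv: "\<bar>vn n y - v y\<bar> \<le> \<epsilon>" and ng: "\<bar>gn n y - g y\<bar> \<le> \<epsilon>" if "y \<in> U" for y
        using bspec[OF n(1) that] bspec[OF n(2) that] unfolding dist_real_def by linarith+
      have 1: "\<bar>mean_op r (vn n) x - mean_op r v x\<bar> \<le> \<epsilon>"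
        using abs_mean_op_le[OF f continuous_on_diff[OF cn(1) cv] nv]
        unfolding mean_op_diff[OF f cn(1) cv] .
      have 2: "\<bar>pot_op r (gn n) x - pot_op r g x\<bar> \<le> ?p * \<epsilon>"
        using abs_pot_op_le[OF f continuous_on_diff[OF cn(2) cg] ng]
        unfolding pot_op_diff[OF f cn(2) cg] .
      have 3: "\<bar>vn n x - v x\<bar> \<le> \<epsilon>" by (rule nv[OF fits_mem[OF f]])
      have 4: "vn n x = mean_op r (vn n) x - pot_op r (gn n) x"
        by (rule weak_solutionD(3)[OF ws f])
      have "?p * \<epsilon> \<le> \<bar>?p\<bar> * \<epsilon>" using \<epsilon> by (intro mult_right_mono) auto
      moreover have "\<epsilon> * (2 + \<bar>?p\<bar>) = 2 * \<epsilon> + \<bar>?p\<bar> * \<epsilon>" by (simp add: algebra_simps)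
      ultimately show ?thesis using 1 2 3 4 by linarith
    qed
    moreover have "0 < 2 + \<bar>?p\<bar>" by (rule add_pos_nonneg) simp_all
    ultimately have "v x - (mean_op r v x - pot_op r g x) = 0" by (rule real_eq_0_if_small)
    then show ?thesis by (rule eq_iff_diff_eq_0[THEN iffD2])
  qed
  with cv cg show ?thesis unfolding weak_solution_def by blast
qed

text \<open>The constant L is chosen before u: all functions bounded by C get equally Lipschitz
  means, because the derivative falls on the kernel. This supplies continuity for merely pointwise
  limits.\<close>

lemma mean_op_lipschitz:
  fixes x :: "'a::euclidean_space"
  assumes r: "0 < r" and f: "\<And>y. y \<in> ball x e \<Longrightarrow> fits U r y" and C: "0 \<le> C"
  shows "\<exists>L\<ge>0. \<forall>u. continuous_on U u \<longrightarrow> (\<forall>y\<in>U. \<bar>u y\<bar> \<le> C) \<longrightarrow>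
    (\<forall>y\<in>ball x e. \<forall>y'\<in>ball x e. \<bar>mean_op r u y - mean_op r u y'\<bar> \<le> L * norm (y - y'))"
proof -
  obtain B where B: "B > 0" "\<And>z::'a. z \<in> kernel_cube \<Longrightarrow> norm z \<le> B"
    using bounded_kernel_cube by blast
  define m where "m = kernel_mass TYPE('a)"
  have m: "0 < m" unfolding m_def by (rule kernel_mass_pos)
  define c where "c = measure lborel (kernel_cube :: 'a set)"
  have c: "0 \<le> c" by (simp add: c_def)
  \<comment> \<open>24 = 6 * 2 * 2 comes from differentiating \<open>6 * bump 2 z\<close>, B bounds
    |z| on the cube, C bounds u, c is the volume of the cube, and r the scale.\<close>
  define L where "L = 24 * B * C * c / r"
  have L0: "0 \<le> L" using B C c r by (simp add: L_def)
  have lip: "\<bar>mean_op r u y - mean_op r u y'\<bar> \<le> L / m * norm (y - y')"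
    if cu: "continuous_on U u" and bu: "\<forall>y\<in>U. \<bar>u y\<bar> \<le> C" and y: "y \<in> ball x e" "y' \<in> ball x e" for u y y'
  proof -
    let ?F = "kernel_op (\<lambda>_. 1) (\<lambda>z. 6 * bump 2 z) r u"
    let ?D = "\<lambda>y v. integral kernel_box (\<lambda>w. (6 * - (2 * 2 * (snd w \<bullet> v) * bump 1 (snd w)))
        * u (y - (r * 1) *\<^sub>R snd w)) / r"
    have "norm (?F y - ?F y') \<le> L * norm (y - y')"
    proof (rule differentiable_bound[where S="ball x e" and f'="?D"])
      show "(?F has_derivative ?D z) (at z within ball x e)" if "z \<in> ball x e" for z
        by (rule has_derivative_at_withinI[OF has_derivative_mean_op[OF r open_ball that cu f]])
      show "onorm (?D z) \<le> L" if z: "z \<in> ball x e" for z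
      proof (rule onorm_le)
        fix v :: 'a
        have "\<bar>integral kernel_box (\<lambda>w. (6 * - (2 * 2 * (snd w \<bullet> v) * bump 1 (snd w)))
            * u (z - (r * 1) *\<^sub>R snd w))\<bar> \<le> (24 * (B * norm v) * C) * c"
          unfolding c_def
        proof (rule integral_kernel_box_bound)
          have k: "continuous_on kernel_box (\<lambda>w. 6 * - (2 * 2 * (snd w \<bullet> v) * bump 1 (snd w)))"
            by (intro continuous_intros continuous_on_snd_box continuous_on_bump)
          show "continuous_on kernel_box (\<lambda>w. (6 * - (2 * 2 * (snd w \<bullet> v) * bump 1 (snd w)))
              * u (z - (r * 1) *\<^sub>R snd w))"
            by (rule continuous_on_kernel_section[where \<sigma>="\<lambda>_. 1",
                  OF continuous_on_const k cu fitsD_const[OF f[OF z]]])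
          fix w :: "real \<times> 'a" assume w: "w \<in> kernel_box"
          have 1: "\<bar>u (z - (r * 1) *\<^sub>R snd w)\<bar> \<le> C"
            using bu fitsD_const[OF f[OF z] w] by blast
          have "\<bar>snd w \<bullet> v\<bar> \<le> norm (snd w) * norm v" by (rule Cauchy_Schwarz_ineq2)
          also have "\<dots> \<le> B * norm v"
            using B(2)[of "snd w"] w by (intro mult_right_mono) (auto simp: kernel_box_Times)
          finally have 2: "\<bar>snd w \<bullet> v\<bar> \<le> B * norm v" .
          have 3: "0 \<le> bump 1 (snd w)" "bump 1 (snd w) \<le> 1"
            by (rule bump_nonneg) (simp add: bump_def)
          have "\<bar>snd w \<bullet> v\<bar> * bump 1 (snd w) \<le> (B * norm v) * 1"
            using 2 3 by (intro mult_mono) auto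
          then have "24 * (\<bar>snd w \<bullet> v\<bar> * bump 1 (snd w)) \<le> 24 * (B * norm v)" by simp
          from mult_mono[OF this 1] have "(24 * (\<bar>snd w \<bullet> v\<bar> * bump 1 (snd w))) * \<bar>u (z - (r * 1) *\<^sub>R snd w)\<bar> \<le> (24 * (B * norm v)) * C"
            using B(1) by simp
          then show "\<bar>(6 * - (2 * 2 * (snd w \<bullet> v) * bump 1 (snd w))) * u (z - (r * 1) *\<^sub>R snd w)\<bar>
              \<le> 24 * (B * norm v) * C"
            using 3(1) by (simp add: abs_mult mult_ac)
        qed
        then have "\<bar>integral kernel_box (\<lambda>w. (6 * - (2 * 2 * (snd w \<bullet> v) * bump 1 (snd w)))
            * u (z - (r * 1) *\<^sub>R snd w))\<bar> / r \<le> (24 * (B * norm v) * C) * c / r"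
          using r by (intro divide_right_mono) auto
        then show "norm (?D z v) \<le> L * norm v"
          using r by (simp only: real_norm_def abs_divide abs_of_pos L_def) (simp add: mult_ac)
      qed
    qed (use y in auto)
    then have "\<bar>?F y - ?F y'\<bar> / m \<le> L * norm (y - y') / m"
      using m by (intro divide_right_mono) auto
    then show ?thesis
      using m by (simp add: mean_op_def m_def[symmetric] diff_divide_distrib[symmetric] abs_divide)
  qed
  show ?thesis
    by (rule exI[of _ "L / m"]) (use lip L0 m in simp)
qed

lemma continuous_on_pot_op:
  fixes g :: "'a::euclidean_space \<Rightarrow> real"
  assumes "0 < r" "open V" "continuous_on U g" "\<And>x. x \<in> V \<Longrightarrow> fits U r x"
  shows "continuous_on V (pot_op r g)"
proof -
  have "continuous_on V (kernel_op (\<lambda>s. s) (bump 3) r g)"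
  proof (intro continuous_at_imp_continuous_on ballI)
    fix x assume "x \<in> V"
    from has_derivative_continuous[OF has_derivative_pot_op[OF assms(1,2) this assms(3,4)]]
    show "isCont (kernel_op (\<lambda>s. s) (bump 3) r g) x" .
  qed
  then have "continuous_on V (\<lambda>x. (r\<^sup>2 / kernel_mass TYPE('a)) * kernel_op (\<lambda>s. s) (bump 3) r g x)"
    by (intro continuous_on_mult continuous_on_const)
  then show ?thesis by (simp add: pot_op_def[abs_def])
qed

lemma mean_op_dominated_convergence:
  fixes x :: "'a::euclidean_space"
  assumes f: "fits U r x" and c: "\<And>n. continuous_on U (vn n)"
    and b: "\<And>n y. y \<in> U \<Longrightarrow> \<bar>vn n y\<bar> \<le> C"
    and lim: "\<And>y. y \<in> U \<Longrightarrow> (\<lambda>n. vn n y) \<longlonglongrightarrow> v y"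
  shows "(\<lambda>n. mean_op r (vn n) x) \<longlonglongrightarrow> mean_op r v x"
proof -
  let ?f = "\<lambda>v w. 1 * (6 * bump 2 (snd w)) * v (x - (r * 1) *\<^sub>R snd w)"
  have "(\<lambda>n. integral kernel_box (?f (vn n))) \<longlonglongrightarrow> integral kernel_box (?f v)"
  proof (rule dominated_convergence(2)[where h="\<lambda>w. 1 * (6 * bump 2 (snd w)) * (\<lambda>_. C) (x - (r * 1) *\<^sub>R snd w)"])
    show "?f (vn n) integrable_on kernel_box" for n by (rule integrable_mean[OF f c])
    show "(\<lambda>w. 1 * (6 * bump 2 (snd w)) * (\<lambda>_. C) (x - (r * 1) *\<^sub>R snd w)) integrable_on kernel_box"
      by (rule integrable_mean[OF f continuous_on_const])
    fix w :: "real \<times> 'a" assume w: "w \<in> kernel_box"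
    note y = fitsD_const[OF f w]
    show "norm (?f (vn n) w) \<le> 1 * (6 * bump 2 (snd w)) * (\<lambda>_. C) (x - (r * 1) *\<^sub>R snd w)" for n
      using mult_left_mono[OF b[OF y, of n], of "6 * bump 2 (snd w)"] bump_nonneg[of 2 "snd w"]
      by (simp add: abs_mult)
    show "(\<lambda>n. ?f (vn n) w) \<longlonglongrightarrow> ?f v w"
      by (intro tendsto_mult tendsto_const lim[OF y])
  qed
  then show ?thesis
    unfolding mean_op_def kernel_op_def
    by (rule tendsto_divide[OF _ tendsto_const]) (use kernel_mass_pos[where 'a='a] in simp)
qed

text \<open>Dominated convergence carries the identity over. Continuity of the limit is the real
  issue: the means of v inherit the uniform Lipschitz bound, and v equals its mean minus a
  continuous potential. The limit of increasing balayage steps needs exactly this form.\<close>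

lemma weak_solution_pointwise_limit:
  fixes v :: "'a::euclidean_space \<Rightarrow> real"
  assumes U: "open U" and ws: "\<And>n. weak_solution U (vn n) g"
    and b: "\<And>n y. y \<in> U \<Longrightarrow> \<bar>vn n y\<bar> \<le> C"
    and lim: "\<And>y. y \<in> U \<Longrightarrow> (\<lambda>n. vn n y) \<longlonglongrightarrow> v y"
  shows "weak_solution U v g"
proof -
  have cn: "continuous_on U (vn n)" for n using weak_solutionD(1)[OF ws[of n]] .
  have cg: "continuous_on U g" using weak_solutionD(2)[OF ws[of 0]] .
  have eq: "v x = mean_op r v x - pot_op r g x" if f: "fits U r x" for x r
  proof -
    have "(\<lambda>n. mean_op r (vn n) x - pot_op r g x) \<longlonglongrightarrow> mean_op r v x - pot_op r g x"
      by (intro tendsto_diff tendsto_const mean_op_dominated_convergence[OF f cn b lim])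
    moreover have "(\<lambda>n. mean_op r (vn n) x - pot_op r g x) = (\<lambda>n. vn n x)"
      using weak_solutionD(3)[OF ws f] by (intro ext) (rule sym)
    ultimately have "(\<lambda>n. vn n x) \<longlonglongrightarrow> mean_op r v x - pot_op r g x" by (rule subst[rotated])
    then show ?thesis by (rule LIMSEQ_unique[OF lim[OF fits_mem[OF f]]])
  qed
  have "isCont v x" if x: "x \<in> U" for x
  proof -
    from fits_nhds[OF U x] obtain e where e: "e > 0"
      "\<And>r y. 0 < r \<Longrightarrow> r < e \<Longrightarrow> dist y x < e \<Longrightarrow> fits U r y" by blast
    define r where "r = e / 2"
    have r: "0 < r" "r < e" using e(1) by (auto simp: r_def)
    have f: "fits U r y" if "y \<in> ball x e" for y
      using e(2)[OF r] that by (simp add: dist_commute)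
    have C0: "0 \<le> C" using b[OF x, of 0] by linarith
    from mean_op_lipschitz[OF r(1) f C0] obtain L where L: "0 \<le> L \<and> (\<forall>u. continuous_on U u \<longrightarrow> (\<forall>y\<in>U. \<bar>u y\<bar> \<le> C) \<longrightarrow>
        (\<forall>y\<in>ball x e. \<forall>y'\<in>ball x e. \<bar>mean_op r u y - mean_op r u y'\<bar> \<le> L * norm (y - y')))" ..
    have "L-lipschitz_on (ball x e) (mean_op r v)"
    proof (rule lipschitz_onI)
      fix y y' assume y: "y \<in> ball x e" "y' \<in> ball x e"
      have "(\<lambda>n. \<bar>mean_op r (vn n) y - mean_op r (vn n) y'\<bar>) \<longlonglongrightarrow> \<bar>mean_op r v y - mean_op r v y'\<bar>"
        by (intro tendsto_rabs tendsto_diff mean_op_dominated_convergence[OF f[OF y(1)] cn b lim]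
            mean_op_dominated_convergence[OF f[OF y(2)] cn b lim])
      then have "\<bar>mean_op r v y - mean_op r v y'\<bar> \<le> L * norm (y - y')"
        by (rule LIMSEQ_le_const2)
           (intro exI allI impI, rule conjunct2[OF L, rule_format, OF cn b y])
      then show "dist (mean_op r v y) (mean_op r v y') \<le> L * dist y y'"
        by (simp add: dist_norm)
    qed (rule conjunct1[OF L])
    then have "continuous_on (ball x e) (mean_op r v)" by (rule lipschitz_on_continuous_on)
    then have "continuous_on (ball x e) (\<lambda>y. mean_op r v y - pot_op r g y)"
      by (intro continuous_on_diff continuous_on_pot_op[OF r(1) open_ball cg f])
    then have "continuous_on (ball x e) v"
      by (rule continuous_on_eq) (use eq[OF f] in simp)
    then show ?thesis using e(1) by (simp add: continuous_on_eq_continuous_at)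
  qed
  then have "continuous_on U v" by (simp add: continuous_at_imp_continuous_on)
  with cg eq show ?thesis unfolding weak_solution_def by blast
qed

subsection \<open>The Poisson equation in a ball\<close>

text \<open>L maps a basis of the finite-dimensional S to an independent set of the same size in S,
  which therefore spans S. Linearity is asked on S only, as the map used later is a Laplacian, which
  is additive on polynomials but not on arbitrary functions.\<close>

lemma (in vector_space) injective_imp_surjective_on_subspace:
  assumes S: "subspace S" "S \<subseteq> span T" "finite T"
    and LS: "\<And>s. s \<in> S \<Longrightarrow> L s \<in> S"
    and add: "\<And>s t. s \<in> S \<Longrightarrow> t \<in> S \<Longrightarrow> L (s + t) = L s + L t"
    and scale: "\<And>c s. s \<in> S \<Longrightarrow> L (scale c s) = scale c (L s)"
    and inj: "\<And>s. s \<in> S \<Longrightarrow> L s = 0 \<Longrightarrow> s = 0"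
    and y: "y \<in> S"
  shows "\<exists>s\<in>S. L s = y"
proof -
  obtain B where B: "B \<subseteq> S" "independent B" "S \<subseteq> span B"
    by (rule maximal_independent_subset)
  have finB: "finite B"
    using independent_span_bound[OF S(3) B(2)] B(1) S(2) by auto
  have L0: "L 0 = 0"
    using scale[OF subspace_0[OF S(1)], of 0] by simp
  have inS: "(\<Sum>b\<in>A. scale (u b) b) \<in> S" if "A \<subseteq> B" for A u
    using that B(1) by (intro subspace_sum[OF S(1)] subspace_scale[OF S(1)]) auto
  have Lsum: "L (\<Sum>b\<in>A. scale (u b) b) = (\<Sum>b\<in>A. scale (u b) (L b))" if "finite A" "A \<subseteq> B" for A u
    using that
  proof (induction A rule: finite_induct)
    case empty
    then show ?case by (simp add: L0)
  next
    case (insert a A)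
    have aS: "a \<in> S" and AB: "A \<subseteq> B" using insert.prems B(1) by auto
    have "L (\<Sum>b\<in>insert a A. scale (u b) b) = L (scale (u a) a + (\<Sum>b\<in>A. scale (u b) b))"
      using insert.hyps by simp
    also have "\<dots> = scale (u a) (L a) + (\<Sum>b\<in>A. scale (u b) (L b))"
      using add[OF subspace_scale[OF S(1) aS] inS[OF AB]] scale[OF aS] insert.IH[OF AB] by simp
    finally show ?case using insert.hyps by simp
  qed
  have injB: "inj_on L B"
  proof (rule inj_onI)
    fix a b assume ab: "a \<in> B" "b \<in> B" "L a = L b"
    then have S': "a \<in> S" "b \<in> S" using B(1) by auto
    have "L (a + scale (- 1) b) = L a + scale (- 1) (L b)"
      by (simp only: add[OF S'(1) subspace_scale[OF S(1) S'(2)]] scale[OF S'(2)])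
    then have "L (a + scale (- 1) b) = 0" using ab(3) by simp
    then have "a + scale (- 1) b = 0"
      by (rule inj[OF subspace_add[OF S(1) S'(1) subspace_scale[OF S(1) S'(2)]]])
    then show "a = b" by simp
  qed
  have reindex: "(\<Sum>x\<in>L ` B. scale (f x) x) = L (\<Sum>b\<in>B. scale (f (L b)) b)" for f
    by (simp add: sum.reindex[OF injB] Lsum[OF finB order_refl])
  have ind: "independent (L ` B)"
  proof (rule independent_if_scalars_zero)
    fix f x assume f: "(\<Sum>x\<in>L ` B. scale (f x) x) = 0" and "x \<in> L ` B"
    then obtain b where b: "b \<in> B" "x = L b" by auto
    have "(\<Sum>b\<in>B. scale (f (L b)) b) = 0"
      using f reindex inj[OF inS[OF order_refl]] by simp
    from independentD[OF B(2) finB order_refl this b(1)] show "f x = 0" using b(2) by simp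
  qed (use finB in simp)
  have LB: "L ` B \<subseteq> S" using LS B(1) by auto
  have "y \<in> span (L ` B)"
  proof (rule ccontr)
    assume ny: "y \<notin> span (L ` B)"
    then have i: "independent (insert y (L ` B))" using ind by (rule independent_insertI)
    have "insert y (L ` B) \<subseteq> span B" using LB y B(3) by blast
    from independent_span_bound[OF finB i this] have "card (insert y (L ` B)) \<le> card B" by (rule conjunct2)
    moreover have "y \<notin> L ` B" by (rule contrapos_nn[OF ny span_base])
    ultimately show False using finB card_image[OF injB] by simp
  qed
  then have "y \<in> range (\<lambda>u. \<Sum>x\<in>L ` B. scale (u x) x)"
    by (simp only: span_finite[OF finite_imageI[OF finB]])
  then obtain u where u: "y = (\<Sum>x\<in>L ` B. scale (u x) x)" by (rule rangeE)
  show ?thesis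
    by (rule bexI[OF _ inS[OF order_refl, of "\<lambda>b. u (L b)"]]) (simp only: u reindex)
qed

interpretation real_fun: vector_space "\<lambda>(c::real) (f::'a \<Rightarrow> real) x. c * f x"
  by unfold_locales (auto simp: fun_eq_iff algebra_simps)

section \<open>Polynomials of bounded degree\<close>

inductive poly_deg :: "nat \<Rightarrow> ('a::euclidean_space \<Rightarrow> real) \<Rightarrow> bool" where
  const: "poly_deg m (\<lambda>_. c)"
| add: "poly_deg m f \<Longrightarrow> poly_deg m g \<Longrightarrow> poly_deg m (\<lambda>x. f x + g x)"
| coord: "b \<in> Basis \<Longrightarrow> poly_deg m f \<Longrightarrow> poly_deg (Suc m) (\<lambda>x. (x \<bullet> b) * f x)"

lemma poly_deg_mono: "poly_deg m f \<Longrightarrow> m \<le> n \<Longrightarrow> poly_deg n f"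
proof (induction arbitrary: n rule: poly_deg.induct)
  case (coord b m f)
  then obtain k where k: "n = Suc k" "m \<le> k" by (cases n) auto
  show ?case unfolding k(1) by (rule poly_deg.coord[OF coord.hyps(1) coord.IH[OF k(2)]])
qed (auto intro: poly_deg.intros)

lemma poly_deg_cmult: "poly_deg m f \<Longrightarrow> poly_deg m (\<lambda>x. c * f x)"
proof (induction rule: poly_deg.induct)
  case (const m d) show ?case by (rule poly_deg.const)
next
  case (add m f g)
  show ?case using poly_deg.add[OF add.IH] by (simp add: distrib_left)
next
  case (coord b m f)
  show ?case using poly_deg.coord[OF coord.hyps(1) coord.IH] by (simp add: mult.left_commute)
qed

lemma poly_deg_sum:
  "finite I \<Longrightarrow> (\<And>i. i \<in> I \<Longrightarrow> poly_deg m (f i)) \<Longrightarrow> poly_deg m (\<lambda>x. \<Sum>i\<in>I. f i x)"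
  by (induction I rule: finite_induct) (auto intro: poly_deg.intros)

lemma poly_deg_mult: "poly_deg m f \<Longrightarrow> poly_deg k g \<Longrightarrow> poly_deg (m + k) (\<lambda>x. f x * g x)"
proof (induction rule: poly_deg.induct)
  case (const m d)
  show ?case by (rule poly_deg_mono[OF poly_deg_cmult[OF const]]) simp
next
  case (add m f1 f2)
  show ?case using poly_deg.add[OF add.IH(1)[OF add.prems] add.IH(2)[OF add.prems]]
    by (simp add: distrib_right)
next
  case (coord b m f)
  show ?case using poly_deg.coord[OF coord.hyps(1) coord.IH[OF coord.prems]] by (simp add: mult.assoc)
qed

lemma poly_deg_inner: "poly_deg 1 (\<lambda>x::'a::euclidean_space. x \<bullet> v)"
proof -
  have "poly_deg 1 (\<lambda>x::'a. \<Sum>b\<in>Basis. (v \<bullet> b) * ((x \<bullet> b) * 1))"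
    using poly_deg.coord[OF _ poly_deg.const, of _ 0 1]
    by (intro poly_deg_sum poly_deg_cmult) auto
  then show ?thesis by (simp add: euclidean_inner[of _ v] mult.commute)
qed

lemma poly_deg_imp_real_polynomial_function: "poly_deg m f \<Longrightarrow> real_polynomial_function f"
proof (induction rule: poly_deg.induct)
  case (coord b m f)
  show ?case
    by (rule real_polynomial_function.intros(4)[OF real_polynomial_function.intros(1)[OF bounded_linear_inner_left] coord.IH])
qed (auto intro: real_polynomial_function.intros)

lemma real_polynomial_function_imp_poly_deg:
  fixes f :: "'a::euclidean_space \<Rightarrow> real"
  assumes "real_polynomial_function f"
  shows "\<exists>m. poly_deg m f"
  using assms
proof (induction rule: real_polynomial_function.induct)
  case (linear f)
  have "(\<lambda>x. \<Sum>b\<in>Basis. f b * (x \<bullet> b)) = f"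
  proof (rule ext, rule sym)
    fix x
    have l: "linear f" using linear by (rule bounded_linear.linear)
    have "f x = f (\<Sum>b\<in>Basis. (x \<bullet> b) *\<^sub>R b)" by (simp add: euclidean_representation)
    then show "f x = (\<Sum>b\<in>Basis. f b * (x \<bullet> b))"
      by (simp add: linear_sum[OF l] linear_cmul[OF l] mult.commute)
  qed
  moreover have "poly_deg 1 (\<lambda>x. \<Sum>b\<in>Basis. f b * (x \<bullet> b))"
    by (intro poly_deg_sum poly_deg_cmult poly_deg_inner) simp
  ultimately have "poly_deg 1 f" by (simp only:)
  then show ?case ..
next
  case (const c) show ?case using poly_deg.const by blast
next
  case (add f g)
  then obtain m n where mn: "poly_deg m f" "poly_deg n g" by blast
  have "poly_deg (max m n) (\<lambda>x. f x + g x)"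
    by (intro poly_deg.add poly_deg_mono[OF mn(1)] poly_deg_mono[OF mn(2)]) auto
  then show ?case ..
next
  case (mult f g)
  then show ?case using poly_deg_mult by blast
qed

text \<open>The last conjunct rescues truncated subtraction: in the product rule, a coordinate times
  f' has degree at most m only if m > 0 or f' = 0, so for m = 0 the induction must know that the
  derivative vanishes.\<close>

lemma poly_deg_derivative:
  assumes "poly_deg m f"
  shows "\<exists>f'. (\<forall>x. (f has_derivative f' x) (at x)) \<and> (\<forall>v. poly_deg (m - 1) (\<lambda>x. f' x v))
    \<and> (m = 0 \<longrightarrow> (\<forall>x v. f' x v = 0))"
  using assms
proof (induction rule: poly_deg.induct)
  case (const m c)
  show ?case by (rule exI[of _ "\<lambda>_ _. 0"]) (auto intro: poly_deg.const)
next
  case (add m f g)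
  then obtain f' g' where f': "\<forall>x. (f has_derivative f' x) (at x)" "\<forall>v. poly_deg (m - 1) (\<lambda>x. f' x v)"
      "m = 0 \<longrightarrow> (\<forall>x v. f' x v = 0)"
    and g': "\<forall>x. (g has_derivative g' x) (at x)" "\<forall>v. poly_deg (m - 1) (\<lambda>x. g' x v)"
      "m = 0 \<longrightarrow> (\<forall>x v. g' x v = 0)" by blast
  show ?case
    by (rule exI[of _ "\<lambda>x v. f' x v + g' x v"])
       (use f' g' in \<open>auto intro!: has_derivative_add poly_deg.add\<close>)
next
  case (coord b m f)
  then obtain f' where f': "\<forall>x. (f has_derivative f' x) (at x)" "\<forall>v. poly_deg (m - 1) (\<lambda>x. f' x v)"
      "m = 0 \<longrightarrow> (\<forall>x v. f' x v = 0)" by blast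
  have l: "((\<lambda>x. x \<bullet> b) has_derivative (\<lambda>v. v \<bullet> b)) (at x)" for x
    by (rule bounded_linear_imp_has_derivative[OF bounded_linear_inner_left])
  have "poly_deg m (\<lambda>x. (x \<bullet> b) * f' x v + (v \<bullet> b) * f x)" for v
  proof (rule poly_deg.add)
    show "poly_deg m (\<lambda>x. (v \<bullet> b) * f x)" by (rule poly_deg_cmult[OF coord.hyps(2)])
    show "poly_deg m (\<lambda>x. (x \<bullet> b) * f' x v)"
    proof (cases m)
      case 0 then show ?thesis using f'(3) by (simp add: poly_deg.const)
    next
      case (Suc k)
      then show ?thesis using poly_deg.coord[OF coord.hyps(1) spec[OF f'(2)]] by simp
    qed
  qed
  moreover have "((\<lambda>x. (x \<bullet> b) * f x) has_derivative (\<lambda>v. (x \<bullet> b) * f' x v + (v \<bullet> b) * f x)) (at x)" for x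
    by (rule has_derivative_mult[OF l spec[OF f'(1)]])
  ultimately show ?case
    by (intro exI[of _ "\<lambda>x v. (x \<bullet> b) * f' x v + (v \<bullet> b) * f x"]) simp
qed

lemma poly_deg_frechet_derivative:
  assumes "poly_deg m f"
  shows "poly_deg (m - 1) (\<lambda>x. frechet_derivative f (at x) v)"
proof -
  obtain f' where f': "\<forall>x. (f has_derivative f' x) (at x)" "\<forall>v. poly_deg (m - 1) (\<lambda>x. f' x v)"
    using poly_deg_derivative[OF assms] by blast
  have "(\<lambda>x. frechet_derivative f (at x) v) = (\<lambda>x. f' x v)"
    using frechet_derivative_at[OF spec[OF f'(1)]] by (simp add: fun_eq_iff)
  then show ?thesis using f'(2) by simp
qed

lemma poly_deg_laplacian: "poly_deg m f \<Longrightarrow> poly_deg (m - 2) (laplacian f)"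
  using poly_deg_sum[OF finite_Basis poly_deg_frechet_derivative[OF poly_deg_frechet_derivative]]
  unfolding laplacian_def[abs_def] by (simp add: numeral_2_eq_2)

lemma laplacian_lincomb:
  fixes f g :: "'a::euclidean_space \<Rightarrow> real"
  assumes "open U" "x \<in> U" "higher_differentiable_on U f 2" "higher_differentiable_on U g 2"
  shows "laplacian (\<lambda>x. a * f x + b * g x) x = a * laplacian f x + b * laplacian g x"
proof -
  note f = higher_differentiable_on_2D[OF assms(3)] and g = higher_differentiable_on_2D[OF assms(4)]
  have "laplacian (\<lambda>x. a * f x + b * g x) x = (\<Sum>i\<in>Basis.
      a * frechet_derivative (\<lambda>y. frechet_derivative f (at y) i) (at x) i
    + b * frechet_derivative (\<lambda>y. frechet_derivative g (at y) i) (at x) i)"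
    by (rule laplacian_eqI[OF assms(1,2), where f'="\<lambda>y v. a * frechet_derivative f (at y) v + b * frechet_derivative g (at y) v"
          and f''="\<lambda>i v. a * frechet_derivative (\<lambda>y. frechet_derivative f (at y) i) (at x) v
            + b * frechet_derivative (\<lambda>y. frechet_derivative g (at y) i) (at x) v"])
       (intro has_derivative_add has_derivative_mult_right f(1) g(1) f(2) g(2) assms(2); assumption)+
  then show ?thesis by (simp add: laplacian_def sum.distrib sum_distrib_left)
qed

text \<open>Finite dimension of the polynomials of degree at most m, needed so that injectivity
  yields surjectivity.\<close>

lemma poly_deg_finite_span:
  "\<exists>T. finite T \<and> (\<forall>f::'a::euclidean_space \<Rightarrow> real. poly_deg m f \<longrightarrow> f \<in> real_fun.span T)"
proof (induction m)
  case 0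
  have "f \<in> real_fun.span {\<lambda>_. 1}" if "poly_deg n f" "n = 0" for f :: "'a \<Rightarrow> real" and n
    using that
  proof (induction rule: poly_deg.induct)
    case (const m c)
    have "(\<lambda>x. c * (\<lambda>_. 1) x) \<in> real_fun.span {\<lambda>_::'a. 1}"
      by (rule real_fun.span_scale[OF real_fun.span_base]) simp
    then show ?case by simp
  next
    case (add m f g)
    then show ?case using real_fun.span_add[of f _ g] by (simp add: plus_fun_def)
  qed simp
  then show ?case by (intro exI[of _ "{\<lambda>_. 1}"]) simp
next
  case (Suc m)
  then obtain T where T: "finite T" "\<And>f::'a \<Rightarrow> real. poly_deg m f \<Longrightarrow> f \<in> real_fun.span T" by blast
  define T' where "T' = insert (\<lambda>_. 1) (\<Union>b\<in>Basis. (\<lambda>(f::'a \<Rightarrow> real) x. (x \<bullet> b) * f x) ` T)"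
  have "f \<in> real_fun.span T'" if "poly_deg n f" "n = Suc m" for f n
    using that
  proof (induction rule: poly_deg.induct)
    case (const k c)
    have "(\<lambda>x. c * (\<lambda>_. 1) x) \<in> real_fun.span T'"
      by (rule real_fun.span_scale[OF real_fun.span_base]) (simp add: T'_def)
    then show ?case by simp
  next
    case (add k f g)
    then show ?case using real_fun.span_add[of f _ g] by (simp add: plus_fun_def)
  next
    case (coord b k f)
    then have "f \<in> real_fun.span T" using T(2) by simp
    then show ?case
    proof (induction rule: real_fun.span_induct_alt)
      case base
      show ?case using real_fun.span_zero by (simp add: zero_fun_def)
    next
      case (step c g h)
      have "(\<lambda>x. (x \<bullet> b) * g x) \<in> real_fun.span T'"
        by (rule real_fun.span_base) (use step(1) coord(1) in \<open>auto simp: T'_def\<close>)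
      from real_fun.span_add[OF real_fun.span_scale[OF this, of c] step(2)]
      show ?case by (simp add: plus_fun_def algebra_simps)
    qed
  qed
  moreover have "finite T'" using T(1) by (simp add: T'_def)
  ultimately show ?case by blast
qed

lemma higher_differentiable_on_poly_deg:
  fixes f :: "'a::euclidean_space \<Rightarrow> real"
  shows "poly_deg m f \<Longrightarrow> higher_differentiable_on UNIV f k"
  by (intro higher_differentiable_on_real_polynomial_function poly_deg_imp_real_polynomial_function)

lemma poly_deg_quadratic:
  "poly_deg 2 (\<lambda>x::'a::euclidean_space. A + B * (C - (x - c) \<bullet> (x - c)))"
proof -
  have "poly_deg 1 (\<lambda>x::'a. x \<bullet> b + (- (c \<bullet> b)))" for b
    by (intro poly_deg.add poly_deg_inner poly_deg.const)
  from poly_deg_mult[OF this this]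
  have "poly_deg 2 (\<lambda>x::'a. (x \<bullet> b + (- (c \<bullet> b))) * (x \<bullet> b + (- (c \<bullet> b))))" for b
    by (simp only: one_add_one)
  then have "poly_deg 2 (\<lambda>x::'a. A + B * (C + (-1) * (\<Sum>b\<in>Basis. (x \<bullet> b + (- (c \<bullet> b))) * (x \<bullet> b + (- (c \<bullet> b))))))"
    by (intro poly_deg.add poly_deg_cmult poly_deg_sum finite_Basis poly_deg.const)
  moreover have "(x - c) \<bullet> (x - c) = (\<Sum>b\<in>Basis. (x \<bullet> b + (- (c \<bullet> b))) * (x \<bullet> b + (- (c \<bullet> b))))" for x
    by (subst euclidean_inner) (simp add: inner_diff_left)
  ultimately show ?thesis by simp
qed

lemma laplacian_quadratic:
  "laplacian (\<lambda>x::'a::euclidean_space. A + B * (C - (x - c) \<bullet> (x - c))) x = - (2 * B * DIM('a))"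
proof -
  have "laplacian (\<lambda>x::'a. A + B * (C - (x - c) \<bullet> (x - c))) x = (\<Sum>b\<in>(Basis::'a set). - (2 * B * (b \<bullet> b)))"
  proof (rule laplacian_eqI[OF open_UNIV UNIV_I, where f'="\<lambda>y v. - (2 * B * ((y - c) \<bullet> v))"
        and f''="\<lambda>b v. - (2 * B * (v \<bullet> b))"])
    show "((\<lambda>x. A + B * (C - (x - c) \<bullet> (x - c))) has_derivative (\<lambda>v. - (2 * B * ((y - c) \<bullet> v)))) (at y)" for y
      by (auto intro!: derivative_eq_intros simp: inner_commute algebra_simps)
    show "((\<lambda>y. - (2 * B * ((y - c) \<bullet> b))) has_derivative (\<lambda>v. - (2 * B * (v \<bullet> b)))) (at x)" for b
      by (auto intro!: derivative_eq_intros)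
  qed
  also have "\<dots> = (\<Sum>b\<in>(Basis::'a set). - (2 * B))"
    by (intro sum.cong) (auto simp: inner_Basis)
  finally show ?thesis by (simp add: mult.commute)
qed

section \<open>Solvability in a ball, first for polynomial and then for continuous data\<close>

lemma weak_solution_poly_deg:
  fixes f :: "'a::euclidean_space \<Rightarrow> real"
  assumes "poly_deg m f" "open U"
  shows "weak_solution U f (laplacian f)"
  by (rule weak_solution_subset[OF weak_solution_laplacian[OF open_UNIV
        higher_differentiable_on_poly_deg[OF assms(1)]]]) simp

lemma weak_solution_quadratic:
  fixes c :: "'a::euclidean_space"
  assumes "open U"
  shows "weak_solution U (\<lambda>x. A + B * (C - (x - c) \<bullet> (x - c))) (\<lambda>_. - (2 * B * DIM('a)))"
  by (rule weak_solution_cong[OF weak_solution_poly_deg[OF poly_deg_quadratic assms]])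
     (simp_all add: laplacian_quadratic)

text \<open>Compare with \<epsilon> + \<epsilon> (R^2 - |x - c|^2) and its negative: on the sphere
  it equals \<epsilon>, its Laplacian is -2 n \<epsilon> \<le> -\<epsilon>, and its maximum is
  \<epsilon> (1 + R^2).\<close>

lemma weak_solution_ball_bound:
  fixes c :: "'a::euclidean_space"
  assumes R: "0 < R" and u: "continuous_on (cball c R) u" and w: "weak_solution (ball c R) u g"
    and s: "\<And>x. x \<in> sphere c R \<Longrightarrow> \<bar>u x\<bar> \<le> \<epsilon>" and g: "\<And>x. x \<in> ball c R \<Longrightarrow> \<bar>g x\<bar> \<le> \<epsilon>"
    and \<epsilon>: "0 \<le> \<epsilon>" and x: "x \<in> cball c R"
  shows "\<bar>u x\<bar> \<le> \<epsilon> * (1 + R\<^sup>2)"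
proof -
  let ?U = "ball c R"
  let ?b = "\<lambda>B x. B + B * (R\<^sup>2 - (x - c) \<bullet> (x - c))"
  have cl: "closure ?U = cball c R" "frontier ?U = sphere c R" using R by auto
  have b: "weak_solution ?U (?b B) (\<lambda>_. - (2 * B * DIM('a)))" for B
    by (rule weak_solution_quadratic[OF open_ball])
  have cb: "continuous_on S (?b B)" for S B by (intro continuous_intros)
  have sph: "(x - c) \<bullet> (x - c) = R\<^sup>2" if "x \<in> sphere c R" for x
    using that by (simp add: dist_norm norm_minus_commute flip: power2_norm_eq_inner)
  have n: "\<epsilon> \<le> 2 * \<epsilon> * DIM('a)"
  proof -
    have "1 \<le> 2 * real DIM('a)" using DIM_positive[where 'a='a] by linarith
    from mult_left_mono[OF this \<epsilon>] show ?thesis by (simp add: mult_ac)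
  qed
  have g1: "- (2 * \<epsilon> * DIM('a)) \<le> g x" "g x \<le> - (2 * (- \<epsilon>) * DIM('a))" if "x \<in> ball c R" for x
    using g[OF that] n by (simp_all add: abs_le_iff)
  have s1: "u x \<le> ?b \<epsilon> x" "?b (- \<epsilon>) x \<le> u x" if "x \<in> sphere c R" for x
    using s[OF that] sph[OF that] by (simp_all add: abs_le_iff)
  have cu: "continuous_on (closure ?U) u" and x': "x \<in> closure ?U" using u x cl by simp_all
  have s2: "u x \<le> ?b \<epsilon> x" "?b (- \<epsilon>) x \<le> u x" if "x \<in> frontier ?U" for x
    using s1 that unfolding cl by blast+
  have "u x \<le> ?b \<epsilon> x"
    by (rule weak_comparison[OF open_ball bounded_ball cu cb weak_solution_imp_sub_super(1)[OF open_ball w]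
          weak_solution_imp_sub_super(2)[OF open_ball b[of \<epsilon>]] g1(1) s2(1) x'])
  moreover have "?b (- \<epsilon>) x \<le> u x"
    by (rule weak_comparison[OF open_ball bounded_ball cb cu weak_solution_imp_sub_super(1)[OF open_ball b[of "- \<epsilon>"]]
          weak_solution_imp_sub_super(2)[OF open_ball w] g1(2) s2(2) x'])
  moreover have "?b \<epsilon> x \<le> \<epsilon> * (1 + R\<^sup>2)"
    using \<epsilon> mult_left_mono[of "R\<^sup>2 - (x - c) \<bullet> (x - c)" "R\<^sup>2" \<epsilon>] by (simp add: distrib_left)
  moreover have "?b (- \<epsilon>) x = - ?b \<epsilon> x" by simp
  ultimately show ?thesis by (intro abs_leI) linarith+
qed

text \<open>Restricted to the line through c and y, the polynomial has one variable and infinitely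
  many zeros.\<close>

lemma real_polynomial_function_eq_0:
  fixes s :: "'a::euclidean_space \<Rightarrow> real"
  assumes s: "real_polynomial_function s" and R: "0 < R" and 0: "\<And>x. x \<in> ball c R \<Longrightarrow> s x = 0"
  shows "s y = 0"
proof -
  define l where "l = (\<lambda>t::real. c + t *\<^sub>R (y - c))"
  have "polynomial_function l"
    unfolding l_def by (intro polynomial_function_add polynomial_function_const
        polynomial_function_bounded_linear bounded_linear_scaleR_left)
  then have "real_polynomial_function (s \<circ> l)" using s by (rule real_polynomial_function_compose)
  then obtain a n where an: "s \<circ> l = (\<lambda>t. \<Sum>i\<le>n. a i * t ^ i)"
    unfolding real_polynomial_function_iff_sum by blast
  define e where "e = R / (norm (y - c) + 1)"
  have n1: "0 < norm (y - c) + 1" by (rule add_nonneg_pos) simp_all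
  have e: "0 < e" using R n1 by (simp add: e_def)
  have zero: "(\<Sum>i\<le>n. a i * t ^ i) = 0" if t: "t \<in> {0<..<e}" for t
  proof -
    have "t * norm (y - c) \<le> t * (norm (y - c) + 1)" using t by simp
    also have "\<dots> < e * (norm (y - c) + 1)" using t n1 by (intro mult_strict_right_mono) auto
    also have "\<dots> = R" using n1 by (simp add: e_def)
    finally have "l t \<in> ball c R" using t by (simp add: l_def dist_norm)
    then show ?thesis using 0 an by (metis comp_apply)
  qed
  have "infinite {0<..<e}" using e by (rule infinite_Ioo)
  moreover have "{0<..<e} \<subseteq> {t. (\<Sum>i\<le>n. a i * t ^ i) = 0}" using zero by blast
  ultimately have "infinite {t. (\<Sum>i\<le>n. a i * t ^ i) = 0}" by (rule infinite_super[rotated])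
  then have "\<forall>i\<le>n. a i = 0" by (simp add: polyfun_finite_roots)
  then have "(s \<circ> l) 1 = 0" by (simp add: an)
  then show ?thesis by (simp add: l_def)
qed

text \<open>Fischer's argument: look for w = p + q s with q = R^2 - |x - c|^2, which vanishes on the
  sphere. The map from s to the Laplacian of q s keeps the degree, as q adds 2 and the Laplacian
  removes 2; by the maximum principle it is injective, hence onto.\<close>

lemma ball_poisson_polynomial:
  fixes c :: "'a::euclidean_space"
  assumes R: "0 < R" and p: "real_polynomial_function p" and g: "real_polynomial_function g"
  shows "\<exists>m w. poly_deg m w \<and> (\<forall>x. laplacian w x = g x) \<and> (\<forall>x\<in>sphere c R. w x = p x)"
proof -
  define q where "q = (\<lambda>x::'a. R\<^sup>2 - (x - c) \<bullet> (x - c))"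
  have q: "poly_deg 2 q"
    using poly_deg_quadratic[of 0 1 "R\<^sup>2" c] by (simp add: q_def)
  have sph: "q x = 0" if "x \<in> sphere c R" for x
    using that by (simp add: q_def dist_norm norm_minus_commute flip: power2_norm_eq_inner)
  obtain m1 where m1: "poly_deg m1 g" using real_polynomial_function_imp_poly_deg[OF g] by blast
  obtain m2 where m2: "poly_deg m2 p" using real_polynomial_function_imp_poly_deg[OF p] by blast
  define m where "m = max m1 m2"
  \<comment> \<open>What the Laplacian of q s must be, so that p + q s has Laplacian g.\<close>
  define y where "y = (\<lambda>x. g x + (-1) * laplacian p x)"
  have y: "poly_deg m y"
    unfolding y_def
    by (intro poly_deg.add poly_deg_cmult poly_deg_mono[OF m1] poly_deg_mono[OF poly_deg_laplacian[OF m2]])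
       (auto simp: m_def)
  define L where "L = (\<lambda>s. laplacian (\<lambda>x. q x * s x))"
  have hq: "higher_differentiable_on UNIV (\<lambda>x. q x * s x) 2" if "poly_deg m s" for s
    by (rule higher_differentiable_on_poly_deg[OF poly_deg_mult[OF q that]])
  obtain T where T: "finite T" "\<And>f::'a \<Rightarrow> real. poly_deg m f \<Longrightarrow> f \<in> real_fun.span T"
    using poly_deg_finite_span[of m] by blast
  have "\<exists>s\<in>Collect (poly_deg m). L s = y"
  proof (rule real_fun.injective_imp_surjective_on_subspace[where T=T])
    show "real_fun.subspace (Collect (poly_deg m))"
      by (rule real_fun.subspaceI)
         (auto simp: zero_fun_def plus_fun_def intro: poly_deg.const poly_deg.add poly_deg_cmult)
    show "Collect (poly_deg m) \<subseteq> real_fun.span T" using T(2) by blast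
    show "L s \<in> Collect (poly_deg m)" if "s \<in> Collect (poly_deg m)" for s
      using poly_deg_laplacian[OF poly_deg_mult[OF q, of m s]] that by (simp add: L_def)
    show "L (s + t) = L s + L t" if "s \<in> Collect (poly_deg m)" "t \<in> Collect (poly_deg m)" for s t
    proof (rule ext)
      fix x
      have "(\<lambda>x. q x * (s + t) x) = (\<lambda>x. 1 * (q x * s x) + 1 * (q x * t x))"
        by (simp add: plus_fun_def distrib_left)
      then show "L (s + t) x = (L s + L t) x"
        using laplacian_lincomb[OF open_UNIV UNIV_I hq[of s] hq[of t], where a=1 and b=1] that by (simp add: L_def)
    qed
    show "L (\<lambda>x. k * s x) = (\<lambda>x. k * L s x)" if "s \<in> Collect (poly_deg m)" for k s
    proof (rule ext)
      fix x
      have "(\<lambda>x. q x * (k * s x)) = (\<lambda>x. k * (q x * s x) + 0 * (q x * s x))"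
        by (simp add: mult.left_commute)
      then show "L (\<lambda>x. k * s x) x = k * L s x"
        using laplacian_lincomb[OF open_UNIV UNIV_I hq[of s] hq[of s], where a=k and b=0] that by (simp add: L_def)
    qed
    \<comment> \<open>q s is harmonic in the ball and vanishes on the sphere, so it is zero by the
      bound with \<epsilon> = 0. Inside the ball q > 0, hence s = 0 there and then
      everywhere.\<close>
    show "s = 0" if s: "s \<in> Collect (poly_deg m)" and "L s = 0" for s
    proof -
      have s': "poly_deg m s" using s by simp
      have "weak_solution (ball c R) (\<lambda>x. q x * s x) (L s)"
        unfolding L_def by (rule weak_solution_poly_deg[OF poly_deg_mult[OF q s'] open_ball])
      then have ws: "weak_solution (ball c R) (\<lambda>x. q x * s x) (\<lambda>_. 0)"
        using \<open>L s = 0\<close> by (simp add: zero_fun_def)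
      have cont: "continuous_on (cball c R) (\<lambda>x. q x * s x)"
        using continuous_on_subset[OF higher_differentiable_on_imp_continuous_on[OF hq[OF s']]] by simp
      have z: "\<bar>q x * s x\<bar> \<le> 0 * (1 + R\<^sup>2)" if "x \<in> cball c R" for x
        by (rule weak_solution_ball_bound[OF R cont ws _ _ order_refl that]) (simp_all add: sph)
      have "s x = 0" if "x \<in> ball c R" for x
      proof -
        have "norm (x - c) < R" using that by (simp add: dist_norm norm_minus_commute)
        then have "q x > 0"
          using R by (simp add: q_def power_strict_mono flip: power2_norm_eq_inner)
        moreover have "x \<in> cball c R" using that by simp
        ultimately show ?thesis using z[of x] by simp
      qed
      then have "s x = 0" for x
        by (rule real_polynomial_function_eq_0[OF poly_deg_imp_real_polynomial_function[OF s'] R])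
      then show ?thesis by (simp add: fun_eq_iff)
    qed
  qed (use T(1) y in auto)
  then obtain s where s: "poly_deg m s" "L s = y" by blast
  define w where "w = (\<lambda>x. 1 * p x + 1 * (q x * s x))"
  have w: "poly_deg (max m2 (2 + m)) w"
    unfolding w_def
    by (intro poly_deg.add poly_deg_cmult poly_deg_mono[OF m2] poly_deg_mono[OF poly_deg_mult[OF q s(1)]]) auto
  have "laplacian w x = g x" for x
  proof -
    have "laplacian w x = 1 * laplacian p x + 1 * L s x"
      unfolding w_def L_def
      by (rule laplacian_lincomb[OF open_UNIV UNIV_I higher_differentiable_on_poly_deg[OF m2] hq[OF s(1)]])
    then show ?thesis using s(2) by (simp add: y_def)
  qed
  moreover have "\<forall>x\<in>sphere c R. w x = p x" using sph by (simp add: w_def)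
  ultimately show ?thesis using w by blast
qed

text \<open>The bound for data of size \<epsilon> makes the solutions for approximating polynomial
  data uniformly Cauchy on the closed ball, and uniform limits of weak solutions are weak
  solutions.\<close>

theorem ball_poisson:
  fixes c :: "'a::euclidean_space"
  assumes R: "0 < R" and \<phi>: "continuous_on (cball c R) \<phi>" and g: "continuous_on (cball c R) g"
  shows "\<exists>w. continuous_on (cball c R) w \<and> (\<forall>x\<in>sphere c R. w x = \<phi> x) \<and> weak_solution (ball c R) w g"
proof -
  have approx: "\<exists>p. real_polynomial_function p \<and> (\<forall>y\<in>cball c R. \<bar>h y - p y\<bar> < 1 / real (Suc n))"
    if ch: "continuous_on (cball c R) h" for h :: "'a \<Rightarrow> real" and n
  proof -
    have pos: "0 < 1 / real (Suc n)" by simp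
    obtain q where "real_polynomial_function q" "\<And>y. y \<in> cball c R \<Longrightarrow> \<bar>h y - q y\<bar> < 1 / real (Suc n)"
      by (rule Stone_Weierstrass_real_polynomial_function[OF compact_cball ch pos], rule that, assumption, simp)
    then show ?thesis by (intro exI[of _ q]) simp
  qed
  define \<phi>n where "\<phi>n = (\<lambda>n. SOME p. real_polynomial_function p \<and> (\<forall>y\<in>cball c R. \<bar>\<phi> y - p y\<bar> < 1 / real (Suc n)))"
  define gn where "gn = (\<lambda>n. SOME p. real_polynomial_function p \<and> (\<forall>y\<in>cball c R. \<bar>g y - p y\<bar> < 1 / real (Suc n)))"
  have \<phi>n: "real_polynomial_function (\<phi>n n)" "\<forall>y\<in>cball c R. \<bar>\<phi> y - \<phi>n n y\<bar> < 1 / real (Suc n)" for n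
    using someI_ex[OF approx[OF \<phi>, of n]] unfolding \<phi>n_def by blast+
  have gn: "real_polynomial_function (gn n)" "\<forall>y\<in>cball c R. \<bar>g y - gn n y\<bar> < 1 / real (Suc n)" for n
    using someI_ex[OF approx[OF g, of n]] unfolding gn_def by blast+
  define W where "W = (\<lambda>n. SOME w. \<exists>m. poly_deg m w \<and> (\<forall>x. laplacian w x = gn n x) \<and> (\<forall>x\<in>sphere c R. w x = \<phi>n n x))"
  have W: "\<exists>m. poly_deg m (W n) \<and> (\<forall>x. laplacian (W n) x = gn n x) \<and> (\<forall>x\<in>sphere c R. W n x = \<phi>n n x)" for n
  proof -
    have "\<exists>w m. poly_deg m w \<and> (\<forall>x. laplacian w x = gn n x) \<and> (\<forall>x\<in>sphere c R. w x = \<phi>n n x)"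
      using ball_poisson_polynomial[OF R \<phi>n(1)[of n] gn(1)[of n], of c] by blast
    from someI_ex[OF this] show ?thesis unfolding W_def .
  qed
  have Ws: "W n x = \<phi>n n x" if "x \<in> sphere c R" for n x using W[of n] that by blast
  have cW: "continuous_on (cball c R) (W n)" for n
  proof -
    obtain m where "poly_deg m (W n)" using W[of n] by blast
    from higher_differentiable_on_imp_continuous_on[OF higher_differentiable_on_poly_deg[OF this, of 0]]
    show ?thesis by (rule continuous_on_subset) simp
  qed
  have wW: "weak_solution (ball c R) (W n) (gn n)" for n
  proof -
    obtain m where m: "poly_deg m (W n)" using W[of n] by blast
    show ?thesis
      by (rule weak_solution_cong[OF weak_solution_poly_deg[OF m open_ball]]) (use W[of n] in auto)
  qed
  have "uniformly_Cauchy_on (cball c R) W"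
  proof (rule uniformly_Cauchy_onI)
    fix e :: real assume e: "e > 0"
    have K: "0 < 2 * (1 + R\<^sup>2)" by (simp add: add_pos_nonneg)
    obtain M where M: "inverse (real (Suc M)) < e / (2 * (1 + R\<^sup>2))"
      using reals_Archimedean[OF divide_pos_pos[OF e K]] by blast
    show "\<exists>M. \<forall>x\<in>cball c R. \<forall>m\<ge>M. \<forall>n\<ge>M. dist (W m x) (W n x) < e"
    proof (intro exI[of _ M] ballI allI impI)
      fix x m n assume x: "x \<in> cball c R" and mn: "M \<le> m" "M \<le> n"
      \<comment> \<open>Two approximations, each within 1/(M + 1) of the same function, differ by at
        most this.\<close>
      define \<epsilon> where "\<epsilon> = 2 * inverse (real (Suc M))"
      have close: "\<bar>h y - h' y\<bar> \<le> \<epsilon>"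
        if "\<bar>k y - h y\<bar> < 1 / real (Suc m)" "\<bar>k y - h' y\<bar> < 1 / real (Suc n)" for h h' k :: "'a \<Rightarrow> real" and y
      proof -
        have "1 / real (Suc m) \<le> inverse (real (Suc M))" "1 / real (Suc n) \<le> inverse (real (Suc M))"
          using mn unfolding inverse_eq_divide by (intro frac_le; simp)+
        then show ?thesis using that unfolding \<epsilon>_def by linarith
      qed
      have "\<bar>W m x - W n x\<bar> \<le> \<epsilon> * (1 + R\<^sup>2)"
      proof (rule weak_solution_ball_bound[OF R continuous_on_diff[OF cW cW] weak_solution_diff[OF wW wW] _ _ _ x])
        fix y assume "y \<in> sphere c R"
        then have "y \<in> cball c R" by simp
        then show "\<bar>W m y - W n y\<bar> \<le> \<epsilon>"
          unfolding Ws[OF \<open>y \<in> sphere c R\<close>]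
          by (intro close[of \<phi>] bspec[OF \<phi>n(2)])
      next
        fix y assume "y \<in> ball c R"
        then have "y \<in> cball c R" by simp
        then show "\<bar>gn m y - gn n y\<bar> \<le> \<epsilon>"
          by (intro close[of g] bspec[OF gn(2)])
      qed (simp add: \<epsilon>_def)
      also have "\<epsilon> * (1 + R\<^sup>2) = inverse (real (Suc M)) * (2 * (1 + R\<^sup>2))" by (simp add: \<epsilon>_def)
      also have "\<dots> < e" using M K by (simp only: pos_less_divide_eq)
      finally show "dist (W m x) (W n x) < e" by (simp add: dist_real_def)
    qed
  qed
  then obtain w where w: "uniform_limit (cball c R) W w sequentially"
    using Cauchy_uniformly_convergent unfolding uniformly_convergent_on_def by blast
  have cw: "continuous_on (cball c R) w"
    by (rule uniform_limit_theorem[OF always_eventually w sequentially_bot]) (simp add: cW)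
  have lim0: "(\<lambda>n. 1 / real (Suc n)) \<longlonglongrightarrow> 0"
    using LIMSEQ_inverse_real_of_nat by (simp add: inverse_eq_divide)
  have "w x = \<phi> x" if x: "x \<in> sphere c R" for x
  proof -
    have x': "x \<in> cball c R" using x by simp
    have "(\<lambda>n. \<phi>n n x) \<longlonglongrightarrow> w x"
      using tendsto_uniform_limitI[OF w x'] Ws[OF x] by simp
    moreover have "(\<lambda>n. \<phi>n n x) \<longlonglongrightarrow> \<phi> x"
    proof (rule LIM_zero_cancel, rule Lim_null_comparison[OF _ lim0], rule always_eventually, rule allI)
      show "norm (\<phi>n n x - \<phi> x) \<le> 1 / real (Suc n)" for n
        using bspec[OF \<phi>n(2) x', of n] by (simp add: abs_minus_commute)
    qed
    ultimately show ?thesis by (rule LIMSEQ_unique)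
  qed
  moreover have "weak_solution (ball c R) w g"
  proof (rule weak_solution_uniform_limit[OF wW])
    show "uniform_limit (ball c R) W w sequentially"
      by (rule uniform_limit_on_subset[OF w]) auto
    show "uniform_limit (ball c R) gn g sequentially"
    proof (rule uniform_limitI)
      fix e :: real assume "e > 0"
      have "\<forall>\<^sub>F n in sequentially. 1 / real (Suc n) < e"
        by (rule order_tendstoD(2)[OF lim0 \<open>e > 0\<close>])
      then show "\<forall>\<^sub>F n in sequentially. \<forall>x\<in>ball c R. dist (gn n x) (g x) < e"
      proof (rule eventually_mono, intro ballI)
        fix n x assume n: "1 / real (Suc n) < e" and "x \<in> ball c R"
        then have "x \<in> cball c R" by simp
        from bspec[OF gn(2) this, of n] n show "dist (gn n x) (g x) < e"
          by (simp only: dist_real_def abs_minus_commute[of "gn n x"])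
      qed
    qed
  qed
  ultimately show ?thesis using cw by blast
qed

subsection \<open>The Dirichlet problem in bounded convex domains\<close>

text \<open>Solutions assembled from balls satisfy the identity only at scales that depend on the
  point. This notion accommodates them; on balls whose closure lies inside, the identity at all
  fitting scales is recovered.\<close>

definition locally_weak_solution :: "'a::euclidean_space set \<Rightarrow> ('a \<Rightarrow> real) \<Rightarrow> ('a \<Rightarrow> real) \<Rightarrow> bool" where
  "locally_weak_solution U v g \<longleftrightarrow> weak_subsolution U v g \<and> weak_supersolution U v g"

lemma locally_weak_solutionD:
  assumes "locally_weak_solution U v g"
  shows "weak_subsolution U v g" "weak_supersolution U v g" "continuous_on U v" "continuous_on U g"
  using assms unfolding locally_weak_solution_def weak_subsolution_def by blast+

lemma weak_solution_imp_locally: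
  "open U \<Longrightarrow> weak_solution U v g \<Longrightarrow> locally_weak_solution U v g"
  unfolding locally_weak_solution_def by (intro conjI weak_solution_imp_sub_super)

lemma locally_weak_solution_subset:
  "locally_weak_solution U v g \<Longrightarrow> open V \<Longrightarrow> V \<subseteq> U \<Longrightarrow> locally_weak_solution V v g"
  unfolding locally_weak_solution_def by (meson weak_subsolution_subset weak_supersolution_subset)

text \<open>In the ball there is a genuine weak solution with the same boundary values and the same
  g; comparison in both directions shows that it coincides with v.\<close>

lemma locally_weak_solution_ball:
  fixes v :: "'a::euclidean_space \<Rightarrow> real"
  assumes v: "locally_weak_solution U v g" and R: "0 < R" and sub: "cball c R \<subseteq> U"
  shows "weak_solution (ball c R) v g"
proof -
  have cv: "continuous_on (cball c R) v" and cg: "continuous_on (cball c R) g"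
    using locally_weak_solutionD(3,4)[OF v] sub continuous_on_subset by blast+
  obtain w where w: "continuous_on (cball c R) w" "\<forall>x\<in>sphere c R. w x = v x" "weak_solution (ball c R) w g"
    using ball_poisson[OF R cv cg] by blast
  have bU: "ball c R \<subseteq> U" using sub ball_subset_cball by blast
  have cl: "closure (ball c R) = cball c R" "frontier (ball c R) = sphere c R" using R by auto
  note vb = locally_weak_solution_subset[OF v open_ball bU]
    and wb = weak_solution_imp_locally[OF open_ball w(3)]
  have eq: "w x = v x" if x: "x \<in> ball c R" for x
  proof (rule antisym)
    have x': "x \<in> closure (ball c R)" using x closure_subset by blast
    have s: "w x \<le> v x" "v x \<le> w x" if "x \<in> frontier (ball c R)" for x
      using w(2) that unfolding cl by auto
    show "w x \<le> v x"
      by (rule weak_comparison[OF open_ball bounded_ball w(1)[folded cl(1)] cv[folded cl(1)]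
            locally_weak_solutionD(1)[OF wb] locally_weak_solutionD(2)[OF vb] order_refl s(1) x'])
    show "v x \<le> w x"
      by (rule weak_comparison[OF open_ball bounded_ball cv[folded cl(1)] w(1)[folded cl(1)]
            locally_weak_solutionD(1)[OF vb] locally_weak_solutionD(2)[OF wb] order_refl s(2) x'])
  qed
  show ?thesis by (rule weak_solution_cong[OF w(3) eq refl])
qed

lemma locally_weak_solutionI:
  fixes v :: "'a::euclidean_space \<Rightarrow> real"
  assumes "\<And>x. x \<in> U \<Longrightarrow> \<exists>V. open V \<and> x \<in> V \<and> V \<subseteq> U \<and> weak_solution V v g"
  shows "locally_weak_solution U v g"
proof -
  have ex: "\<exists>e>0. \<forall>r. 0 < r \<longrightarrow> r < e \<longrightarrow> fits U r x \<and> v x = mean_op r v x - pot_op r g x" if x: "x \<in> U" for x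
  proof -
    obtain V where V: "open V" "x \<in> V" "V \<subseteq> U" "weak_solution V v g" using assms[OF x] by blast
    obtain e where e: "e > 0" "\<And>r. 0 < r \<Longrightarrow> r < e \<Longrightarrow> fits V r x" using fits_small[OF V(1,2)] by blast
    have "fits U r x \<and> v x = mean_op r v x - pot_op r g x" if r: "0 < r" "r < e" for r
      using fits_subset[OF e(2)[OF r] V(3)] weak_solutionD(3)[OF V(4) e(2)[OF r]] by (rule conjI)
    then show ?thesis using e(1) by blast
  qed
  have "isCont v x \<and> isCont g x" if x: "x \<in> U" for x
  proof -
    obtain V where V: "open V" "x \<in> V" "weak_solution V v g" using assms[OF x] by blast
    show ?thesis
      using weak_solutionD(1,2)[OF V(3)] V(1,2) by (simp add: continuous_on_eq_continuous_at)
  qed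
  then have c: "continuous_on U v" "continuous_on U g"
    by (simp_all add: continuous_at_imp_continuous_on)
  have "\<exists>e>0. \<forall>r. 0 < r \<longrightarrow> r < e \<longrightarrow> fits U r x \<and> v x \<le> mean_op r v x - pot_op r g x"
    "\<exists>e>0. \<forall>r. 0 < r \<longrightarrow> r < e \<longrightarrow> fits U r x \<and> mean_op r v x - pot_op r g x \<le> v x" if x: "x \<in> U" for x
  proof -
    obtain e where e: "e > 0" "\<And>r. 0 < r \<Longrightarrow> r < e \<Longrightarrow> fits U r x \<and> v x = mean_op r v x - pot_op r g x"
      using ex[OF x] by blast
    show "\<exists>e>0. \<forall>r. 0 < r \<longrightarrow> r < e \<longrightarrow> fits U r x \<and> v x \<le> mean_op r v x - pot_op r g x"
      by (rule exI[of _ e]) (use e in simp)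
    show "\<exists>e>0. \<forall>r. 0 < r \<longrightarrow> r < e \<longrightarrow> fits U r x \<and> mean_op r v x - pot_op r g x \<le> v x"
      by (rule exI[of _ e]) (use e in simp)
  qed
  with c show ?thesis
    unfolding locally_weak_solution_def weak_subsolution_def weak_supersolution_def by blast
qed

lemma open_ball_inside:
  fixes x :: "'a::euclidean_space"
  assumes "open U" "x \<in> U"
  shows "\<exists>R>0. cball x R \<subseteq> U"
  using assms open_contains_cball by blast

lemma locally_weak_solution_cong:
  assumes U: "open U" and v: "locally_weak_solution U v g"
    and "\<And>x. x \<in> U \<Longrightarrow> v x = v' x" "\<And>x. x \<in> U \<Longrightarrow> g x = g' x"
  shows "locally_weak_solution U v' g'"
proof (rule locally_weak_solutionI)
  fix x assume x: "x \<in> U"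
  obtain R where R: "R > 0" "cball x R \<subseteq> U" using open_ball_inside[OF U x] by blast
  then have b: "ball x R \<subseteq> U" using ball_subset_cball by blast
  have "weak_solution (ball x R) v' g'"
    by (rule weak_solution_cong[OF locally_weak_solution_ball[OF v R]]) (use assms(3,4) b in auto)
  then show "\<exists>V. open V \<and> x \<in> V \<and> V \<subseteq> U \<and> weak_solution V v' g'"
    using R(1) b by (intro exI[of _ "ball x R"]) simp
qed

lemma locally_weak_solution_diff:
  assumes U: "open U" and v: "locally_weak_solution U v g" and w: "locally_weak_solution U w h"
  shows "locally_weak_solution U (\<lambda>x. v x - w x) (\<lambda>x. g x - h x)"
proof (rule locally_weak_solutionI)
  fix x assume x: "x \<in> U"
  obtain R where R: "R > 0" "cball x R \<subseteq> U" using open_ball_inside[OF U x] by blast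
  then have b: "ball x R \<subseteq> U" using ball_subset_cball by blast
  have "weak_solution (ball x R) (\<lambda>x. v x - w x) (\<lambda>x. g x - h x)"
    by (rule weak_solution_diff[OF locally_weak_solution_ball[OF v R] locally_weak_solution_ball[OF w R]])
  then show "\<exists>V. open V \<and> x \<in> V \<and> V \<subseteq> U \<and> weak_solution V (\<lambda>x. v x - w x) (\<lambda>x. g x - h x)"
    using R(1) b by (intro exI[of _ "ball x R"]) simp
qed

lemma locally_weak_solution_uniform_limit:
  assumes U: "open U" and ws: "\<And>n. locally_weak_solution U (vn n) (gn n)"
    and v: "uniform_limit U vn v sequentially" and g: "uniform_limit U gn g sequentially"
  shows "locally_weak_solution U v g"
proof (rule locally_weak_solutionI)
  fix x assume x: "x \<in> U"
  obtain R where R: "R > 0" "cball x R \<subseteq> U" using open_ball_inside[OF U x] by blast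
  then have b: "ball x R \<subseteq> U" using ball_subset_cball by blast
  have "weak_solution (ball x R) v g"
    by (rule weak_solution_uniform_limit[OF locally_weak_solution_ball[OF ws R]
          uniform_limit_on_subset[OF v b] uniform_limit_on_subset[OF g b]])
  then show "\<exists>V. open V \<and> x \<in> V \<and> V \<subseteq> U \<and> weak_solution V v g"
    using R(1) b by (intro exI[of _ "ball x R"]) simp
qed

section \<open>Lifting a subsolution in a ball, and balayage\<close>

definition is_lift :: "'a::euclidean_space set \<Rightarrow> ('a \<Rightarrow> real) \<Rightarrow> 'a \<Rightarrow> real \<Rightarrow> ('a \<Rightarrow> real) \<Rightarrow> ('a \<Rightarrow> real) \<Rightarrow> bool" where
  "is_lift \<Omega> g c R v v' \<longleftrightarrow> continuous_on (closure \<Omega>) v' \<and> weak_subsolution \<Omega> v' g \<and>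
     (\<forall>x. x \<notin> ball c R \<longrightarrow> v' x = v x) \<and> (\<forall>x. v x \<le> v' x) \<and> weak_solution (ball c R) v' g"

text \<open>Inside the ball, v is replaced by the solution with boundary values v, which lies above
  v by comparison. The glued function is again a subsolution thanks to the local form of that
  notion.\<close>

lemma ball_lift_exists:
  fixes v :: "'a::euclidean_space \<Rightarrow> real"
  assumes \<Omega>: "open \<Omega>" and cv: "continuous_on (closure \<Omega>) v" and v: "weak_subsolution \<Omega> v g"
    and R: "0 < R" and sub: "cball c R \<subseteq> \<Omega>"
  shows "\<exists>v'. is_lift \<Omega> g c R v v'"
proof -
  have cg: "continuous_on \<Omega> g" and cv\<Omega>: "continuous_on \<Omega> v"
    using v unfolding weak_subsolution_def by blast+
  have cvb: "continuous_on (cball c R) v" and cgb: "continuous_on (cball c R) g"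
    by (rule continuous_on_subset[OF cv\<Omega> sub], rule continuous_on_subset[OF cg sub])
  obtain w where w: "continuous_on (cball c R) w" "\<forall>x\<in>sphere c R. w x = v x" "weak_solution (ball c R) w g"
    using ball_poisson[OF R cvb cgb] by blast
  define v' where "v' = (\<lambda>x. if x \<in> ball c R then w x else v x)"
  have cl: "closure (ball c R) = cball c R" "frontier (ball c R) = sphere c R" using R by auto
  have b\<Omega>: "ball c R \<subseteq> \<Omega>" using sub ball_subset_cball by blast
  have out: "\<forall>x. x \<notin> ball c R \<longrightarrow> v' x = v x" by (simp add: v'_def)
  have ge: "v x \<le> v' x" for x
  proof (cases "x \<in> ball c R")
    case True
    have x': "x \<in> closure (ball c R)" using True closure_subset by blast
    have s: "v x \<le> w x" if "x \<in> frontier (ball c R)" for x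
      using w(2) that unfolding cl by auto
    have "v x \<le> w x"
      by (rule weak_comparison[OF open_ball bounded_ball cvb[folded cl(1)] w(1)[folded cl(1)]
            weak_subsolution_subset[OF v open_ball b\<Omega>] weak_solution_imp_sub_super(2)[OF open_ball w(3)]
            order_refl s x'])
    then show ?thesis using True by (simp add: v'_def)
  qed (simp add: v'_def)
  have cv': "continuous_on (closure \<Omega>) v'"
  proof -
    have "continuous_on (cball c R \<union> (closure \<Omega> - ball c R)) (\<lambda>x. if x \<in> ball c R then w x else v x)"
    proof (rule continuous_on_cases)
      show "closed (closure \<Omega> - ball c R)" by (intro closed_Diff closed_closure open_ball)
      show "continuous_on (closure \<Omega> - ball c R) v" by (rule continuous_on_subset[OF cv]) auto
      show "\<forall>x. x \<in> cball c R \<and> x \<notin> ball c R \<or> x \<in> closure \<Omega> - ball c R \<and> x \<in> ball c R \<longrightarrow> w x = v x"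
        using w(2) by auto
    qed (use w(1) in auto)
    moreover have "cball c R \<union> (closure \<Omega> - ball c R) = closure \<Omega>"
      using sub closure_subset[of \<Omega>] by auto
    ultimately show ?thesis by (simp only: v'_def)
  qed
  have ws': "weak_solution (ball c R) v' g"
    by (rule weak_solution_cong[OF w(3)]) (simp_all add: v'_def)
  have cv'\<Omega>: "continuous_on \<Omega> v'" by (rule continuous_on_subset[OF cv' closure_subset])
  have "\<exists>e>0. \<forall>r. 0 < r \<longrightarrow> r < e \<longrightarrow> fits \<Omega> r x \<and> v' x \<le> mean_op r v' x - pot_op r g x" if x: "x \<in> \<Omega>" for x
  proof (cases "x \<in> ball c R")
    case True
    obtain e where e: "e > 0" "\<And>r. 0 < r \<Longrightarrow> r < e \<Longrightarrow> fits (ball c R) r x"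
      using fits_small[OF open_ball True] by blast
    have "fits \<Omega> r x \<and> v' x \<le> mean_op r v' x - pot_op r g x" if r: "0 < r" "r < e" for r
      using fits_subset[OF e(2)[OF r] b\<Omega>] eq_refl[OF weak_solutionD(3)[OF ws' e(2)[OF r]]] by (rule conjI)
    then show ?thesis using e(1) by blast
  next
    \<comment> \<open>On and outside the sphere the value is still that of v while the mean can only
      have grown, so the inequality for v carries over. Points on the sphere belong to this
      case.\<close>
    case False
    obtain e where e: "e > 0" "\<And>r. 0 < r \<Longrightarrow> r < e \<Longrightarrow> fits \<Omega> r x \<and> v x \<le> mean_op r v x - pot_op r g x"
      using v x unfolding weak_subsolution_def by blast
    have "fits \<Omega> r x \<and> v' x \<le> mean_op r v' x - pot_op r g x" if r: "0 < r" "r < e" for r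
    proof -
      have f: "fits \<Omega> r x" using e(2)[OF r] by blast
      have "mean_op r v x \<le> mean_op r v' x" by (rule mean_op_mono[OF f cv\<Omega> cv'\<Omega> ge])
      then show ?thesis using e(2)[OF r] False out f by simp
    qed
    then show ?thesis using e(1) by blast
  qed
  then have "weak_subsolution \<Omega> v' g"
    using cg cv'\<Omega> unfolding weak_subsolution_def by blast
  then have "is_lift \<Omega> g c R v v'"
    using cv' out ge ws' unfolding is_lift_def by blast
  then show ?thesis by (intro exI[of _ v'])
qed

text \<open>Lindelof: balayage proceeds in a sequence of steps, so countably many balls must
  suffice.\<close>

lemma countable_ball_cover:
  fixes \<Omega> :: "'a::euclidean_space set"
  assumes \<Omega>: "open \<Omega>" "\<Omega> \<noteq> {}"
  shows "\<exists>(c :: nat \<Rightarrow> 'a) R. (\<forall>k. 0 < R k \<and> cball (c k) (R k) \<subseteq> \<Omega>) \<and> (\<forall>x\<in>\<Omega>. \<exists>k. x \<in> ball (c k) (R k))"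
proof -
  define F where "F = {ball c R | c R. 0 < R \<and> cball c R \<subseteq> \<Omega>}"
  have F: "\<Union>F = \<Omega>"
  proof
    show "\<Union>F \<subseteq> \<Omega>" using ball_subset_cball by (fastforce simp: F_def)
    show "\<Omega> \<subseteq> \<Union>F"
    proof
      fix x assume "x \<in> \<Omega>"
      then obtain R where "R > 0" "cball x R \<subseteq> \<Omega>" using open_ball_inside[OF \<Omega>(1)] by blast
      then show "x \<in> \<Union>F" unfolding F_def by (intro UnionI[of "ball x R"]) auto
    qed
  qed
  have "\<And>S. S \<in> F \<Longrightarrow> open S" by (auto simp: F_def)
  then obtain F' where F': "F' \<subseteq> F" "countable F'" "\<Union>F' = \<Union>F" by (rule Lindelof[of F])
  then have ne: "F' \<noteq> {}" using \<Omega>(2) F by auto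
  have "\<forall>k. \<exists>p. 0 < snd p \<and> cball (fst p) (snd p) \<subseteq> \<Omega> \<and> from_nat_into F' k = ball (fst p) (snd p)"
  proof
    fix k
    have "from_nat_into F' k \<in> F" using from_nat_into[OF ne] F'(1) by blast
    then obtain c R where "from_nat_into F' k = ball c R" "0 < R" "cball c R \<subseteq> \<Omega>" unfolding F_def by blast
    then show "\<exists>p. 0 < snd p \<and> cball (fst p) (snd p) \<subseteq> \<Omega> \<and> from_nat_into F' k = ball (fst p) (snd p)"
      by (intro exI[of _ "(c, R)"]) simp
  qed
  from choice[OF this] obtain P where P: "\<forall>k. 0 < snd (P k) \<and> cball (fst (P k)) (snd (P k)) \<subseteq> \<Omega>
      \<and> from_nat_into F' k = ball (fst (P k)) (snd (P k))" ..
  have "\<exists>k. x \<in> ball (fst (P k)) (snd (P k))" if "x \<in> \<Omega>" for x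
  proof -
    have "x \<in> \<Union>F'" unfolding F'(3) F by (rule that)
    then obtain S where "S \<in> F'" "x \<in> S" by (rule UnionE)
    then obtain k where "from_nat_into F' k = S" using from_nat_into_surj[OF F'(2)] by blast
    then have "x \<in> ball (fst (P k)) (snd (P k))" using spec[OF P, of k] \<open>x \<in> S\<close> by simp
    then show ?thesis by (rule exI[of _ k])
  qed
  moreover have "\<forall>k. 0 < snd (P k) \<and> cball (fst (P k)) (snd (P k)) \<subseteq> \<Omega>" using P by simp
  ultimately show ?thesis by (intro exI[of _ "\<lambda>k. fst (P k)"] exI[of _ "\<lambda>k. snd (P k)"] conjI ballI)
qed

lemma poly_deg_slab:
  "poly_deg 2 (\<lambda>x::'a::euclidean_space. k * ((u \<bullet> x - \<alpha>) * (\<beta> - u \<bullet> x)))"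
proof -
  have "poly_deg 1 (\<lambda>x::'a. x \<bullet> u + (- \<alpha>))" "poly_deg 1 (\<lambda>x::'a. \<beta> + (-1) * (x \<bullet> u))"
    by (intro poly_deg.add poly_deg_cmult poly_deg_inner poly_deg.const)+
  from poly_deg_cmult[OF poly_deg_mult[OF this]]
  show ?thesis by (simp add: inner_commute numeral_2_eq_2)
qed

lemma slab_has_derivative:
  "((\<lambda>x::'a::real_inner. k * ((u \<bullet> x - \<alpha>) * (\<beta> - u \<bullet> x))) has_derivative
    (\<lambda>v. k * ((u \<bullet> v) * (\<beta> + \<alpha> - 2 * (u \<bullet> y))))) (at y)"
proof -
  have l: "((\<lambda>x. u \<bullet> x) has_derivative (\<lambda>v. u \<bullet> v)) (at y)"
    by (rule bounded_linear_imp_has_derivative[OF bounded_linear_inner_right])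
  have "((\<lambda>x. k * ((u \<bullet> x - \<alpha>) * (\<beta> - u \<bullet> x))) has_derivative
      (\<lambda>v. k * ((u \<bullet> y - \<alpha>) * (0 - u \<bullet> v) + (u \<bullet> v - 0) * (\<beta> - u \<bullet> y)))) (at y)"
    by (intro has_derivative_mult_right has_derivative_mult has_derivative_diff has_derivative_const l)
  moreover have "k * ((u \<bullet> y - \<alpha>) * (0 - u \<bullet> v) + (u \<bullet> v - 0) * (\<beta> - u \<bullet> y))
      = k * ((u \<bullet> v) * (\<beta> + \<alpha> - 2 * (u \<bullet> y)))" for v
    by (simp add: algebra_simps)
  ultimately show ?thesis by (simp only:)
qed

lemma laplacian_slab:
  "laplacian (\<lambda>x::'a::euclidean_space. k * ((u \<bullet> x - \<alpha>) * (\<beta> - u \<bullet> x))) x = - (2 * k * (u \<bullet> u))"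
proof -
  have "laplacian (\<lambda>x::'a. k * ((u \<bullet> x - \<alpha>) * (\<beta> - u \<bullet> x))) x
      = (\<Sum>b\<in>Basis. - (2 * k * ((u \<bullet> b) * (u \<bullet> b))))"
  proof (rule laplacian_eqI[OF open_UNIV UNIV_I,
        where f'="\<lambda>y v. k * ((u \<bullet> v) * (\<beta> + \<alpha> - 2 * (u \<bullet> y)))"
        and f''="\<lambda>b v. - (2 * k * ((u \<bullet> b) * (u \<bullet> v)))"])
    show "((\<lambda>x. k * ((u \<bullet> x - \<alpha>) * (\<beta> - u \<bullet> x))) has_derivative
        (\<lambda>v. k * ((u \<bullet> v) * (\<beta> + \<alpha> - 2 * (u \<bullet> y))))) (at y)" for y
      by (rule slab_has_derivative)
    have l: "((\<lambda>x. u \<bullet> x) has_derivative (\<lambda>v. u \<bullet> v)) (at x)"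
      by (rule bounded_linear_imp_has_derivative[OF bounded_linear_inner_right])
    have "((\<lambda>y. k * ((u \<bullet> b) * (\<beta> + \<alpha> - 2 * (u \<bullet> y)))) has_derivative
        (\<lambda>v. k * ((u \<bullet> b) * (0 - 2 * (u \<bullet> v))))) (at x)" for b
      by (intro has_derivative_mult_right has_derivative_diff has_derivative_const l)
    moreover have "k * ((u \<bullet> b) * (0 - 2 * (u \<bullet> v))) = - (2 * k * ((u \<bullet> b) * (u \<bullet> v)))" for b v
      by simp
    ultimately show "((\<lambda>y. k * ((u \<bullet> b) * (\<beta> + \<alpha> - 2 * (u \<bullet> y)))) has_derivative
        (\<lambda>v. - (2 * k * ((u \<bullet> b) * (u \<bullet> v))))) (at x)" for b
      by (simp only:)
  qed
  also have "\<dots> = - (2 * k * (\<Sum>b\<in>Basis. (u \<bullet> b) * (u \<bullet> b)))"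
    by (simp add: sum_negf sum_distrib_left)
  also have "(\<Sum>b\<in>Basis. (u \<bullet> b) * (u \<bullet> b)) = u \<bullet> u" by (rule euclidean_inner[symmetric])
  finally show ?thesis .
qed

text \<open>A supporting hyperplane at p and a parallel one beyond the domain bound a slab of
  \<open>a\<close>-width W. The parabola across that slab is nonnegative, has constant Laplacian -A
  and vanishes at p.\<close>

lemma convex_barrier:
  fixes \<Omega> :: "'a::euclidean_space set"
  assumes \<Omega>: "open \<Omega>" "convex \<Omega>" "bounded \<Omega>" "\<Omega> \<noteq> {}" and p: "p \<in> frontier \<Omega>" and A: "0 \<le> A"
  shows "\<exists>b. continuous_on (closure \<Omega>) b \<and> weak_supersolution \<Omega> b (\<lambda>_. - A) \<and>
    (\<forall>x\<in>closure \<Omega>. 0 \<le> b x) \<and> b p = 0"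
proof -
  have "\<Omega> \<inter> {p} = {}" using p \<Omega>(1) by (auto simp: frontier_def interior_open)
  then obtain a \<beta> where a: "a \<noteq> 0" "\<forall>x\<in>\<Omega>. a \<bullet> x \<le> \<beta>" "\<forall>x\<in>{p}. \<beta> \<le> a \<bullet> x"
    using separating_hyperplane_sets[OF \<Omega>(2) convex_singleton \<Omega>(4), of p] by auto
  have "\<Omega> \<subseteq> {x. a \<bullet> x \<le> a \<bullet> p}" using a by force
  then have half: "closure \<Omega> \<subseteq> {x. a \<bullet> x \<le> a \<bullet> p}"
    by (rule closure_minimal[OF _ closed_halfspace_le])
  obtain B where B: "B > 0" "\<And>x. x \<in> closure \<Omega> \<Longrightarrow> norm x \<le> B"
    using bounded_closure[OF \<Omega>(3)] unfolding bounded_pos by auto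
  define W where "W = norm a * (2 * B)"
  have W: "a \<bullet> p - a \<bullet> x \<le> W" if x: "x \<in> closure \<Omega>" for x
  proof -
    have "p \<in> closure \<Omega>" using p by (simp add: frontier_def)
    then have "norm (p - x) \<le> 2 * B" using norm_triangle_ineq4[of p x] B(2)[of p] B(2)[OF x] by linarith
    then have "norm a * norm (p - x) \<le> W" unfolding W_def by (intro mult_left_mono) auto
    moreover have "a \<bullet> (p - x) \<le> norm a * norm (p - x)" by (rule norm_cauchy_schwarz)
    ultimately show ?thesis by (simp add: inner_diff_right)
  qed
  \<comment> \<open>Chosen so that the Laplacian -2 k (a \<bullet> a) of the parabola is -A.\<close>
  define k where "k = A / (2 * (a \<bullet> a))"
  have aa: "a \<bullet> a > 0" using a(1) by simp
  have k: "0 \<le> k" using A aa by (simp add: k_def)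
  define b where "b = (\<lambda>x. k * ((a \<bullet> x - (a \<bullet> p - W)) * (a \<bullet> p - a \<bullet> x)))"
  have pb: "poly_deg 2 b" unfolding b_def by (rule poly_deg_slab)
  have "laplacian b x = - A" for x
    unfolding b_def laplacian_slab using aa by (simp add: k_def)
  then have "weak_solution \<Omega> b (\<lambda>_. - A)"
    by (intro weak_solution_cong[OF weak_solution_poly_deg[OF pb \<Omega>(1)]]) auto
  then have "weak_supersolution \<Omega> b (\<lambda>_. - A)" by (rule weak_solution_imp_sub_super(2)[OF \<Omega>(1)])
  moreover have "continuous_on (closure \<Omega>) b" unfolding b_def by (intro continuous_intros)
  moreover have "0 \<le> b x" if "x \<in> closure \<Omega>" for x
    unfolding b_def using k W[OF that] half that by (intro mult_nonneg_nonneg) auto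
  moreover have "b p = 0" by (simp add: b_def)
  ultimately show ?thesis by (intro exI[of _ b]) simp
qed

lemma weak_solution_const: "weak_solution U (\<lambda>_. c) (\<lambda>_. 0)"
proof -
  have "pot_op r (\<lambda>_. 0) x = 0" for r and x :: 'a by (simp add: pot_op_def kernel_op_def)
  then show ?thesis by (simp add: weak_solution_def mean_op_const continuous_on_const)
qed

lemma weak_subsolution_zero:
  fixes g :: "'a::euclidean_space \<Rightarrow> real"
  assumes U: "open U" and cg: "continuous_on U g" and g: "\<And>x. x \<in> U \<Longrightarrow> g x \<le> 0"
  shows "weak_subsolution U (\<lambda>_. 0) g"
proof -
  have "\<exists>e>0. \<forall>r. 0 < r \<longrightarrow> r < e \<longrightarrow> fits U r x \<and> 0 \<le> mean_op r (\<lambda>_. 0) x - pot_op r g x" if x: "x \<in> U" for x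
  proof -
    obtain e where e: "e > 0" "\<And>r. 0 < r \<Longrightarrow> r < e \<Longrightarrow> fits U r x" using fits_small[OF U x] by blast
    have "fits U r x \<and> 0 \<le> mean_op r (\<lambda>_. 0) x - pot_op r g x" if r: "0 < r" "r < e" for r
    proof -
      have f: "fits U r x" by (rule e(2)[OF r])
      have "pot_op r g x \<le> pot_op r (\<lambda>_. 0) x" by (rule pot_op_mono[OF f cg continuous_on_const g])
      moreover have "pot_op r (\<lambda>_. 0) x = 0" by (simp add: pot_op_def kernel_op_def)
      ultimately show ?thesis using f by (simp add: mean_op_const)
    qed
    then show ?thesis using e(1) by blast
  qed
  then show ?thesis using cg unfolding weak_subsolution_def by simp
qed

text \<open>Poincare's balayage: starting from the subsolution 0, solve the equation successively in
  countably many balls, each of which is visited infinitely often.\<close>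

lemma dirichlet_nonpos:
  fixes \<Omega> :: "'a::euclidean_space set"
  assumes \<Omega>: "open \<Omega>" "convex \<Omega>" "bounded \<Omega>" "\<Omega> \<noteq> {}" and cg: "continuous_on \<Omega> g"
    and g: "\<And>x. x \<in> \<Omega> \<Longrightarrow> - A \<le> g x" "\<And>x. x \<in> \<Omega> \<Longrightarrow> g x \<le> 0"
  shows "\<exists>v. continuous_on (closure \<Omega>) v \<and> (\<forall>x\<in>frontier \<Omega>. v x = 0) \<and> locally_weak_solution \<Omega> v g"
proof -
  obtain c :: "nat \<Rightarrow> 'a" and R where cR: "\<forall>k. 0 < R k \<and> cball (c k) (R k) \<subseteq> \<Omega>"
      and cover: "\<forall>x\<in>\<Omega>. \<exists>k. x \<in> ball (c k) (R k)"
    using countable_ball_cover[OF \<Omega>(1,4)] by blast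
  have A: "0 \<le> A" using g \<Omega>(4) by force
  \<comment> \<open>The first component of the pairing enumeration takes every index infinitely
    often, so each ball is treated again and again.\<close>
  define i where "i = (\<lambda>j. fst (prod_decode j))"
  define V where "V = rec_nat (\<lambda>_. 0) (\<lambda>j v. SOME v'. is_lift \<Omega> g (c (i j)) (R (i j)) v v')"
  have V0: "V 0 = (\<lambda>_. 0)" by (simp add: V_def)
  have VS: "V (Suc j) = (SOME v'. is_lift \<Omega> g (c (i j)) (R (i j)) (V j) v')" for j
    by (simp add: V_def)
  have ball_out: "x \<notin> ball (c k) (R k)" if "x \<in> frontier \<Omega>" for x k
  proof -
    have "x \<notin> \<Omega>" using that \<Omega>(1) by (auto simp: frontier_def interior_open)
    then show ?thesis using cR ball_subset_cball by blast
  qed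
  have lift: "is_lift \<Omega> g (c (i j)) (R (i j)) (V j) (V (Suc j))"
    if "continuous_on (closure \<Omega>) (V j)" "weak_subsolution \<Omega> (V j) g" for j
  proof -
    have "0 < R (i j)" "cball (c (i j)) (R (i j)) \<subseteq> \<Omega>" using cR by simp_all
    from someI_ex[OF ball_lift_exists[OF \<Omega>(1) that this]] show ?thesis unfolding VS .
  qed
  have inv: "continuous_on (closure \<Omega>) (V j) \<and> weak_subsolution \<Omega> (V j) g \<and> (\<forall>x\<in>frontier \<Omega>. V j x = 0)" for j
  proof (induction j)
    case 0
    show ?case using weak_subsolution_zero[OF \<Omega>(1) cg g(2)] by (simp add: V0)
  next
    case (Suc j)
    then have L: "is_lift \<Omega> g (c (i j)) (R (i j)) (V j) (V (Suc j))" by (intro lift) simp_all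
    have "V (Suc j) x = V j x" if "x \<in> frontier \<Omega>" for x
      using L ball_out[OF that] unfolding is_lift_def by blast
    then show ?case using L Suc.IH unfolding is_lift_def by simp
  qed
  have L: "is_lift \<Omega> g (c (i j)) (R (i j)) (V j) (V (Suc j))" for j
    by (rule lift) (use inv[of j] in simp_all)
  have incr: "incseq (\<lambda>j. V j x)" for x
  proof (rule incseq_SucI)
    show "V j x \<le> V (Suc j) x" for j using L[of j] unfolding is_lift_def by simp
  qed
  have nonneg: "0 \<le> V j x" for j x
    using incseqD[OF incr, of 0 j x] by (simp add: V0)
  \<comment> \<open>Every iterate is a subsolution for g \<ge> -A with boundary values 0, so it
    stays below every nonnegative barrier with right-hand side -A.\<close>
  have below: "V j x \<le> b x"
    if cb: "continuous_on (closure \<Omega>) b" and wb: "weak_supersolution \<Omega> b (\<lambda>_. - A)"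
      and nb: "\<forall>x\<in>closure \<Omega>. 0 \<le> b x" and x: "x \<in> closure \<Omega>" for b j x
  proof (rule weak_comparison[OF \<Omega>(1,3) _ cb _ wb g(1) _ x])
    show "V j y \<le> b y" if y: "y \<in> frontier \<Omega>" for y
    proof -
      have "y \<in> closure \<Omega>" using y by (simp add: frontier_def)
      then have "0 \<le> b y" using nb by simp
      moreover have "V j y = 0" using inv[of j] y by simp
      ultimately show ?thesis by simp
    qed
    show "continuous_on (closure \<Omega>) (V j)" "weak_subsolution \<Omega> (V j) g" using inv[of j] by simp_all
  qed
  \<comment> \<open>One barrier at an arbitrary boundary point already bounds all iterates
    uniformly, so the increasing sequences converge.\<close>
  have "frontier \<Omega> \<noteq> {}" using \<Omega>(3,4) frontier_not_empty not_bounded_UNIV by blast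
  then obtain p0 where "p0 \<in> frontier \<Omega>" by blast
  from convex_barrier[OF \<Omega> this A] obtain b0 where b0: "continuous_on (closure \<Omega>) b0"
    "weak_supersolution \<Omega> b0 (\<lambda>_. - A)" "\<forall>x\<in>closure \<Omega>. 0 \<le> b0 x" by blast
  have "bounded (b0 ` closure \<Omega>)"
    using compact_imp_bounded[OF compact_continuous_image[OF b0(1)]] \<Omega>(3) by simp
  then obtain C where C: "\<And>x. x \<in> closure \<Omega> \<Longrightarrow> \<bar>b0 x\<bar> \<le> C" unfolding bounded_real by auto
  have VC: "\<bar>V j x\<bar> \<le> C" if "x \<in> closure \<Omega>" for j x
    using below[OF b0 that, of j] nonneg[of j x] C[OF that] by simp
  define v where "v = (\<lambda>x. lim (\<lambda>j. V j x))"
  have lim: "(\<lambda>j. V j x) \<longlonglongrightarrow> v x" if x: "x \<in> closure \<Omega>" for x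
  proof -
    have "Bseq (\<lambda>j. V j x)" using VC[OF x] by (intro BseqI') auto
    then have "convergent (\<lambda>j. V j x)" by (rule Bseq_mono_convergent) (simp add: incseqD[OF incr])
    then show ?thesis by (simp add: v_def convergent_LIMSEQ_iff)
  qed
  have sol: "weak_solution (ball (c k) (R k)) v g" for k
  proof (rule weak_solution_pointwise_limit[OF open_ball])
    \<comment> \<open>The steps that treat ball k. Right after each of them the iterate solves the
      equation there, and along this subsequence the limit is the same.\<close>
    let ?\<sigma> = "\<lambda>n. prod_encode (k, n)"
    have bk: "ball (c k) (R k) \<subseteq> closure \<Omega>" using cR ball_subset_cball closure_subset by blast
    show "weak_solution (ball (c k) (R k)) (V (Suc (?\<sigma> n))) g" for n
      using L[of "?\<sigma> n"] unfolding is_lift_def by (simp add: i_def)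
    show "\<bar>V (Suc (?\<sigma> n)) y\<bar> \<le> C" if "y \<in> ball (c k) (R k)" for n y
      using VC bk that by blast
    show "(\<lambda>n. V (Suc (?\<sigma> n)) y) \<longlonglongrightarrow> v y" if "y \<in> ball (c k) (R k)" for y
    proof -
      have "(\<lambda>j. V (Suc j) y) \<longlonglongrightarrow> v y" by (rule LIMSEQ_Suc[OF lim]) (use bk that in blast)
      moreover have "filterlim ?\<sigma> at_top sequentially"
        by (rule filterlim_at_top_mono[OF filterlim_ident]) (simp add: le_prod_encode_2)
      ultimately show ?thesis by (rule filterlim_compose)
    qed
  qed
  have lws: "locally_weak_solution \<Omega> v g"
  proof (rule locally_weak_solutionI)
    fix x assume "x \<in> \<Omega>"
    then obtain k where k: "x \<in> ball (c k) (R k)" using cover by blast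
    moreover have "ball (c k) (R k) \<subseteq> \<Omega>" using cR ball_subset_cball by blast
    ultimately show "\<exists>V. open V \<and> x \<in> V \<and> V \<subseteq> \<Omega> \<and> weak_solution V v g"
      using sol[of k] by (intro exI[of _ "ball (c k) (R k)"]) simp
  qed
  have v0: "v x = 0" if x: "x \<in> frontier \<Omega>" for x
  proof -
    have "x \<in> closure \<Omega>" using x by (simp add: frontier_def)
    from LIMSEQ_unique[OF lim[OF this], of 0] show ?thesis using inv x by simp
  qed
  have "continuous (at x within closure \<Omega>) v" if x: "x \<in> closure \<Omega>" for x
  proof (cases "x \<in> \<Omega>")
    case True
    have "isCont v x"
      using locally_weak_solutionD(3)[OF lws] True \<Omega>(1) by (simp add: continuous_on_eq_continuous_at)
    then show ?thesis by (rule continuous_at_imp_continuous_at_within)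
  next
    case False
    then have xf: "x \<in> frontier \<Omega>" using x \<Omega>(1) by (simp add: frontier_def interior_open)
    from convex_barrier[OF \<Omega> xf A] obtain b where b: "continuous_on (closure \<Omega>) b"
      "weak_supersolution \<Omega> b (\<lambda>_. - A)" "\<forall>x\<in>closure \<Omega>. 0 \<le> b x" "b x = 0" by blast
    have le: "v y \<le> b y" "0 \<le> v y" if y: "y \<in> closure \<Omega>" for y
    proof -
      show "v y \<le> b y" by (rule LIMSEQ_le_const2[OF lim[OF y]]) (simp add: below[OF b(1-3) y])
      show "0 \<le> v y" by (rule LIMSEQ_le_const[OF lim[OF y]]) (simp add: nonneg)
    qed
    \<comment> \<open>Continuity at a boundary point: v lies between 0 and a barrier that tends to 0
      there.\<close>
    have "(b \<longlongrightarrow> 0) (at x within closure \<Omega>)"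
      using b(1,4) x unfolding continuous_on_def by fastforce
    moreover have "\<forall>\<^sub>F y in at x within closure \<Omega>. 0 \<le> v y" "\<forall>\<^sub>F y in at x within closure \<Omega>. v y \<le> b y"
      using le by (simp_all add: eventually_at_filter)
    ultimately have "(v \<longlongrightarrow> 0) (at x within closure \<Omega>)"
      using tendsto_sandwich[OF _ _ tendsto_const[of 0]] by blast
    then show ?thesis by (simp add: continuous_within v0[OF xf])
  qed
  then have "continuous_on (closure \<Omega>) v" by (simp add: continuous_on_eq_continuous_within)
  then show ?thesis using v0 lws by blast
qed

text \<open>Writing g = (g - A) - (- A) reduces to nonpositive right-hand sides, for which 0 is a
  subsolution from which the balayage can start.\<close>

theorem dirichlet_poisson:
  fixes \<Omega> :: "'a::euclidean_space set"
  assumes \<Omega>: "open \<Omega>" "convex \<Omega>" "bounded \<Omega>" "\<Omega> \<noteq> {}" and cg: "continuous_on \<Omega> g"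
    and g: "\<And>x. x \<in> \<Omega> \<Longrightarrow> \<bar>g x\<bar> \<le> A"
  shows "\<exists>v. continuous_on (closure \<Omega>) v \<and> (\<forall>x\<in>frontier \<Omega>. v x = 0) \<and> locally_weak_solution \<Omega> v g"
proof -
  have A: "0 \<le> A" using g \<Omega>(4) by force
  have c1: "continuous_on \<Omega> (\<lambda>x. g x - A)" by (intro continuous_on_diff cg continuous_on_const)
  have "\<exists>v. continuous_on (closure \<Omega>) v \<and> (\<forall>x\<in>frontier \<Omega>. v x = 0) \<and> locally_weak_solution \<Omega> v (\<lambda>x. g x - A)"
  proof (rule dirichlet_nonpos[OF \<Omega> c1, where A="2 * A"])
    fix x assume "x \<in> \<Omega>"
    from g[OF this] show "- (2 * A) \<le> g x - A" "g x - A \<le> 0" by linarith+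
  qed
  then obtain v1 where v1: "continuous_on (closure \<Omega>) v1" "\<forall>x\<in>frontier \<Omega>. v1 x = 0"
    "locally_weak_solution \<Omega> v1 (\<lambda>x. g x - A)" by blast
  have "\<exists>v. continuous_on (closure \<Omega>) v \<and> (\<forall>x\<in>frontier \<Omega>. v x = 0) \<and> locally_weak_solution \<Omega> v (\<lambda>_. - A)"
    by (rule dirichlet_nonpos[OF \<Omega> continuous_on_const, where A=A]) (use A in auto)
  then obtain v2 where v2: "continuous_on (closure \<Omega>) v2" "\<forall>x\<in>frontier \<Omega>. v2 x = 0"
    "locally_weak_solution \<Omega> v2 (\<lambda>_. - A)" by blast
  have "locally_weak_solution \<Omega> (\<lambda>x. v1 x - v2 x) g"
    by (rule locally_weak_solution_cong[OF \<Omega>(1) locally_weak_solution_diff[OF \<Omega>(1) v1(3) v2(3)]]) simp_all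
  moreover have "continuous_on (closure \<Omega>) (\<lambda>x. v1 x - v2 x)" by (intro continuous_on_diff v1 v2)
  ultimately show ?thesis using v1(2) v2(2) by (intro exI[of _ "\<lambda>x. v1 x - v2 x"]) simp
qed

section \<open>A semilinear problem between a sub- and a supersolution\<close>

lemma weak_solution_cmult:
  assumes "weak_solution U v g"
  shows "weak_solution U (\<lambda>x. c * v x) (\<lambda>x. c * g x)"
proof -
  have "mean_op r (\<lambda>y. c * v y) x = c * mean_op r v x" for r x
    by (simp add: mean_op_def kernel_op_def mult.left_commute[of _ c])
  moreover have "pot_op r (\<lambda>y. c * g y) x = c * pot_op r g x" for r x
    by (simp add: pot_op_def kernel_op_def mult.left_commute[of _ c])
  moreover have "c * v x = c * (mean_op r v x - pot_op r g x)" if "fits U r x" for r x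
    by (rule arg_cong[OF weak_solutionD(3)[OF assms that]])
  ultimately show ?thesis
    using weak_solutionD(1,2)[OF assms] unfolding weak_solution_def
    by (simp add: continuous_on_mult right_diff_distrib)
qed

lemma locally_weak_solution_cmult:
  assumes U: "open U" and v: "locally_weak_solution U v g"
  shows "locally_weak_solution U (\<lambda>x. c * v x) (\<lambda>x. c * g x)"
proof (rule locally_weak_solutionI)
  fix x assume x: "x \<in> U"
  obtain R where R: "R > 0" "cball x R \<subseteq> U" using open_ball_inside[OF U x] by blast
  then have b: "ball x R \<subseteq> U" using ball_subset_cball by blast
  have "weak_solution (ball x R) (\<lambda>x. c * v x) (\<lambda>x. c * g x)"
    by (rule weak_solution_cmult[OF locally_weak_solution_ball[OF v R]])
  then show "\<exists>V. open V \<and> x \<in> V \<and> V \<subseteq> U \<and> weak_solution V (\<lambda>x. c * v x) (\<lambda>x. c * g x)"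
    using R(1) b by (intro exI[of _ "ball x R"]) simp
qed

text \<open>Weak comparison is applied on the open set where u exceeds w; on its boundary u \<le> w
  holds anyway. So the right-hand sides are compared only where the truncated nonlinearity is known
  explicitly.\<close>

lemma locally_weak_comparison_on_superlevel:
  fixes u w :: "'a::euclidean_space \<Rightarrow> real"
  assumes \<Omega>: "open \<Omega>" "bounded \<Omega>" and c: "continuous_on (closure \<Omega>) u" "continuous_on (closure \<Omega>) w"
    and u: "weak_subsolution \<Omega> u g" and w: "weak_supersolution \<Omega> w h"
    and gh: "\<And>x. x \<in> \<Omega> \<Longrightarrow> w x < u x \<Longrightarrow> h x \<le> g x"
    and bd: "\<And>x. x \<in> frontier \<Omega> \<Longrightarrow> u x \<le> w x" and x: "x \<in> closure \<Omega>"
  shows "u x \<le> w x"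
proof (rule ccontr)
  assume neg: "\<not> u x \<le> w x"
  define D where "D = {y \<in> \<Omega>. 0 < u y - w y}"
  have "continuous_on \<Omega> (\<lambda>y. u y - w y)"
    by (intro continuous_on_diff continuous_on_subset[OF c(1) closure_subset]
        continuous_on_subset[OF c(2) closure_subset])
  then have "open (\<Omega> \<inter> (\<lambda>y. u y - w y) -` {0<..})"
    by (rule continuous_open_preimage[OF _ \<Omega>(1) open_greaterThan])
  moreover have "\<Omega> \<inter> (\<lambda>y. u y - w y) -` {0<..} = D" by (auto simp: D_def)
  ultimately have D: "open D" by simp
  have sub: "D \<subseteq> \<Omega>" by (auto simp: D_def)
  have clD: "closure D \<subseteq> closure \<Omega>" by (rule closure_mono[OF sub])
  have "x \<notin> frontier \<Omega>" using bd neg by blast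
  then have "x \<in> \<Omega>" using x \<Omega>(1) by (simp add: frontier_def interior_open)
  then have xD: "x \<in> closure D" using neg closure_subset[of D] by (auto simp: D_def)
  have bdD: "u y \<le> w y" if y: "y \<in> frontier D" for y
  proof (cases "y \<in> \<Omega>")
    case True
    have "y \<notin> D" using y D by (simp add: frontier_def interior_open)
    then show ?thesis using True by (simp add: D_def)
  next
    case False
    have "y \<in> closure \<Omega>" using y clD by (auto simp: frontier_def)
    then have "y \<in> frontier \<Omega>" using False \<Omega>(1) by (simp add: frontier_def interior_open)
    then show ?thesis by (rule bd)
  qed
  have ghD: "h y \<le> g y" if "y \<in> D" for y using that gh by (simp add: D_def)
  have "u x \<le> w x"
    by (rule weak_comparison[OF D bounded_subset[OF \<Omega>(2) sub] continuous_on_subset[OF c(1) clD]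
          continuous_on_subset[OF c(2) clD] weak_subsolution_subset[OF u D sub]
          weak_supersolution_subset[OF w D sub] ghD bdD xD])
  then show False using neg by simp
qed

text \<open>\<open>gm\<close>, \<open>gp\<close> and \<open>g\<phi>\<close> are the Laplacians of
  \<open>um\<close>, \<open>up\<close> and \<open>\<phi>\<close> in the weak sense.
  \<open>contract\<close> is the point: a weight with Laplacian at most - (L / \<theta>) \<phi>
  makes solving with an L-Lipschitz right-hand side a \<theta>-contraction in the norm sup |u| /
  \<phi>.\<close>

locale sub_super =
  fixes \<Omega> :: "'a::euclidean_space set" and F :: "'a \<Rightarrow> real \<Rightarrow> real"
    and um up gm gp \<phi> g\<phi> :: "'a \<Rightarrow> real" and L A \<theta> :: real
  assumes \<Omega>: "open \<Omega>" "convex \<Omega>" "bounded \<Omega>" "\<Omega> \<noteq> {}"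
    and um: "continuous_on (closure \<Omega>) um" "locally_weak_solution \<Omega> um gm"
    and up: "continuous_on (closure \<Omega>) up" "locally_weak_solution \<Omega> up gp"
    and \<phi>: "continuous_on (closure \<Omega>) \<phi>" "locally_weak_solution \<Omega> \<phi> g\<phi>" "\<And>x. x \<in> closure \<Omega> \<Longrightarrow> 0 < \<phi> x"
    and um_le_up: "\<And>x. x \<in> closure \<Omega> \<Longrightarrow> um x \<le> up x"
    and boundary: "\<And>x. x \<in> frontier \<Omega> \<Longrightarrow> um x \<le> 1" "\<And>x. x \<in> frontier \<Omega> \<Longrightarrow> 1 \<le> up x"
    and gm: "\<And>x. x \<in> \<Omega> \<Longrightarrow> F x (um x) \<le> gm x"
    and gp: "\<And>x. x \<in> \<Omega> \<Longrightarrow> gp x \<le> F x (up x)"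
    and Lip: "\<And>x s t. x \<in> \<Omega> \<Longrightarrow> s \<in> {um x..up x} \<Longrightarrow> t \<in> {um x..up x} \<Longrightarrow> \<bar>F x s - F x t\<bar> \<le> L * \<bar>s - t\<bar>"
    and bound: "\<And>x t. x \<in> \<Omega> \<Longrightarrow> t \<in> {um x..up x} \<Longrightarrow> \<bar>F x t\<bar> \<le> A"
    and cont: "\<And>u. continuous_on \<Omega> u \<Longrightarrow> (\<And>x. x \<in> \<Omega> \<Longrightarrow> u x \<in> {um x..up x}) \<Longrightarrow> continuous_on \<Omega> (\<lambda>x. F x (u x))"
    and L: "0 < L" and \<theta>: "0 < \<theta>" "\<theta> < 1"
    and contract: "\<And>x. x \<in> \<Omega> \<Longrightarrow> g\<phi> x \<le> - (L / \<theta>) * \<phi> x"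
begin

text \<open>Truncation extends the bound and the Lipschitz condition, assumed only between the
  barriers, to arbitrary iterates. It is removed at the end by comparison.\<close>

definition clamp :: "'a \<Rightarrow> real \<Rightarrow> real" where "clamp x t = max (um x) (min t (up x))"

definition rhs :: "('a \<Rightarrow> real) \<Rightarrow> 'a \<Rightarrow> real" where "rhs u x = F x (clamp x (u x))"

lemma clamp_mem: "x \<in> \<Omega> \<Longrightarrow> clamp x t \<in> {um x..up x}"
  using um_le_up[of x] closure_subset[of \<Omega>] by (auto simp: clamp_def)

lemma clamp_lip: "\<bar>clamp x s - clamp x t\<bar> \<le> \<bar>s - t\<bar>"
  by (auto simp: clamp_def max_def min_def)

lemma rhs_lip:
  assumes x: "x \<in> \<Omega>"
  shows "\<bar>rhs u x - rhs v x\<bar> \<le> L * \<bar>u x - v x\<bar>"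
proof -
  have "\<bar>rhs u x - rhs v x\<bar> \<le> L * \<bar>clamp x (u x) - clamp x (v x)\<bar>"
    unfolding rhs_def by (rule Lip[OF x clamp_mem[OF x] clamp_mem[OF x]])
  also have "\<dots> \<le> L * \<bar>u x - v x\<bar>" using L by (intro mult_left_mono clamp_lip) simp
  finally show ?thesis .
qed

lemma rhs_continuous:
  assumes "continuous_on (closure \<Omega>) u"
  shows "continuous_on \<Omega> (rhs u)"
proof -
  note sub = continuous_on_subset[OF _ closure_subset]
  have "continuous_on \<Omega> (\<lambda>x. clamp x (u x))"
    unfolding clamp_def by (intro continuous_on_max continuous_on_min sub[OF assms] sub[OF um(1)] sub[OF up(1)])
  from cont[OF this clamp_mem] show ?thesis by (simp add: rhs_def[abs_def])
qed

lemma solve_step: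
  assumes "continuous_on (closure \<Omega>) u"
  shows "\<exists>v. continuous_on (closure \<Omega>) v \<and> (\<forall>x\<in>frontier \<Omega>. v x = 1) \<and> locally_weak_solution \<Omega> v (rhs u)"
proof -
  have b: "\<bar>rhs u x\<bar> \<le> A" if "x \<in> \<Omega>" for x
    unfolding rhs_def by (rule bound[OF that clamp_mem[OF that]])
  obtain v where v: "continuous_on (closure \<Omega>) v" "\<forall>x\<in>frontier \<Omega>. v x = 0" "locally_weak_solution \<Omega> v (rhs u)"
    using dirichlet_poisson[OF \<Omega> rhs_continuous[OF assms] b] by blast
  have "locally_weak_solution \<Omega> (\<lambda>x. v x - (- 1)) (\<lambda>x. rhs u x - 0)"
    by (rule locally_weak_solution_diff[OF \<Omega>(1) v(3) weak_solution_imp_locally[OF \<Omega>(1) weak_solution_const]])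
  then have "locally_weak_solution \<Omega> (\<lambda>x. v x - (- 1)) (rhs u)" by simp
  moreover have "continuous_on (closure \<Omega>) (\<lambda>x. v x - (- 1))" by (intro continuous_on_diff v(1) continuous_on_const)
  ultimately show ?thesis using v(2) by (intro exI[of _ "\<lambda>x. v x - (- 1)"]) simp
qed

definition iter :: "nat \<Rightarrow> 'a \<Rightarrow> real" where
  "iter = rec_nat (\<lambda>_. 1) (\<lambda>_ u. SOME v. continuous_on (closure \<Omega>) v \<and> (\<forall>x\<in>frontier \<Omega>. v x = 1)
     \<and> locally_weak_solution \<Omega> v (rhs u))"

lemma iter_0: "iter 0 x = 1"
  by (simp add: iter_def)

lemma iter_continuous_boundary: "continuous_on (closure \<Omega>) (iter k) \<and> (\<forall>x\<in>frontier \<Omega>. iter k x = 1)"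
proof (induction k)
  case 0 show ?case by (simp add: iter_def)
next
  case (Suc k)
  from someI_ex[OF solve_step[OF conjunct1[OF Suc.IH]]] show ?case by (simp add: iter_def)
qed

lemma iter_solution: "locally_weak_solution \<Omega> (iter (Suc k)) (rhs (iter k))"
  using someI_ex[OF solve_step[OF conjunct1[OF iter_continuous_boundary[of k]]]] by (simp add: iter_def)

text \<open>If two iterates differ by at most c \<phi>, the right-hand sides differ by at most L c
  \<phi>, which is at most -\<theta> c times the Laplacian of \<phi>. Comparison with \<theta> c
  \<phi> then bounds the next difference. The first C exists because \<phi> is positive on a compact
  set.\<close>

lemma iter_contraction:
  "\<exists>C\<ge>0. \<forall>k. \<forall>x\<in>closure \<Omega>. \<bar>iter (Suc k) x - iter k x\<bar> \<le> C * \<theta> ^ k * \<phi> x"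
proof -
  have cpt: "compact (closure \<Omega>)" using \<Omega>(3) by simp
  have ne: "closure \<Omega> \<noteq> {}" using \<Omega>(4) closure_subset by blast
  have ci: "continuous_on (closure \<Omega>) (iter k)" for k using iter_continuous_boundary by blast
  have cd: "continuous_on (closure \<Omega>) (\<lambda>x. iter (Suc k) x - iter k x)" for k
    by (intro continuous_on_diff ci)
  have "\<forall>x\<in>closure \<Omega>. \<phi> x \<noteq> 0" using \<phi>(3) by force
  then have "continuous_on (closure \<Omega>) (\<lambda>x. \<bar>iter 1 x - iter 0 x\<bar> / \<phi> x)"
    using cd[of 0] by (intro continuous_on_divide continuous_on_rabs \<phi>(1)) simp_all
  from continuous_attains_sup[OF cpt ne this] obtain x0 where
    x0: "\<forall>x\<in>closure \<Omega>. \<bar>iter 1 x - iter 0 x\<bar> / \<phi> x \<le> \<bar>iter 1 x0 - iter 0 x0\<bar> / \<phi> x0" "x0 \<in> closure \<Omega>" by blast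
  define C where "C = \<bar>iter 1 x0 - iter 0 x0\<bar> / \<phi> x0"
  have C: "0 \<le> C" using \<phi>(3)[OF x0(2)] by (simp add: C_def)
  have "\<forall>x\<in>closure \<Omega>. \<bar>iter (Suc k) x - iter k x\<bar> \<le> C * \<theta> ^ k * \<phi> x" for k
  proof (induction k)
    case 0
    show ?case
    proof
      fix x assume x: "x \<in> closure \<Omega>"
      have "\<bar>iter 1 x - iter 0 x\<bar> / \<phi> x \<le> C" using x0(1) x by (simp add: C_def)
      then show "\<bar>iter (Suc 0) x - iter 0 x\<bar> \<le> C * \<theta> ^ 0 * \<phi> x"
        using \<phi>(3)[OF x] by (simp add: pos_divide_le_eq)
    qed
  next
    case (Suc k)
    let ?c = "C * \<theta> ^ Suc k"
    let ?w = "\<lambda>x. iter (Suc (Suc k)) x - iter (Suc k) x"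
    let ?g = "\<lambda>x. rhs (iter (Suc k)) x - rhs (iter k) x"
    have w: "locally_weak_solution \<Omega> ?w ?g"
      by (rule locally_weak_solution_diff[OF \<Omega>(1) iter_solution iter_solution])
    have c0: "0 \<le> ?c" using C \<theta>(1) by simp
    have gb: "\<bar>?g x\<bar> \<le> - (?c * g\<phi> x)" if x: "x \<in> \<Omega>" for x
    proof -
      have x': "x \<in> closure \<Omega>" using x closure_subset by blast
      have "\<bar>?g x\<bar> \<le> L * \<bar>iter (Suc k) x - iter k x\<bar>" by (rule rhs_lip[OF x])
      also have "\<dots> \<le> L * (C * \<theta> ^ k * \<phi> x)" using Suc.IH x' L by (intro mult_left_mono) auto
      also have "\<dots> = ?c * (L / \<theta> * \<phi> x)" using \<theta>(1) by simp
      also have "\<dots> \<le> ?c * (- g\<phi> x)" using contract[OF x] c0 by (intro mult_left_mono) simp_all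
      finally show ?thesis by simp
    qed
    have s: "locally_weak_solution \<Omega> (\<lambda>x. c * \<phi> x) (\<lambda>x. c * g\<phi> x)" for c
      by (rule locally_weak_solution_cmult[OF \<Omega>(1) \<phi>(2)])
    have cs: "continuous_on (closure \<Omega>) (\<lambda>x. c * \<phi> x)" for c
      by (intro continuous_on_mult continuous_on_const \<phi>(1))
    have bd: "?w x \<le> ?c * \<phi> x" "- ?c * \<phi> x \<le> ?w x" if "x \<in> frontier \<Omega>" for x
    proof -
      have "?w x = 0" using iter_continuous_boundary that by simp
      moreover have "0 < \<phi> x" using \<phi>(3) that by (simp add: frontier_def)
      ultimately show "?w x \<le> ?c * \<phi> x" "- ?c * \<phi> x \<le> ?w x" using c0 by (simp_all only: zero_le_mult_iff mult_minus_left neg_le_0_iff_le) auto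
    qed
    have g1: "?c * g\<phi> x \<le> ?g x" and g2: "?g x \<le> - ?c * g\<phi> x" if "x \<in> \<Omega>" for x
      using gb[OF that] by (simp_all only: abs_le_iff mult_minus_left) linarith+
    show ?case
    proof
      fix x assume x: "x \<in> closure \<Omega>"
      have "?w x \<le> ?c * \<phi> x"
        by (rule weak_comparison[OF \<Omega>(1,3) cd cs locally_weak_solutionD(1)[OF w]
              locally_weak_solutionD(2)[OF s] g1 bd(1) x])
      moreover have "- ?c * \<phi> x \<le> ?w x"
        by (rule weak_comparison[OF \<Omega>(1,3) cs cd locally_weak_solutionD(1)[OF s]
              locally_weak_solutionD(2)[OF w] g2 bd(2) x])
      ultimately show "\<bar>?w x\<bar> \<le> ?c * \<phi> x" unfolding mult_minus_left by linarith
    qed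
  qed
  with C show ?thesis by blast
qed

text \<open>The iterates are partial sums of a series dominated by a geometric one, so they converge
  uniformly to a solution for the truncated F, and comparison places this limit between the
  barriers, where truncation does nothing.\<close>

theorem solution_exists:
  "\<exists>u. continuous_on (closure \<Omega>) u \<and> (\<forall>x\<in>frontier \<Omega>. u x = 1) \<and> (\<forall>x\<in>closure \<Omega>. um x \<le> u x \<and> u x \<le> up x)
     \<and> locally_weak_solution \<Omega> u (\<lambda>x. F x (u x))"
proof -
  obtain C where C: "C \<ge> 0" "\<forall>k. \<forall>x\<in>closure \<Omega>. \<bar>iter (Suc k) x - iter k x\<bar> \<le> C * \<theta> ^ k * \<phi> x"
    using iter_contraction by blast
  have cpt: "compact (closure \<Omega>)" using \<Omega>(3) by simp
  have "bounded (\<phi> ` closure \<Omega>)" by (rule compact_imp_bounded[OF compact_continuous_image[OF \<phi>(1) cpt]])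
  then obtain P where P: "\<And>x. x \<in> closure \<Omega> \<Longrightarrow> \<bar>\<phi> x\<bar> \<le> P" unfolding bounded_real by auto
  define f where "f = (\<lambda>k x. iter (Suc k) x - iter k x)"
  have "uniform_limit (closure \<Omega>) (\<lambda>n x. \<Sum>k<n. f k x) (\<lambda>x. suminf (\<lambda>k. f k x)) sequentially"
  proof (rule Weierstrass_m_test)
    show "norm (f k x) \<le> (C * P) * \<theta> ^ k" if x: "x \<in> closure \<Omega>" for k x
    proof -
      have "norm (f k x) \<le> C * \<theta> ^ k * \<phi> x" using C(2) x by (simp add: f_def)
      also have "\<dots> \<le> C * \<theta> ^ k * P" using P[OF x] C(1) \<theta>(1) by (intro mult_left_mono) auto
      finally show ?thesis by (simp add: mult_ac)
    qed
    show "summable (\<lambda>k. (C * P) * \<theta> ^ k)" using \<theta> by (intro summable_mult summable_geometric) simp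
  qed
  moreover have "(\<Sum>k<n. f k x) = iter n x - 1" for n x
    using sum_lessThan_telescope[of "\<lambda>k. iter k x" n] by (simp add: f_def iter_0)
  ultimately have lim1: "uniform_limit (closure \<Omega>) (\<lambda>n x. iter n x - 1) (\<lambda>x. suminf (\<lambda>k. f k x)) sequentially"
    by simp
  define u where "u = (\<lambda>x. suminf (\<lambda>k. f k x) + 1)"
  have lim: "uniform_limit (closure \<Omega>) iter u sequentially"
    using lim1 unfolding uniform_limit_iff u_def dist_real_def by (simp add: diff_diff_eq add.commute)
  have ci: "continuous_on (closure \<Omega>) (iter k)" for k using iter_continuous_boundary by blast
  have cu: "continuous_on (closure \<Omega>) u"
    by (rule uniform_limit_theorem[OF _ lim sequentially_bot]) (simp add: ci)
  have u1: "u x = 1" if x: "x \<in> frontier \<Omega>" for x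
  proof -
    have "x \<in> closure \<Omega>" using x by (simp add: frontier_def)
    from tendsto_uniform_limitI[OF lim this] have "(\<lambda>n. iter n x) \<longlonglongrightarrow> u x" .
    moreover have "(\<lambda>n. iter n x) = (\<lambda>n. 1)" using iter_continuous_boundary x by auto
    ultimately have "(\<lambda>n::nat. 1) \<longlonglongrightarrow> u x" by simp
    then show ?thesis using LIMSEQ_unique[OF _ tendsto_const] by blast
  qed
  have lim\<Omega>: "uniform_limit \<Omega> iter u sequentially" by (rule uniform_limit_on_subset[OF lim closure_subset])
  have limS: "uniform_limit \<Omega> (\<lambda>n. iter (Suc n)) u sequentially"
    using lim\<Omega> unfolding filterlim_sequentially_Suc .
  have limr: "uniform_limit \<Omega> (\<lambda>n. rhs (iter n)) (rhs u) sequentially"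
  proof (rule uniform_limitI)
    fix e :: real assume "e > 0"
    then have "e / L > 0" using L by simp
    from uniform_limitD[OF lim\<Omega> this]
    show "\<forall>\<^sub>F n in sequentially. \<forall>x\<in>\<Omega>. dist (rhs (iter n) x) (rhs u x) < e"
    proof (rule eventually_mono, intro ballI)
      fix n x assume n: "\<forall>x\<in>\<Omega>. dist (iter n x) (u x) < e / L" and x: "x \<in> \<Omega>"
      have "\<bar>rhs (iter n) x - rhs u x\<bar> \<le> L * \<bar>iter n x - u x\<bar>" by (rule rhs_lip[OF x])
      also have "\<dots> < e" using n x L by (simp add: dist_real_def pos_less_divide_eq mult.commute)
      finally show "dist (rhs (iter n) x) (rhs u x) < e" by (simp add: dist_real_def)
    qed
  qed
  have lws: "locally_weak_solution \<Omega> u (rhs u)"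
    by (rule locally_weak_solution_uniform_limit[OF \<Omega>(1) iter_solution limS limr])
  \<comment> \<open>Where u exceeds \<open>up\<close>, the truncated right-hand side is F at
    \<open>up\<close>, hence at least \<open>gp\<close>; this is what comparison on the superlevel
    set asks for. The lower barrier is symmetric.\<close>
  have up': "u x \<le> up x" if x: "x \<in> closure \<Omega>" for x
  proof (rule locally_weak_comparison_on_superlevel[OF \<Omega>(1,3) cu up(1) locally_weak_solutionD(1)[OF lws]
        locally_weak_solutionD(2)[OF up(2)] _ _ x])
    fix y assume y: "y \<in> \<Omega>" "up y < u y"
    have "y \<in> closure \<Omega>" using y(1) closure_subset by blast
    then have "clamp y (u y) = up y" using um_le_up[of y] y(2) by (simp add: clamp_def)
    then show "gp y \<le> rhs u y" using gp[OF y(1)] by (simp add: rhs_def)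
  next
    show "u y \<le> up y" if "y \<in> frontier \<Omega>" for y using u1[OF that] boundary(2)[OF that] by simp
  qed
  have um': "um x \<le> u x" if x: "x \<in> closure \<Omega>" for x
  proof (rule locally_weak_comparison_on_superlevel[OF \<Omega>(1,3) um(1) cu locally_weak_solutionD(1)[OF um(2)]
        locally_weak_solutionD(2)[OF lws] _ _ x])
    fix y assume y: "y \<in> \<Omega>" "u y < um y"
    have "clamp y (u y) = um y" using y(2) by (auto simp: clamp_def max_def min_def)
    then show "rhs u y \<le> gm y" using gm[OF y(1)] by (simp add: rhs_def)
  next
    show "um y \<le> u y" if "y \<in> frontier \<Omega>" for y using u1[OF that] boundary(1)[OF that] by simp
  qed
  have "locally_weak_solution \<Omega> u (\<lambda>x. F x (u x))"
  proof (rule locally_weak_solution_cong[OF \<Omega>(1) lws refl])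
    fix x assume "x \<in> \<Omega>"
    then have "x \<in> closure \<Omega>" using closure_subset by blast
    then show "rhs u x = F x (u x)" using up'[of x] um'[of x] by (simp add: rhs_def clamp_def)
  qed
  then show ?thesis using cu u1 up' um' by blast
qed

end

lemma locally_weak_solution_regularity:
  fixes v :: "'a::euclidean_space \<Rightarrow> real"
  assumes U: "open U" and w: "locally_weak_solution U v g"
    and v: "higher_differentiable_on U v k" and g: "higher_differentiable_on U g k"
  shows "higher_differentiable_on U v (Suc k)"
proof (rule higher_differentiable_on_local)
  fix x assume x: "x \<in> U"
  obtain R where R: "R > 0" "cball x R \<subseteq> U" using open_ball_inside[OF U x] by blast
  then have b: "ball x R \<subseteq> U" using ball_subset_cball by blast
  have "higher_differentiable_on (ball x R) v (Suc k)"
    by (rule weak_solution_regularity[OF open_ball locally_weak_solution_ball[OF w R]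
          higher_differentiable_on_subset[OF b v] higher_differentiable_on_subset[OF b g]])
  then show "\<exists>V. open V \<and> x \<in> V \<and> higher_differentiable_on V v (Suc k)"
    using R(1) by (intro exI[of _ "ball x R"] conjI) simp_all
qed

text \<open>Bootstrap: k derivatives of u give k derivatives of the right-hand side, and the weak
  equation then yields one more for u.\<close>

theorem semilinear_smooth:
  fixes u :: "'a::euclidean_space \<Rightarrow> real"
  assumes U: "open U" and w: "locally_weak_solution U u (\<lambda>x. F x (u x))"
    and F: "\<And>k. higher_differentiable_on U u k \<Longrightarrow> higher_differentiable_on U (\<lambda>x. F x (u x)) k"
  shows "smooth_on U u" "\<And>x. x \<in> U \<Longrightarrow> laplacian u x = F x (u x)"
proof -
  have h: "higher_differentiable_on U u k" for k
  proof (induction k)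
    case 0
    show ?case using locally_weak_solutionD(3)[OF w] by simp
  next
    case (Suc k)
    show ?case by (rule locally_weak_solution_regularity[OF U w Suc.IH F[OF Suc.IH]])
  qed
  then show "smooth_on U u" by (simp add: smooth_on_def)
  fix x assume x: "x \<in> U"
  obtain R where R: "R > 0" "cball x R \<subseteq> U" using open_ball_inside[OF U x] by blast
  then have b: "ball x R \<subseteq> U" using ball_subset_cball by blast
  show "laplacian u x = F x (u x)"
    by (rule weak_solution_imp_laplacian[OF open_ball locally_weak_solution_ball[OF w R]
          higher_differentiable_on_subset[OF b h]]) (use R(1) in simp)
qed

section \<open>The conformal equation\<close>

text \<open>Mean value theorem, with E controlling the derivative factor z powr (p - 1) through the
  larger endpoint.\<close>

lemma powr_lipschitz:
  fixes s t :: real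
  assumes "0 < s" "0 < t" and p: "1 \<le> p" and bound: "s powr (p - 1) \<le> E" "t powr (p - 1) \<le> E"
  shows "\<bar>s powr p - t powr p\<bar> \<le> p * E * \<bar>s - t\<bar>"
proof -
  have *: "\<bar>b powr p - a powr p\<bar> \<le> p * E * \<bar>b - a\<bar>"
    if ab: "0 < a" "a < b" "b powr (p - 1) \<le> E" for a b
  proof -
    have "\<exists>z. a < z \<and> z < b \<and> b powr p - a powr p = (b - a) * (p * z powr (p - 1))"
    proof (rule MVT2[OF ab(2)])
      show "((\<lambda>x. x powr p) has_real_derivative p * x powr (p - 1)) (at x)" if "a \<le> x" "x \<le> b" for x
        using ab that by (intro has_real_derivative_powr) simp
    qed
    then obtain z where z: "a < z" "z < b" "b powr p - a powr p = (b - a) * (p * z powr (p - 1))" by blast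
    have "z powr (p - 1) \<le> b powr (p - 1)" using z ab p by (intro powr_mono2) auto
    then have "z powr (p - 1) \<le> E" using ab(3) by linarith
    then have "p * z powr (p - 1) \<le> p * E" using p by (intro mult_left_mono) auto
    moreover have "0 \<le> p * z powr (p - 1)" using p by simp
    moreover have "\<bar>b powr p - a powr p\<bar> = (p * z powr (p - 1)) * (b - a)"
      using z ab p by (simp add: abs_mult)
    ultimately show ?thesis using ab(2) by (simp add: mult_right_mono)
  qed
  show ?thesis
  proof (cases s t rule: linorder_cases)
    case less
    from *[OF assms(1) less bound(2)] show ?thesis by (simp add: abs_minus_commute)
  next
    case greater
    from *[OF assms(2) greater bound(1)] show ?thesis .
  qed simp
qed

lemma laplacian_exp:
  fixes h :: "'a::euclidean_space \<Rightarrow> real"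
  assumes "open U" "x \<in> U" "higher_differentiable_on U h 2"
  shows "laplacian (\<lambda>y. exp (c * h y)) x = exp (c * h x) * (c * laplacian h x + c\<^sup>2 * (norm (grad h x))\<^sup>2)"
proof -
  have "laplacian (\<lambda>y. exp (c * h y)) x
      = (c\<^sup>2 * exp (c * h x)) * (norm (grad h x))\<^sup>2 + (c * exp (c * h x)) * laplacian h x"
    by (rule laplacian_compose(1)[OF assms, where \<psi>="\<lambda>t. exp (c * t)" and \<psi>'="\<lambda>t. c * exp (c * t)"])
       (auto intro!: derivative_eq_intros simp: power2_eq_square)
  then show ?thesis by (simp add: algebra_simps)
qed

text \<open>The hypothesis \<open>small\<close> says K < \<kappa>. Here \<beta> K t bounds |F| and
  \<beta> K is a Lipschitz constant of F between the barriers, while \<beta> \<kappa> with \<kappa>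
  = (m - \<beta>) / D^2 is the rate in the differential inequalities of the two
  exponentials.\<close>

theorem conformal_dirichlet:
  fixes \<Omega> :: "'a::euclidean_space set" and R S \<tau> :: "'a \<Rightarrow> real" and D m \<Lambda> \<gamma> :: real
  defines "n \<equiv> real DIM('a)"
  assumes dim: "3 \<le> DIM('a)"
    and \<Omega>: "open \<Omega>" "convex \<Omega>" "bounded \<Omega>" "\<Omega> \<noteq> {}"
    and RS: "smooth_on \<Omega> R" "smooth_on \<Omega> S"
    and bR: "\<And>x. x \<in> \<Omega> \<Longrightarrow> \<bar>R x\<bar> \<le> \<Lambda>" and bS: "\<And>x. x \<in> \<Omega> \<Longrightarrow> \<bar>S x\<bar> \<le> \<gamma>"
    and pos: "0 < \<Lambda>" "0 < \<gamma>" "0 < D"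
    and \<tau>: "higher_differentiable_on UNIV \<tau> 2" "\<And>x. x \<in> closure \<Omega> \<Longrightarrow> 0 \<le> \<tau> x" "\<And>x. x \<in> closure \<Omega> \<Longrightarrow> \<tau> x \<le> D\<^sup>2"
      "\<And>x. x \<in> \<Omega> \<Longrightarrow> laplacian \<tau> x = - 2 * m" "\<And>x. x \<in> \<Omega> \<Longrightarrow> (norm (grad \<tau> x))\<^sup>2 \<le> 4 * D\<^sup>2"
    and small: "D\<^sup>2 * (\<gamma> + (n + 2) / (n - 2) * exp 1 * \<Lambda> / (2 * (n - 1))) < m - (n - 2) / 2"
  shows "\<exists>f. is_smooth_dirichlet_solution \<Omega> R S f"
proof -
  define p where "p = (n + 2) / (n - 2)"
  define \<beta> where "\<beta> = (n - 2) / 2"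
  define N where "N = 2 * (n - 1)"
  define K where "K = \<gamma> + p * exp 1 * \<Lambda> / N"
  define \<kappa> where "\<kappa> = (m - \<beta>) / D\<^sup>2"
  have n3: "3 \<le> n" using dim by (simp add: n_def)
  have \<beta>: "0 < \<beta>" and N: "0 < N" using n3 by (auto simp: \<beta>_def N_def)
  have p1: "1 \<le> p" using n3 by (simp add: p_def field_simps)
  \<comment> \<open>For u = exp (\<beta> f) this makes u powr (p - 1) equal to exp (2 f), the
    nonlinearity of the original equation.\<close>
  have p\<beta>: "(p - 1) * \<beta> = 2" using n3 by (simp add: p_def \<beta>_def field_simps)
  have D2: "0 < D\<^sup>2" using pos(3) by simp
  have "D\<^sup>2 * K < m - \<beta>" using small by (simp only: K_def p_def N_def \<beta>_def)
  then have K\<kappa>: "K < \<kappa>" using D2 by (simp add: \<kappa>_def pos_less_divide_eq mult.commute)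
  have K0: "0 < K" using pos p1 N by (simp add: K_def add_pos_pos)
  have \<kappa>0: "0 < \<kappa>" using K0 K\<kappa> by linarith
  \<comment> \<open>Normalised to 0 \<le> 2 h \<le> 1: between the barriers t powr (p - 1) is then
    at most exp (2 h) \<le> e, which is where \<open>exp 1\<close> in \<open>small\<close> comes
    from.\<close>
  define h where "h = (\<lambda>x. \<tau> x / (2 * D\<^sup>2))"
  have h2: "higher_differentiable_on UNIV h 2"
    unfolding h_def by (rule higher_differentiable_on_divide[OF open_UNIV \<tau>(1)])
  have hb: "0 \<le> h x" "2 * h x \<le> 1" if "x \<in> closure \<Omega>" for x
    using \<tau>(2,3)[OF that] D2 by (simp_all add: h_def)
  have \<tau>1: "(\<tau> has_derivative frechet_derivative \<tau> (at x)) (at x)" for x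
    by (rule higher_differentiable_on_2D(1)[OF \<tau>(1) UNIV_I])
  have "laplacian h x = 1 / (2 * D\<^sup>2) * laplacian \<tau> x + 0 * laplacian \<tau> x" for x
    using laplacian_lincomb[OF open_UNIV UNIV_I \<tau>(1) \<tau>(1), where a="1 / (2 * D\<^sup>2)" and b=0] by (simp add: h_def)
  then have lh: "laplacian h x = - m / D\<^sup>2" if "x \<in> \<Omega>" for x
    using \<tau>(4)[OF that] by simp
  have gh: "(norm (grad h x))\<^sup>2 \<le> 1 / D\<^sup>2" if "x \<in> \<Omega>" for x
  proof -
    have "((\<lambda>y. \<tau> y * inverse (2 * D\<^sup>2)) has_derivative (\<lambda>v. frechet_derivative \<tau> (at x) v * inverse (2 * D\<^sup>2))) (at x)"
      by (rule has_derivative_mult_left[OF \<tau>1])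
    then have "frechet_derivative h (at x) = (\<lambda>v. frechet_derivative \<tau> (at x) v * inverse (2 * D\<^sup>2))"
      unfolding h_def divide_inverse using frechet_derivative_at by metis
    then have "(norm (grad h x))\<^sup>2 = (norm (grad \<tau> x))\<^sup>2 * (inverse (2 * D\<^sup>2))\<^sup>2"
      unfolding norm_grad_power2 by (simp only: power_mult_distrib sum_distrib_right)
    also have "\<dots> \<le> 4 * D\<^sup>2 * (inverse (2 * D\<^sup>2))\<^sup>2" using \<tau>(5)[OF that] by (intro mult_right_mono) auto
    also have "\<dots> = 1 / D\<^sup>2" using D2 by (simp add: power2_eq_square field_simps)
    finally show ?thesis .
  qed
  define w where "w = (\<lambda>c x. exp (c * h x))"
  have w2: "higher_differentiable_on UNIV (w c) 2" for c
    unfolding w_def by (intro higher_differentiable_on_exp higher_differentiable_on_cmult open_UNIV h2)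
  have wsol: "locally_weak_solution \<Omega> (w c) (laplacian (w c))" for c
    by (rule weak_solution_imp_locally[OF \<Omega>(1) weak_solution_subset[OF weak_solution_laplacian[OF open_UNIV w2]]]) simp
  have wc: "continuous_on A (w c)" for A c
    by (rule continuous_on_subset[OF higher_differentiable_on_imp_continuous_on[OF w2]]) simp
  have wpos: "0 < w c x" for c x by (simp add: w_def)
  have lw: "laplacian (w c) x = w c x * (c * laplacian h x + c\<^sup>2 * (norm (grad h x))\<^sup>2)" for c x
    unfolding w_def by (rule laplacian_exp[OF open_UNIV UNIV_I h2])
  \<comment> \<open>The squared gradient of h costs up to \<beta> / D^2 relative to the main term;
    this is why \<kappa> contains m - \<beta> and not m.\<close>
  have lup: "laplacian (w \<beta>) x \<le> - (\<beta> * \<kappa> * w \<beta> x)" if x: "x \<in> \<Omega>" for x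
  proof -
    have "\<beta>\<^sup>2 * (norm (grad h x))\<^sup>2 \<le> \<beta>\<^sup>2 * (1 / D\<^sup>2)" using gh[OF x] by (intro mult_left_mono) auto
    then have "\<beta> * laplacian h x + \<beta>\<^sup>2 * (norm (grad h x))\<^sup>2 \<le> - (\<beta> * \<kappa>)"
      unfolding lh[OF x] \<kappa>_def by (simp add: power2_eq_square diff_divide_distrib right_diff_distrib)
    from mult_left_mono[OF this less_imp_le[OF wpos[of \<beta> x]]]
    show ?thesis unfolding lw by (simp add: mult_ac)
  qed
  \<comment> \<open>For the exponent -\<beta> the gradient term has the favourable sign and is
    dropped.\<close>
  have lum: "\<beta> * \<kappa> * w (- \<beta>) x \<le> laplacian (w (- \<beta>)) x" if x: "x \<in> \<Omega>" for x
  proof -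
    have "\<beta> * \<kappa> \<le> \<beta> * (m / D\<^sup>2)" using \<beta> D2 unfolding \<kappa>_def by (intro mult_left_mono divide_right_mono) auto
    moreover have "0 \<le> (- \<beta>)\<^sup>2 * (norm (grad h x))\<^sup>2" by simp
    moreover have "(- \<beta>) * (- m / D\<^sup>2) = \<beta> * (m / D\<^sup>2)" by simp
    ultimately have "\<beta> * \<kappa> \<le> (- \<beta>) * laplacian h x + (- \<beta>)\<^sup>2 * (norm (grad h x))\<^sup>2"
      unfolding lh[OF x] by linarith
    from mult_left_mono[OF this less_imp_le[OF wpos[of "- \<beta>" x]]]
    show ?thesis unfolding lw by (simp add: mult_ac)
  qed
  define F where "F = (\<lambda>x t. \<beta> * (S x * t - R x * t powr p / N))"
  have range: "0 < t" "t powr (p - 1) \<le> exp 1" if x: "x \<in> closure \<Omega>" and t: "t \<in> {w (- \<beta>) x..w \<beta> x}" for x t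
  proof -
    show t0: "0 < t" using t wpos[of "- \<beta>" x] by simp
    have "t powr (p - 1) \<le> w \<beta> x powr (p - 1)" using t0 t p1 by (intro powr_mono2) auto
    also have "\<dots> = exp ((p - 1) * \<beta> * h x)" by (simp add: w_def powr_def mult_ac)
    also have "\<dots> \<le> exp 1" using hb[OF x] by (simp add: p\<beta>)
    finally show "t powr (p - 1) \<le> exp 1" .
  qed
  have FK: "\<bar>F x t\<bar> \<le> \<beta> * K * t" if x: "x \<in> \<Omega>" and t: "t \<in> {w (- \<beta>) x..w \<beta> x}" for x t
  proof -
    have "x \<in> closure \<Omega>" using x closure_subset by blast
    note t' = range[OF this t]
    have tp: "t powr p = t * t powr (p - 1)" using t'(1) powr_mult_base[of t "p - 1"] by simp
    have "\<bar>R x * t powr p / N\<bar> = \<bar>R x\<bar> * t powr (p - 1) * t / N" using t'(1) N by (simp add: tp abs_mult)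
    also have "\<dots> \<le> \<Lambda> * exp 1 * t / N"
      using bR[OF x] t' N pos by (intro divide_right_mono mult_right_mono mult_mono) auto
    \<comment> \<open>A factor p \<ge> 1 is given away, so that the one constant K serves for the
      size and for the Lipschitz constant of F.\<close>
    also have "\<dots> \<le> p * exp 1 * \<Lambda> / N * t"
      using p1 t'(1) N pos mult_right_mono[of 1 p "\<Lambda> * exp 1 * t / N"] by (simp add: mult_ac)
    finally have 1: "\<bar>R x * t powr p / N\<bar> \<le> p * exp 1 * \<Lambda> / N * t" .
    have 2: "\<bar>S x * t\<bar> \<le> \<gamma> * t" using bS[OF x] t'(1) by (simp add: abs_mult mult_right_mono)
    have "\<bar>S x * t - R x * t powr p / N\<bar> \<le> K * t" using 1 2 unfolding K_def distrib_right by linarith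
    from mult_left_mono[OF this less_imp_le[OF \<beta>]] show ?thesis
      using \<beta> by (simp add: F_def abs_mult mult.assoc)
  qed
  have Flip: "\<bar>F x s - F x t\<bar> \<le> \<beta> * K * \<bar>s - t\<bar>"
    if x: "x \<in> \<Omega>" and s: "s \<in> {w (- \<beta>) x..w \<beta> x}" and t: "t \<in> {w (- \<beta>) x..w \<beta> x}" for x s t
  proof -
    have x': "x \<in> closure \<Omega>" using x closure_subset by blast
    have "\<bar>s powr p - t powr p\<bar> \<le> p * exp 1 * \<bar>s - t\<bar>"
      by (rule powr_lipschitz[OF range(1)[OF x' s] range(1)[OF x' t] p1 range(2)[OF x' s] range(2)[OF x' t]])
    then have "\<bar>R x\<bar> * \<bar>s powr p - t powr p\<bar> / N \<le> \<Lambda> * (p * exp 1 * \<bar>s - t\<bar>) / N"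
      using bR[OF x] N pos by (intro divide_right_mono mult_mono) auto
    then have 1: "\<bar>R x * s powr p / N - R x * t powr p / N\<bar> \<le> p * exp 1 * \<Lambda> / N * \<bar>s - t\<bar>"
      using N by (simp add: abs_mult mult_ac flip: diff_divide_distrib right_diff_distrib)
    have 2: "\<bar>S x * s - S x * t\<bar> \<le> \<gamma> * \<bar>s - t\<bar>"
      using bS[OF x] by (simp add: abs_mult mult_right_mono flip: right_diff_distrib)
    have "\<bar>(S x * s - R x * s powr p / N) - (S x * t - R x * t powr p / N)\<bar> \<le> K * \<bar>s - t\<bar>"
      using 1 2 unfolding K_def distrib_right by linarith
    from mult_left_mono[OF this less_imp_le[OF \<beta>]] show ?thesis
      using \<beta> by (simp add: F_def abs_mult mult.assoc flip: right_diff_distrib)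
  qed
  have wle: "w (- \<beta>) x \<le> 1" "1 \<le> w \<beta> x" "w \<beta> x \<le> exp \<beta>" if "x \<in> closure \<Omega>" for x
    using hb[OF that] \<beta> mult_left_mono[of "h x" 1 \<beta>] by (simp_all add: w_def)
  have cR: "continuous_on \<Omega> R" and cS: "continuous_on \<Omega> S"
    using RS unfolding smooth_on_def by (metis higher_differentiable_on.simps(1))+
  \<comment> \<open>The supersolution \<open>w \<beta>\<close> is used a second time as the weight.
    With \<theta> = K / \<kappa> the required rate L / \<theta> is exactly \<beta> \<kappa>.\<close>
  interpret sub_super \<Omega> F "w (- \<beta>)" "w \<beta>" "laplacian (w (- \<beta>))" "laplacian (w \<beta>)" "w \<beta>" "laplacian (w \<beta>)"
    "\<beta> * K" "\<beta> * K * exp \<beta>" "K / \<kappa>"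
  proof
    fix x assume x: "x \<in> closure \<Omega>"
    show "0 < w \<beta> x" by (rule wpos)
    show "w (- \<beta>) x \<le> w \<beta> x" using wle[OF x] by linarith
  next
    fix x assume "x \<in> frontier \<Omega>"
    then have x: "x \<in> closure \<Omega>" by (simp add: frontier_def)
    show "w (- \<beta>) x \<le> 1" "1 \<le> w \<beta> x" using wle[OF x] by auto
  next
    fix x assume x: "x \<in> \<Omega>"
    then have x': "x \<in> closure \<Omega>" using closure_subset by blast
    have mem: "w (- \<beta>) x \<in> {w (- \<beta>) x..w \<beta> x}" "w \<beta> x \<in> {w (- \<beta>) x..w \<beta> x}"
      using wle[OF x'] by auto
    have \<beta>K: "\<beta> * K * t \<le> \<beta> * \<kappa> * t" if "0 < t" for t
      using that K\<kappa> \<beta> by (intro mult_right_mono mult_left_mono) auto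
    show "F x (w (- \<beta>) x) \<le> laplacian (w (- \<beta>)) x"
      using FK[OF x mem(1)] lum[OF x] \<beta>K[OF wpos[of "- \<beta>" x]] by linarith
    show "laplacian (w \<beta>) x \<le> F x (w \<beta> x)"
      using FK[OF x mem(2)] lup[OF x] \<beta>K[OF wpos[of \<beta> x]] by linarith
    have "\<beta> * K / (K / \<kappa>) = \<beta> * \<kappa>" using K0 by simp
    then show "laplacian (w \<beta>) x \<le> - (\<beta> * K / (K / \<kappa>)) * w \<beta> x" using lup[OF x] by simp
    fix t assume t: "t \<in> {w (- \<beta>) x..w \<beta> x}"
    have "\<beta> * K * t \<le> \<beta> * K * exp \<beta>" using t wle(3)[OF x'] \<beta> K0 by (intro mult_left_mono) auto
    then show "\<bar>F x t\<bar> \<le> \<beta> * K * exp \<beta>" using FK[OF x t] by linarith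
  next
    fix u assume u: "continuous_on \<Omega> u" "\<And>x. x \<in> \<Omega> \<Longrightarrow> u x \<in> {w (- \<beta>) x..w \<beta> x}"
    have "0 < u x" if "x \<in> \<Omega>" for x using u(2)[OF that] wpos[of "- \<beta>" x] by simp
    then have "\<forall>x\<in>\<Omega>. u x \<noteq> 0" by force
    then show "continuous_on \<Omega> (\<lambda>x. F x (u x))"
      unfolding F_def using N u(1) cR cS by (intro continuous_intros) auto
  qed (use \<Omega> wc wsol Flip \<beta> K0 \<kappa>0 K\<kappa> in auto)
  obtain u where u: "continuous_on (closure \<Omega>) u" "\<forall>x\<in>frontier \<Omega>. u x = 1"
      "\<forall>x\<in>closure \<Omega>. w (- \<beta>) x \<le> u x \<and> u x \<le> w \<beta> x" "locally_weak_solution \<Omega> u (\<lambda>x. F x (u x))"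
    using solution_exists by blast
  have upos: "0 < u x" if "x \<in> closure \<Omega>" for x
    using u(3) that wpos[of "- \<beta>" x] by (meson less_le_trans)
  have upos\<Omega>: "0 < u x" if "x \<in> \<Omega>" for x using upos that closure_subset by blast
  have hF: "higher_differentiable_on \<Omega> (\<lambda>x. F x (u x)) k" if hu: "higher_differentiable_on \<Omega> u k" for k
  proof -
    have "higher_differentiable_on \<Omega> R k" "higher_differentiable_on \<Omega> S k"
      using RS unfolding smooth_on_def by blast+
    then show ?thesis
      unfolding F_def
      by (intro higher_differentiable_on_cmult higher_differentiable_on_diff higher_differentiable_on_mult
          higher_differentiable_on_divide higher_differentiable_on_powr \<Omega>(1) hu upos\<Omega>)
  qed
  have smooth: "smooth_on \<Omega> u" "x \<in> \<Omega> \<Longrightarrow> laplacian u x = F x (u x)" for x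
    using semilinear_smooth[where u=u and F=F, OF \<Omega>(1) u(4)] hF by simp_all
  have hu: "higher_differentiable_on \<Omega> u k" for k using smooth(1) unfolding smooth_on_def by blast
  define f where "f = (\<lambda>x. 1 / \<beta> * ln (u x))"
  have "smooth_on \<Omega> f"
    unfolding smooth_on_def f_def
    by (intro allI higher_differentiable_on_cmult higher_differentiable_on_ln \<Omega>(1) hu upos\<Omega>)
  moreover have "continuous_on (closure \<Omega>) f"
  proof -
    have "\<forall>x\<in>closure \<Omega>. u x \<noteq> 0" using upos by force
    then show ?thesis unfolding f_def
      using u(1) upos by (intro continuous_on_mult continuous_on_const continuous_on_ln) auto
  qed
  moreover have "laplacian f x = - (1 / (2 * (n - 1))) *
      (exp (2 * f x) * R x + (n - 1) * (n - 2) * (norm (grad f x))\<^sup>2) + S x" if x: "x \<in> \<Omega>" for x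
  proof -
    define q where "q = (norm (grad u x))\<^sup>2"
    have ux: "0 < u x" by (rule upos\<Omega>[OF x])
    have d1: "((\<lambda>t. 1 / \<beta> * ln t) has_real_derivative 1 / \<beta> * inverse (u y)) (at (u y))" if "y \<in> \<Omega>" for y
      by (intro DERIV_cmult DERIV_ln upos\<Omega> that)
    have d2: "((\<lambda>t. 1 / \<beta> * inverse t) has_real_derivative 1 / \<beta> * - (inverse (u x) ^ Suc (Suc 0))) (at (u x))"
      using ux by (intro DERIV_cmult DERIV_inverse) simp
    note lc = laplacian_compose[OF \<Omega>(1) x hu d1 d2]
    have l: "laplacian f x = - (inverse (u x))\<^sup>2 * q / \<beta> + inverse (u x) * F x (u x) / \<beta>"
      using lc(1) smooth(2)[OF x] by (simp add: f_def q_def power2_eq_square)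
    have g: "(norm (grad f x))\<^sup>2 = (inverse (u x))\<^sup>2 * q / \<beta>\<^sup>2"
      using lc(2) ux by (simp add: f_def q_def power_mult_distrib power_divide)
    have "inverse (u x) * u x powr p = u x powr (p - 1)"
      using ux powr_mult_base[of "u x" "p - 1"] by (simp add: field_simps)
    also have "\<dots> = exp ((p - 1) * ln (u x))" using ux by (simp add: powr_def)
    also have "(p - 1) * ln (u x) = 2 * f x"
    proof -
      have "p - 1 = 2 / \<beta>" using p\<beta> \<beta> by (simp add: field_simps)
      then show ?thesis by (simp add: f_def)
    qed
    finally have e: "inverse (u x) * u x powr p = exp (2 * f x)" .
    have "inverse (u x) * F x (u x) / \<beta> = inverse (u x) * (S x * u x - R x * u x powr p / N)"
      using \<beta> by (simp add: F_def)
    also have "\<dots> = S x * (inverse (u x) * u x) - R x * (inverse (u x) * u x powr p) / N"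
      by (simp add: right_diff_distrib mult_ac)
    also have "\<dots> = S x - R x * exp (2 * f x) / N" unfolding e using ux by simp
    finally have l': "laplacian f x = - (inverse (u x))\<^sup>2 * q / \<beta> + (S x - R x * exp (2 * f x) / N)"
      using l by simp
    \<comment> \<open>The coefficient of |grad f|^2 in the equation is (n - 2) / 2 = \<beta>, the
      same as the one produced by the Laplacian of ln u / \<beta>; this match determines the
      substitution.\<close>
    have "1 / (2 * (n - 1)) * ((n - 1) * (n - 2) * (norm (grad f x))\<^sup>2) = \<beta> * (norm (grad f x))\<^sup>2"
      using n3 by (simp add: \<beta>_def field_simps)
    also have "\<dots> = (inverse (u x))\<^sup>2 * q / \<beta>" unfolding g using \<beta> by (simp add: power2_eq_square)
    finally have g': "1 / (2 * (n - 1)) * ((n - 1) * (n - 2) * (norm (grad f x))\<^sup>2) = (inverse (u x))\<^sup>2 * q / \<beta>" .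
    have "- (1 / (2 * (n - 1))) * (exp (2 * f x) * R x + (n - 1) * (n - 2) * (norm (grad f x))\<^sup>2)
        = - (exp (2 * f x) * R x / N) - 1 / (2 * (n - 1)) * ((n - 1) * (n - 2) * (norm (grad f x))\<^sup>2)"
      by (simp only: N_def distrib_left mult_minus_left) simp
    then show ?thesis using l' g' by (simp add: mult.commute)
  qed
  moreover have "\<forall>x\<in>frontier \<Omega>. f x = 0" using u(2) by (simp add: f_def)
  ultimately show ?thesis unfolding is_smooth_dirichlet_solution_def Let_def n_def by blast
qed

section \<open>The Green function of the unit ball\<close>

lemma norm_powr_eq_inner_powr: "norm x powr a = (x \<bullet> x) powr (a / 2)"
  by (simp add: powr_powr flip: power2_norm_eq_inner powr_numeral)

context
  fixes A c :: real and b :: "'a::euclidean_space" and quad :: "'a \<Rightarrow> real"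
  defines "quad \<equiv> \<lambda>x. A + b \<bullet> x + c * (x \<bullet> x)"
begin

lemma quad_has_derivative: "(quad has_derivative (\<lambda>v. (b + (2 * c) *\<^sub>R x) \<bullet> v)) (at x)"
  unfolding quad_def
  by (auto intro!: derivative_eq_intros simp: inner_add_left inner_commute algebra_simps)

lemma quad_higher_differentiable: "higher_differentiable_on UNIV quad k"
proof -
  have "poly_deg 2 (\<lambda>x::'a. x \<bullet> x)"
    using poly_deg_quadratic[of 0 "-1" 0 "0::'a"] by simp
  then have "poly_deg 2 (\<lambda>x::'a. (A + x \<bullet> b) + c * (x \<bullet> x))"
    by (intro poly_deg.add poly_deg_cmult poly_deg.const poly_deg_mono[OF poly_deg_inner]) auto
  then have "poly_deg 2 quad" by (simp add: quad_def[abs_def] inner_commute add.commute add.left_commute)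
  then show ?thesis by (rule higher_differentiable_on_poly_deg)
qed

lemma quad_grad: "grad quad x = b + (2 * c) *\<^sub>R x"
  by (rule grad_eqI[OF quad_has_derivative])

lemma quad_laplacian: "laplacian quad x = 2 * DIM('a) * c"
proof -
  have "laplacian quad x = (\<Sum>e\<in>(Basis::'a set). (2 * c) * (e \<bullet> e))"
  proof (rule laplacian_eqI[OF open_UNIV UNIV_I quad_has_derivative, where f''="\<lambda>e v. (2 * c) * (v \<bullet> e)"])
    show "((\<lambda>y. (b + (2 * c) *\<^sub>R y) \<bullet> e) has_derivative (\<lambda>v. (2 * c) * (v \<bullet> e))) (at x)" for e
      by (auto intro!: derivative_eq_intros simp: inner_add_left)
  qed
  also have "\<dots> = (\<Sum>e\<in>(Basis::'a set). 2 * c)" by (intro sum.cong) (auto simp: inner_Basis)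
  finally show ?thesis by simp
qed

text \<open>The condition on b, c and A means |grad quad|^2 = 4 c quad. With Laplacian 2 n c the
  exponent (2 - n) / 2 gives a harmonic power. Both |x - y|^2 and the reflected expression
  \<open>kelvin\<close> are of this kind, so one computation covers both parts of the Green
  function.\<close>

lemma quad_powr:
  assumes U: "open U" "x \<in> U" and pos: "\<And>y. y \<in> U \<Longrightarrow> 0 < quad y" and bA: "b \<bullet> b = 4 * c * A"
  defines "\<alpha> \<equiv> (2 - real DIM('a)) / 2"
  shows "laplacian (\<lambda>y. quad y powr \<alpha>) x = 0"
    and "grad (\<lambda>y. quad y powr \<alpha>) x = (\<alpha> * quad x powr (\<alpha> - 1)) *\<^sub>R (b + (2 * c) *\<^sub>R x)"
proof -
  have h: "higher_differentiable_on U quad 2"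
    by (rule higher_differentiable_on_subset[OF subset_UNIV quad_higher_differentiable])
  have d1: "((\<lambda>t. t powr \<alpha>) has_real_derivative \<alpha> * quad y powr (\<alpha> - 1)) (at (quad y))" if "y \<in> U" for y
    by (rule has_real_derivative_powr[OF pos[OF that]])
  have d2: "((\<lambda>t. \<alpha> * t powr (\<alpha> - 1)) has_real_derivative \<alpha> * ((\<alpha> - 1) * quad x powr (\<alpha> - 1 - 1))) (at (quad x))"
    by (rule DERIV_cmult[OF has_real_derivative_powr[OF pos[OF U(2)]]])
  note lc = laplacian_compose[where \<psi>="\<lambda>t. t powr \<alpha>" and \<psi>'="\<lambda>t. \<alpha> * t powr (\<alpha> - 1)", OF U h d1 d2]
  show "grad (\<lambda>y. quad y powr \<alpha>) x = (\<alpha> * quad x powr (\<alpha> - 1)) *\<^sub>R (b + (2 * c) *\<^sub>R x)"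
    using lc(2) by (simp add: quad_grad)
  have "(norm (b + (2 * c) *\<^sub>R x))\<^sup>2 = b \<bullet> b + 4 * c * (b \<bullet> x) + 4 * c * c * (x \<bullet> x)"
    unfolding power2_norm_eq_inner by (simp add: inner_add_left inner_add_right inner_commute algebra_simps)
  also have "\<dots> = 4 * c * quad x" unfolding bA by (simp add: quad_def algebra_simps)
  finally have g: "(norm (grad quad x))\<^sup>2 = 4 * c * quad x" by (simp add: quad_grad)
  have q: "quad x powr (\<alpha> - 1 - 1) * quad x = quad x powr (\<alpha> - 1)"
    using pos[OF U(2)] powr_mult_base[of "quad x" "\<alpha> - 1 - 1"] by (simp add: mult.commute)
  have "laplacian (\<lambda>y. quad y powr \<alpha>) x
      = \<alpha> * (\<alpha> - 1) * 4 * c * (quad x powr (\<alpha> - 1 - 1) * quad x) + \<alpha> * quad x powr (\<alpha> - 1) * (2 * DIM('a) * c)"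
    using lc(1) by (simp add: g quad_laplacian mult_ac)
  also have "\<dots> = 2 * \<alpha> * c * quad x powr (\<alpha> - 1) * (2 * (\<alpha> - 1) + DIM('a))"
    unfolding q by (simp add: algebra_simps)
  also have "2 * (\<alpha> - 1) + DIM('a) = 0" by (simp add: \<alpha>_def field_simps)
  finally show "laplacian (\<lambda>y. quad y powr \<alpha>) x = 0" by simp
qed

end

text \<open>For y \<noteq> 0 this is |y|^2 |x - y*|^2 with y* = y / |y|^2 the point reflected in the
  unit sphere. The polynomial form has no division and includes y = 0.\<close>

definition kelvin :: "'a::euclidean_space \<Rightarrow> 'a \<Rightarrow> real" where
  "kelvin y x = 1 + (- 2 *\<^sub>R y) \<bullet> x + (y \<bullet> y) * (x \<bullet> x)"

lemma kelvin_eq: "kelvin y x = (x - y) \<bullet> (x - y) + (1 - x \<bullet> x) * (1 - y \<bullet> y)"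
  by (simp add: kelvin_def inner_diff_left inner_diff_right inner_commute algebra_simps)

lemma inner_self_less_1: "x \<in> ball (0::'a::euclidean_space) 1 \<Longrightarrow> x \<bullet> x < 1"
  using power_strict_mono[of "norm x" 1 2] by (simp flip: power2_norm_eq_inner)

lemma inner_self_le_1: "x \<in> cball (0::'a::euclidean_space) 1 \<Longrightarrow> x \<bullet> x \<le> 1"
  using power_mono[of "norm x" 1 2] by (simp flip: power2_norm_eq_inner)

lemma kelvin_pos:
  fixes x y :: "'a::euclidean_space"
  assumes "y \<in> ball 0 1" "x \<in> cball 0 1"
  shows "0 < kelvin y x"
proof (cases "x = y")
  case True
  then have "x \<bullet> x < 1" using inner_self_less_1[OF assms(1)] by simp
  then show ?thesis using True by (simp add: kelvin_eq)
next
  case False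
  have "0 \<le> (1 - x \<bullet> x) * (1 - y \<bullet> y)"
    using inner_self_less_1[OF assms(1)] inner_self_le_1[OF assms(2)] by (intro mult_nonneg_nonneg) auto
  moreover have "0 < (x - y) \<bullet> (x - y)" using False by simp
  ultimately show ?thesis unfolding kelvin_eq by linarith
qed

lemma kelvin_ge:
  fixes x y :: "'a::euclidean_space"
  assumes "y \<in> ball 0 1" "x \<in> cball 0 1"
  shows "(x - y) \<bullet> (x - y) \<le> kelvin y x"
  using inner_self_less_1[OF assms(1)] inner_self_le_1[OF assms(2)] by (simp add: kelvin_eq)

definition green_kappa :: "'a::euclidean_space itself \<Rightarrow> real" where
  "green_kappa _ = 1 / (real DIM('a) * (real DIM('a) - 2) * unit_ball_vol (real DIM('a)))"

text \<open>Method of images: on the unit sphere \<open>kelvin y x\<close> equals |x - y|^2, so the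
  harmonic second term cancels the fundamental solution there.\<close>

definition explicit_green :: "'a::euclidean_space \<Rightarrow> 'a \<Rightarrow> real" where
  "explicit_green x y = fundamental_solution (x - y)
     + green_kappa TYPE('a) * kelvin y x powr ((2 - real DIM('a)) / 2)"

lemma fundamental_solution_eq:
  fixes x :: "'a::euclidean_space"
  assumes "3 \<le> DIM('a)"
  shows "fundamental_solution x = - green_kappa TYPE('a) * (x \<bullet> x) powr ((2 - real DIM('a)) / 2)"
  using assms by (simp add: fundamental_solution_def green_kappa_def norm_powr_eq_inner_powr Let_def)

lemma harmonic_kelvin:
  fixes y :: "'a::euclidean_space"
  assumes y: "y \<in> ball 0 1"
  shows "harmonic_on (ball 0 1) (\<lambda>x. k * kelvin y x powr ((2 - real DIM('a)) / 2))"
    and "continuous_on (cball 0 1) (\<lambda>x. k * kelvin y x powr ((2 - real DIM('a)) / 2))"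
proof -
  let ?\<alpha> = "(2 - real DIM('a)) / 2"
  have pos: "0 < kelvin y x" if "x \<in> cball 0 1" for x by (rule kelvin_pos[OF y that])
  have h: "higher_differentiable_on (ball 0 1) (kelvin y) j" for j
    using higher_differentiable_on_subset[OF subset_UNIV quad_higher_differentiable[of 1 "- 2 *\<^sub>R y" "y \<bullet> y"]]
    by (simp add: kelvin_def[abs_def])
  have hp: "higher_differentiable_on (ball 0 1) (\<lambda>x. kelvin y x powr ?\<alpha>) 2"
    by (rule higher_differentiable_on_powr[OF open_ball _ h]) (use pos in auto)
  have lap: "laplacian (\<lambda>x. kelvin y x powr ?\<alpha>) x = 0" if x: "x \<in> ball 0 1" for x
    unfolding kelvin_def
    by (rule quad_powr(1)[OF open_ball x])
       (use pos in \<open>auto simp: kelvin_def\<close>)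
  have "laplacian (\<lambda>x. k * kelvin y x powr ?\<alpha>) x = 0" if "x \<in> ball 0 1" for x
    using laplacian_lincomb[OF open_ball that hp hp, where a=k and b=0] lap[OF that] by simp
  then show "harmonic_on (ball 0 1) (\<lambda>x. k * kelvin y x powr ?\<alpha>)"
    unfolding harmonic_on_def using higher_differentiable_on_cmult[OF open_ball hp] by blast
  have "\<forall>x\<in>cball 0 1. kelvin y x \<noteq> 0" using pos by force
  moreover have "continuous_on (cball 0 1) (kelvin y)" unfolding kelvin_def by (intro continuous_intros)
  ultimately show "continuous_on (cball 0 1) (\<lambda>x. k * kelvin y x powr ?\<alpha>)"
    by (intro continuous_on_mult continuous_on_const continuous_on_powr)
qed

lemma explicit_green_boundary:
  fixes x y :: "'a::euclidean_space"
  assumes "3 \<le> DIM('a)" "x \<in> sphere 0 1"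
  shows "explicit_green x y = 0"
proof -
  have "x \<bullet> x = 1" using assms(2) by (simp add: flip: power2_norm_eq_inner)
  then show ?thesis by (simp add: explicit_green_def fundamental_solution_eq[OF assms(1)] kelvin_eq)
qed

lemma is_green_function_explicit:
  assumes "3 \<le> DIM('a::euclidean_space)"
  shows "is_green_function (ball (0::'a) 1) explicit_green"
proof -
  have "closure (ball (0::'a) 1) = cball 0 1" "frontier (ball (0::'a) 1) = sphere 0 1" by auto
  then show ?thesis
    unfolding is_green_function_def
    using harmonic_kelvin[where 'a='a] explicit_green_boundary[OF assms]
    by (intro ballI conjI exI[of _ "\<lambda>x. green_kappa TYPE('a) * kelvin y x powr ((2 - real DIM('a)) / 2)" for y])
       (auto simp: explicit_green_def)
qed

lemma harmonic_imp_weak_solution: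
  assumes "open U" "harmonic_on U h"
  shows "weak_solution U h (\<lambda>_. 0)"
  by (rule weak_solution_cong[OF weak_solution_laplacian[OF assms(1)]])
     (use assms(2) in \<open>auto simp: harmonic_on_def\<close>)

lemma harmonic_unique:
  fixes h k :: "'a::euclidean_space \<Rightarrow> real"
  assumes U: "open U" "bounded U" and h: "harmonic_on U h" "continuous_on (closure U) h"
    and k: "harmonic_on U k" "continuous_on (closure U) k"
    and eq: "\<And>x. x \<in> frontier U \<Longrightarrow> h x = k x" and x: "x \<in> closure U"
  shows "h x = k x"
proof (rule antisym)
  note wh = weak_solution_imp_sub_super[OF U(1) harmonic_imp_weak_solution[OF U(1) h(1)]]
    and wk = weak_solution_imp_sub_super[OF U(1) harmonic_imp_weak_solution[OF U(1) k(1)]]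
  show "h x \<le> k x" by (rule weak_comparison[OF U h(2) k(2) wh(1) wk(2) order_refl _ x]) (simp add: eq)
  show "k x \<le> h x" by (rule weak_comparison[OF U k(2) h(2) wk(1) wh(2) order_refl _ x]) (simp add: eq)
qed

text \<open>The chosen Green function and the explicit one have the same singular part; their
  harmonic parts have equal boundary values and agree by the maximum principle.\<close>

lemma green_function_ball_eq:
  fixes x y :: "'a::euclidean_space"
  assumes dim: "3 \<le> DIM('a)" and y: "y \<in> ball 0 1" and x: "x \<in> cball 0 1"
  shows "green_function (ball 0 1) x y = explicit_green x y"
proof -
  let ?h = "\<lambda>x. green_kappa TYPE('a) * kelvin y x powr ((2 - real DIM('a)) / 2)"
  have cl: "closure (ball (0::'a) 1) = cball 0 1" "frontier (ball (0::'a) 1) = sphere 0 1" by auto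
  have "is_green_function (ball (0::'a) 1) (green_function (ball 0 1))"
    unfolding green_function_def by (rule someI[where P="is_green_function (ball 0 1)", OF is_green_function_explicit[OF dim]])
  then obtain h where h: "harmonic_on (ball 0 1) h" "continuous_on (cball 0 1) h"
      "\<forall>x\<in>cball 0 1. green_function (ball 0 1) x y = fundamental_solution (x - y) + h x"
    and z: "\<forall>x\<in>sphere 0 1. green_function (ball 0 1) x y = 0"
    using y unfolding is_green_function_def cl by blast
  have "h x = ?h x"
  proof (rule harmonic_unique[OF open_ball bounded_ball h(1) _ harmonic_kelvin(1)[OF y]])
    fix z' :: 'a assume z': "z' \<in> frontier (ball 0 1)"
    then have zs: "z' \<in> sphere 0 1" and zc: "z' \<in> cball 0 1" using cl by auto
    then have "fundamental_solution (z' - y) + h z' = 0"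
      using bspec[OF h(3) zc] bspec[OF z zs] by simp
    then show "h z' = ?h z'"
      using explicit_green_boundary[OF dim zs, of y] by (simp add: explicit_green_def)
  qed (use h(2) harmonic_kelvin(2)[OF y] x cl in auto)
  then show ?thesis using h(3) x by (simp add: explicit_green_def)
qed

lemma grad_lincomb:
  fixes f g :: "'a::euclidean_space \<Rightarrow> real"
  assumes "(f has_derivative f') (at x)" "(g has_derivative g') (at x)"
  shows "grad (\<lambda>x. a * f x + b * g x) x = a *\<^sub>R grad f x + b *\<^sub>R grad g x"
proof -
  have "frechet_derivative (\<lambda>x. a * f x + b * g x) (at x) = (\<lambda>v. a * f' v + b * g' v)"
    by (rule frechet_derivative_at[symmetric]) (intro has_derivative_add has_derivative_mult_right assms)
  moreover have "frechet_derivative f (at x) = f'" "frechet_derivative g (at x) = g'"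
    using assms frechet_derivative_at by metis+
  ultimately show ?thesis
    by (simp add: grad_def scaleR_add_left sum.distrib scaleR_sum_right)
qed

lemma grad_green_function:
  fixes x y :: "'a::euclidean_space"
  assumes dim: "3 \<le> DIM('a)" and y: "y \<in> ball 0 1" and x: "x \<in> ball 0 1" and xy: "x \<noteq> y"
  defines "n \<equiv> real DIM('a)"
  shows "grad (\<lambda>z. green_function (ball 0 1) z y) x = (1 / (n * unit_ball_vol n)) *\<^sub>R
    (norm (x - y) powr (- n) *\<^sub>R (x - y) - kelvin y x powr (- n / 2) *\<^sub>R ((y \<bullet> y) *\<^sub>R x - y))"
proof -
  let ?\<alpha> = "(2 - real DIM('a)) / 2"
  let ?\<kappa> = "green_kappa TYPE('a)"
  let ?q = "\<lambda>z. y \<bullet> y + (- 2 *\<^sub>R y) \<bullet> z + 1 * (z \<bullet> z)"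
  let ?U = "ball 0 1 - {y}"
  have U: "open ?U" "x \<in> ?U" using x xy by (auto intro: open_delete)
  have q: "?q z = (z - y) \<bullet> (z - y)" for z
    by (simp add: inner_diff_left inner_diff_right inner_commute algebra_simps)
  have qpos: "0 < ?q z" if "z \<in> ?U" for z using that unfolding q by simp
  have kpos: "0 < kelvin y z" if "z \<in> ?U" for z using that by (intro kelvin_pos[OF y]) auto
  have kpos': "0 < 1 + (- 2 *\<^sub>R y) \<bullet> z + (y \<bullet> y) * (z \<bullet> z)" if "z \<in> ?U" for z
    using kpos[OF that] by (simp only: kelvin_def)
  have G: "green_function (ball 0 1) z y = (- ?\<kappa>) * ?q z powr ?\<alpha> + ?\<kappa> * kelvin y z powr ?\<alpha>" if "z \<in> ?U" for z
  proof -
    have "z \<in> cball 0 1" using that by simp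
    then show ?thesis
      unfolding q by (simp add: green_function_ball_eq[OF dim y] explicit_green_def fundamental_solution_eq[OF dim])
  qed
  have d: "((\<lambda>z. h z powr ?\<alpha>) has_derivative frechet_derivative (\<lambda>z. h z powr ?\<alpha>) (at x)) (at x)"
    if "higher_differentiable_on UNIV h 1" "\<And>z. z \<in> ?U \<Longrightarrow> 0 < h z" for h
  proof -
    have "higher_differentiable_on ?U (\<lambda>z. h z powr ?\<alpha>) (Suc 0)"
      using higher_differentiable_on_powr[OF U(1) that(2) higher_differentiable_on_subset[OF subset_UNIV that(1)]] by simp
    then show ?thesis by (rule higher_differentiable_on_has_derivative[OF _ U(2)])
  qed
  have dq: "((\<lambda>z. ?q z powr ?\<alpha>) has_derivative frechet_derivative (\<lambda>z. ?q z powr ?\<alpha>) (at x)) (at x)"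
    by (rule d[OF quad_higher_differentiable qpos])
  have dk: "((\<lambda>z. kelvin y z powr ?\<alpha>) has_derivative frechet_derivative (\<lambda>z. kelvin y z powr ?\<alpha>) (at x)) (at x)"
    unfolding kelvin_def by (rule d[OF quad_higher_differentiable kpos'])
  have gq: "grad (\<lambda>z. ?q z powr ?\<alpha>) x = (?\<alpha> * ?q x powr (?\<alpha> - 1)) *\<^sub>R (- 2 *\<^sub>R y + (2 * 1) *\<^sub>R x)"
    by (rule quad_powr(2)[OF U qpos]) simp_all
  have gk: "grad (\<lambda>z. kelvin y z powr ?\<alpha>) x = (?\<alpha> * kelvin y x powr (?\<alpha> - 1)) *\<^sub>R (- 2 *\<^sub>R y + (2 * (y \<bullet> y)) *\<^sub>R x)"
    unfolding kelvin_def by (rule quad_powr(2)[OF U kpos']) simp_all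
  have \<alpha>1: "?\<alpha> - 1 = - n / 2" by (simp add: n_def field_simps)
  have n2: "0 < n - 2" "0 < n" using dim by (auto simp: n_def)
  have "1 / (n * k * V) * (- k) = - (1 / (n * V))" if "0 < k" for k V :: real
    using that by simp
  \<comment> \<open>The factor n - 2 of the normalisation cancels against the exponent, leaving the
    reciprocal n \<omega> of the sphere's area, with \<omega> the volume of the unit ball.\<close>
  from this[OF n2(1)] have \<kappa>\<alpha>: "?\<kappa> * ?\<alpha> * 2 = - (1 / (n * unit_ball_vol n))"
    unfolding green_kappa_def n_def[symmetric] by simp
  have alg: "(- a) *\<^sub>R ((\<alpha> * Q) *\<^sub>R (- 2 *\<^sub>R y + (2 * 1) *\<^sub>R x)) + a *\<^sub>R ((\<alpha> * K) *\<^sub>R (- 2 *\<^sub>R y + (2 * Y) *\<^sub>R x))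
      = (- (a * \<alpha> * 2)) *\<^sub>R (Q *\<^sub>R (x - y) - K *\<^sub>R (Y *\<^sub>R x - y))" for a \<alpha> Q K Y :: real
    by (simp add: scaleR_diff_right scaleR_add_right mult_ac)
  have "grad (\<lambda>z. green_function (ball 0 1) z y) x
      = grad (\<lambda>z. (- ?\<kappa>) * ?q z powr ?\<alpha> + ?\<kappa> * kelvin y z powr ?\<alpha>) x"
    by (rule grad_cong_open[OF U G])
  also have "\<dots> = (- ?\<kappa>) *\<^sub>R grad (\<lambda>z. ?q z powr ?\<alpha>) x + ?\<kappa> *\<^sub>R grad (\<lambda>z. kelvin y z powr ?\<alpha>) x"
    by (rule grad_lincomb[OF dq dk])
  also have "\<dots> = (- (?\<kappa> * ?\<alpha> * 2)) *\<^sub>R (?q x powr (?\<alpha> - 1) *\<^sub>R (x - y) - kelvin y x powr (?\<alpha> - 1) *\<^sub>R ((y \<bullet> y) *\<^sub>R x - y))"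
    unfolding gq gk by (rule alg)
  also have "\<dots> = (1 / (n * unit_ball_vol n)) *\<^sub>R
    (norm (x - y) powr (- n) *\<^sub>R (x - y) - kelvin y x powr (- n / 2) *\<^sub>R ((y \<bullet> y) *\<^sub>R x - y))"
    unfolding \<kappa>\<alpha> \<alpha>1 q norm_powr_eq_inner_powr[of "x - y"] by simp
  finally show ?thesis .
qed

lemma norm_powr_scaleR:
  fixes z :: "'a::euclidean_space"
  assumes "z \<noteq> 0"
  shows "norm (norm z powr (- n) *\<^sub>R z) = norm z powr (1 - n)"
  using assms powr_mult_base[of "norm z" "- n"] by (simp add: mult.commute)

text \<open>The vector in the image term satisfies | |y|^2 x - y |^2 = |y|^2 kelvin \<le> kelvin, so
  this term is at most kelvin powr ((1 - n) / 2), and kelvin \<ge> |x - y|^2 reduces it to the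
  singular term. Needed to show that the supremum in \<open>green_const\<close> is over a bounded
  set.\<close>

lemma norm_grad_green_function_le:
  fixes x y :: "'a::euclidean_space"
  assumes dim: "3 \<le> DIM('a)" and y: "y \<in> ball 0 1" and x: "x \<in> ball 0 1" and xy: "x \<noteq> y"
  defines "n \<equiv> real DIM('a)"
  shows "norm (grad (\<lambda>z. green_function (ball 0 1) z y) x) \<le> 2 / (n * unit_ball_vol n) * norm (x - y) powr (1 - n)"
proof -
  let ?k = "kelvin y x" and ?v = "(y \<bullet> y) *\<^sub>R x - y"
  have n3: "3 \<le> n" using dim by (simp add: n_def)
  have x': "x \<in> cball 0 1" using x by simp
  have k0: "0 < ?k" by (rule kelvin_pos[OF y x'])
  have "(norm ?v)\<^sup>2 = (y \<bullet> y) * ?k"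
    unfolding power2_norm_eq_inner
    by (simp add: kelvin_def inner_diff_left inner_diff_right inner_commute algebra_simps)
  also have "\<dots> \<le> 1 * ?k" using inner_self_less_1[OF y] k0 by (intro mult_right_mono) auto
  also have "\<dots> = (?k powr (1/2))\<^sup>2" using k0 by (simp add: powr_half_sqrt)
  finally have v: "norm ?v \<le> ?k powr (1/2)" by (rule power2_le_imp_le) simp
  have "norm (?k powr (- n / 2) *\<^sub>R ?v) = ?k powr (- n / 2) * norm ?v" by simp
  also have "\<dots> \<le> ?k powr (- n / 2) * ?k powr (1/2)" using v by (intro mult_left_mono) auto
  also have "\<dots> = ?k powr ((1 - n) / 2)"
    by (simp add: diff_divide_distrib flip: powr_add)
  also have "\<dots> \<le> ((x - y) \<bullet> (x - y)) powr ((1 - n) / 2)"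
    using n3 xy kelvin_ge[OF y x'] by (intro powr_mono2') auto
  also have "\<dots> = norm (x - y) powr (1 - n)" by (rule norm_powr_eq_inner_powr[symmetric])
  finally have 2: "norm (?k powr (- n / 2) *\<^sub>R ?v) \<le> norm (x - y) powr (1 - n)" .
  have "norm (norm (x - y) powr (- n) *\<^sub>R (x - y) - ?k powr (- n / 2) *\<^sub>R ?v)
      \<le> norm (x - y) powr (1 - n) + norm (x - y) powr (1 - n)"
    using norm_triangle_ineq4[of "norm (x - y) powr (- n) *\<^sub>R (x - y)" "?k powr (- n / 2) *\<^sub>R ?v"]
      norm_powr_scaleR[of "x - y" n] 2 xy by simp
  moreover have c0: "0 \<le> 1 / (n * unit_ball_vol n)" using n3 by simp
  ultimately have "1 / (n * unit_ball_vol n) * norm (norm (x - y) powr (- n) *\<^sub>R (x - y) - ?k powr (- n / 2) *\<^sub>R ?v)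
      \<le> 1 / (n * unit_ball_vol n) * (norm (x - y) powr (1 - n) + norm (x - y) powr (1 - n))"
    by (intro mult_left_mono)
  then show ?thesis
    using c0 by (simp add: grad_green_function[OF dim y x xy] n_def[symmetric])
qed

text \<open>At x = 0 \<open>kelvin\<close> is 1 and both terms of the gradient point along -y and y,
  so the norm is an explicit function of |y|.\<close>

lemma norm_grad_green_function_0:
  fixes y :: "'a::euclidean_space"
  assumes dim: "3 \<le> DIM('a)" and y: "y \<in> ball 0 1" and y0: "y \<noteq> 0"
  defines "n \<equiv> real DIM('a)"
  shows "norm (grad (\<lambda>z. green_function (ball 0 1) z y) 0) = 1 / (n * unit_ball_vol n) * (norm y powr (1 - n) - norm y)"
proof -
  have n3: "3 \<le> n" using dim by (simp add: n_def)
  have c0: "0 \<le> 1 / (n * unit_ball_vol n)" using n3 by simp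
  have x0: "(0::'a) \<in> ball 0 1" by simp
  have "norm y powr (- n) \<ge> norm y powr 0"
    using y y0 n3 by (intro powr_mono') auto
  then have ge: "1 \<le> norm y powr (- n)" using y0 by simp
  have "norm y powr (- n) *\<^sub>R (0 - y) - kelvin y 0 powr (- n / 2) *\<^sub>R ((y \<bullet> y) *\<^sub>R 0 - y)
      = (norm y powr (- n) - 1) *\<^sub>R (- y)"
    by (simp add: kelvin_def scaleR_diff_left)
  then have "norm (norm (0 - y) powr (- n) *\<^sub>R (0 - y) - kelvin y 0 powr (- n / 2) *\<^sub>R ((y \<bullet> y) *\<^sub>R 0 - y))
      = (norm y powr (- n) - 1) * norm y"
    using ge by simp
  also have "\<dots> = norm y powr (1 - n) - norm y"
    using y0 powr_mult_base[of "norm y" "- n"] by (simp add: algebra_simps)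
  finally show ?thesis
    using c0 by (simp only: grad_green_function[OF dim y x0 y0[symmetric]] n_def[symmetric] norm_scaleR abs_of_nonneg)
qed

section \<open>Integrals of powers of the norm and the lower bound for the constant\<close>

lemma nn_integral_lborel_affine:
  fixes g :: "'a::euclidean_space \<Rightarrow> ennreal"
  assumes g [measurable]: "g \<in> borel_measurable borel" and c: "c \<noteq> 0"
  shows "(\<integral>\<^sup>+x. g x \<partial>lborel) = ennreal (\<bar>c\<bar> ^ DIM('a)) * (\<integral>\<^sup>+x. g (t + c *\<^sub>R x) \<partial>lborel)"
  by (subst lborel_affine[OF c, of t])
     (simp add: nn_integral_density nn_integral_distr nn_integral_cmult)

text \<open>Dyadic shells in place of polar coordinates: the terms 2^((k+1)(n-1)) times the volume
  of the ball of radius 2^-k form a geometric series with ratio 1/2.\<close>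

lemma nn_integral_ball_norm_powr_finite:
  "(\<integral>\<^sup>+z. ennreal (norm (z::'a::euclidean_space) powr (1 - real DIM('a))) * indicator (ball 0 1) z \<partial>lborel) < \<infinity>"
proof -
  define N where "N = DIM('a)"
  define M where "M = N - 1"
  have N: "N = Suc M" using DIM_positive[where 'a='a] by (simp add: N_def M_def)
  let ?f = "\<lambda>z::'a. norm z powr (1 - real N)"
  \<comment> \<open>The bound for the integrand where 2^-(k+1) \<le> |z| < 2^-k.\<close>
  define cc where "cc = (\<lambda>k::nat. (2::real) ^ (Suc k * M))"
  have fz: "ennreal (?f z) * indicator (ball 0 1) z \<le> (\<Sum>k. ennreal (cc k) * indicator (ball 0 ((1/2) ^ k)) z)"
    if z0: "z \<noteq> 0" for z :: 'a
  proof (cases "z \<in> ball 0 1")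
    case True
    have nz: "0 < norm z" using z0 by simp
    have "\<exists>k. (1/2) ^ k < norm z" by (rule real_arch_pow_inv[OF nz]) simp
    then obtain k0 where k0: "(1/2::real) ^ k0 \<le> norm z" using less_imp_le by blast
    define k where "k = (LEAST k. (1/2::real) ^ k \<le> norm z)"
    have k: "(1/2::real) ^ k \<le> norm z" unfolding k_def by (rule LeastI[of "\<lambda>k. (1/2::real) ^ k \<le> norm z", OF k0])
    have "k \<noteq> 0" using k True by (cases k) auto
    then obtain j where j: "k = Suc j" by (cases k) auto
    have "\<not> (1/2::real) ^ j \<le> norm z" using not_less_Least[of j "\<lambda>k. (1/2::real) ^ k \<le> norm z"] j by (simp add: k_def)
    then have zj: "z \<in> ball 0 ((1/2) ^ j)" by simp
    have "?f z = inverse (norm z ^ M)" using nz by (simp add: N powr_minus powr_realpow)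
    also have "\<dots> \<le> inverse (((1/2) ^ Suc j) ^ M)"
      using k j by (intro le_imp_inverse_le power_mono) (auto simp del: power_Suc)
    also have "\<dots> = cc j" by (simp add: cc_def power_mult[symmetric] power_one_over del: power_Suc)
    finally have "ennreal (?f z) * indicator (ball 0 1) z \<le> ennreal (cc j) * indicator (ball 0 ((1/2) ^ j)) z"
      using True zj by (simp add: ennreal_leI)
    also have "\<dots> = (\<Sum>k\<in>{j}. ennreal (cc k) * indicator (ball 0 ((1/2) ^ k)) z)"
      by (subst sum.insert) simp_all
    also have "\<dots> \<le> (\<Sum>k. ennreal (cc k) * indicator (ball 0 ((1/2) ^ k)) z)"
      by (rule sum_le_suminf) auto
    finally show ?thesis .
  qed simp
  have "AE z in lborel. z \<noteq> (0::'a)" by (rule AE_lborel_singleton)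
  then have "AE z in lborel. ennreal (?f z) * indicator (ball 0 1) z
      \<le> (\<Sum>k. ennreal (cc k) * indicator (ball (0::'a) ((1/2) ^ k)) z)"
    by (rule AE_mp) (rule AE_I2, rule impI, rule fz)
  then have "(\<integral>\<^sup>+z. ennreal (?f z) * indicator (ball 0 1) z \<partial>lborel)
      \<le> (\<integral>\<^sup>+z. (\<Sum>k. ennreal (cc k) * indicator (ball (0::'a) ((1/2) ^ k)) z) \<partial>lborel)"
    by (rule nn_integral_mono_AE)
  also have "\<dots> = (\<Sum>k. \<integral>\<^sup>+z. ennreal (cc k) * indicator (ball (0::'a) ((1/2) ^ k)) z \<partial>lborel)"
    by (rule nn_integral_suminf) (measurable, simp)
  also have "\<dots> = (\<Sum>k. ennreal (2 ^ M * unit_ball_vol (real N) * (1/2) ^ k))"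
  proof (rule suminf_cong)
    fix k
    have "cc k * ((1/2) ^ k) ^ N = 2 ^ M * (1/2) ^ k"
      by (simp add: cc_def N power_add power_one_over power_mult[symmetric] mult.commute field_simps)
    then have "cc k * (unit_ball_vol (real N) * ((1/2) ^ k) ^ N) = 2 ^ M * unit_ball_vol (real N) * (1/2) ^ k"
      by (simp add: mult_ac)
    then show "(\<integral>\<^sup>+z. ennreal (cc k) * indicator (ball (0::'a) ((1/2) ^ k)) z \<partial>lborel)
        = ennreal (2 ^ M * unit_ball_vol (real N) * (1/2) ^ k)"
      by (simp add: nn_integral_cmult_indicator emeasure_ball N_def[symmetric] cc_def flip: ennreal_mult)
  qed
  also have "\<dots> = ennreal (2 ^ M * unit_ball_vol (real N) * (1 / (1 - 1/2)))"
  proof (rule suminf_ennreal_eq)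
    show "(\<lambda>k. 2 ^ M * unit_ball_vol (real N) * (1 / 2) ^ k) sums (2 ^ M * unit_ball_vol (real N) * (1 / (1 - 1/2)))"
      by (intro sums_mult geometric_sums) simp
  qed simp
  also have "\<dots> < \<infinity>" by simp
  finally show ?thesis by (simp add: N_def)
qed

definition radial_mass :: "'a::euclidean_space itself \<Rightarrow> real" where
  "radial_mass _ = enn2real (\<integral>\<^sup>+z. ennreal (norm (z::'a) powr (1 - real DIM('a))) * indicator (ball 0 1) z \<partial>lborel)"

lemma nn_integral_ball_norm_powr:
  "(\<integral>\<^sup>+z. ennreal (norm (z::'a::euclidean_space) powr (1 - real DIM('a))) * indicator (ball 0 1) z \<partial>lborel)
    = ennreal (radial_mass TYPE('a))"
  unfolding radial_mass_def
  using nn_integral_ball_norm_powr_finite[where 'a='a] by (intro ennreal_enn2real[symmetric]) simp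

text \<open>By scaling, the integral over the ball of radius \<open>q\<close> is \<open>q\<close> times the integral over the unit ball,
  and on the remaining shell the integrand is at least 1; let \<open>q\<close> tend to 1.\<close>

lemma radial_mass_ge:
  "real DIM('a::euclidean_space) * unit_ball_vol (real DIM('a)) \<le> radial_mass TYPE('a)"
proof -
  define N where "N = DIM('a)"
  define M where "M = N - 1"
  have N: "N = Suc M" using DIM_positive[where 'a='a] by (simp add: N_def M_def)
  define V where "V = unit_ball_vol (real N)"
  have V: "0 \<le> V" by (simp add: V_def)
  let ?f = "\<lambda>z::'a. ennreal (norm z powr (1 - real N))"
  let ?J = "radial_mass TYPE('a)"
  have J0: "0 \<le> ?J" by (simp add: radial_mass_def)
  have J: "(\<integral>\<^sup>+z. ?f z * indicator (ball 0 1) z \<partial>lborel) = ennreal ?J"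
    unfolding N_def by (rule nn_integral_ball_norm_powr)
  have [measurable]: "ball (0::'a) r \<in> sets borel" for r by simp
  have ineq: "V * (\<Sum>i<N. q ^ i) \<le> ?J" if q: "0 < q" "q < 1" for q
  proof -
    have mq: "(\<lambda>z. ?f z * indicator (ball 0 q) z) \<in> borel_measurable borel" by measurable
    have "(\<integral>\<^sup>+z. ?f z * indicator (ball 0 q) z \<partial>lborel)
        = ennreal (\<bar>q\<bar> ^ N) * (\<integral>\<^sup>+z. ?f (0 + q *\<^sub>R z) * indicator (ball 0 q) (0 + q *\<^sub>R z) \<partial>lborel)"
      unfolding N_def by (rule nn_integral_lborel_affine[OF mq[unfolded N_def], of q 0]) (use q in simp)
    also have "(\<lambda>z::'a. ?f (0 + q *\<^sub>R z) * indicator (ball 0 q) (0 + q *\<^sub>R z))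
        = (\<lambda>z. ennreal (q powr (1 - real N)) * (?f z * indicator (ball 0 1) z))"
    proof
      fix z :: 'a
      have "q *\<^sub>R z \<in> ball 0 q \<longleftrightarrow> z \<in> ball 0 1" using q by simp
      then show "?f (0 + q *\<^sub>R z) * indicator (ball 0 q) (0 + q *\<^sub>R z)
          = ennreal (q powr (1 - real N)) * (?f z * indicator (ball 0 1) z)"
        using q by (simp add: indicator_def powr_mult ennreal_mult)
    qed
    also have "(\<integral>\<^sup>+z. ennreal (q powr (1 - real N)) * (?f z * indicator (ball 0 1) z) \<partial>lborel)
        = ennreal (q powr (1 - real N)) * ennreal ?J"
      by (subst nn_integral_cmult) (measurable, simp add: J)
    also have "ennreal (\<bar>q\<bar> ^ N) * (ennreal (q powr (1 - real N)) * ennreal ?J) = ennreal (q * ?J)"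
    proof -
      have "\<bar>q\<bar> ^ N * q powr (1 - real N) = q"
        using q by (simp add: N powr_minus powr_realpow)
      then show ?thesis using q J0 by (simp flip: ennreal_mult mult.assoc)
    qed
    finally have inner: "(\<integral>\<^sup>+z. ?f z * indicator (ball 0 q) z \<partial>lborel) = ennreal (q * ?J)" .
    have sub: "ball 0 q \<subseteq> ball (0::'a) 1" using q by auto
    have shell: "emeasure lborel (ball (0::'a) 1 - ball 0 q) = ennreal (V * (1 - q ^ N))"
    proof -
      have "emeasure lborel (ball (0::'a) 1 - ball 0 q) = emeasure lborel (ball (0::'a) 1) - emeasure lborel (ball (0::'a) q)"
        using q by (intro emeasure_Diff sub) (simp_all add: emeasure_ball)
      also have "\<dots> = ennreal (V - V * q ^ N)"
        using q V by (simp add: emeasure_ball N_def[symmetric] V_def[symmetric] ennreal_minus)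
      finally show ?thesis by (simp add: right_diff_distrib)
    qed
    have "ennreal (q * ?J) + ennreal (V * (1 - q ^ N))
        = (\<integral>\<^sup>+z. ?f z * indicator (ball 0 q) z + indicator (ball 0 1 - ball 0 q) z \<partial>lborel)"
      by (subst nn_integral_add) (measurable, simp add: inner shell)
    also have "\<dots> \<le> (\<integral>\<^sup>+z. ?f z * indicator (ball 0 1) z \<partial>lborel)"
    proof (rule nn_integral_mono)
      fix z :: 'a
      have "1 \<le> ?f z" if "z \<in> ball 0 1" "z \<notin> ball 0 q"
      proof -
        have nz: "0 < norm z" "norm z \<le> 1" using that q by auto
        have "norm z powr 0 \<le> norm z powr (1 - real N)" using nz by (intro powr_mono') (auto simp: N)
        then have "1 \<le> norm z powr (1 - real N)" using nz by simp
        then show ?thesis by (simp add: ennreal_leI flip: ennreal_1)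
      qed
      then show "?f z * indicator (ball 0 q) z + indicator (ball 0 1 - ball 0 q) z \<le> ?f z * indicator (ball 0 1) z"
        using sub by (auto simp: indicator_def)
    qed
    finally have "ennreal (q * ?J + V * (1 - q ^ N)) \<le> ennreal ?J"
      using q V J0 by (simp add: J power_le_one)
    then have "q * ?J + V * (1 - q ^ N) \<le> ?J" using J0 by (simp add: ennreal_le_iff)
    \<comment> \<open>1 - q^N = (1 - q) (1 + q + ... + q^(N-1)); cancelling 1 - q leaves a sum that
      tends to N as q tends to 1.\<close>
    then have "(1 - q) * (V * (\<Sum>i<N. q ^ i)) \<le> (1 - q) * ?J"
      by (simp add: one_diff_power_eq algebra_simps)
    then show ?thesis using q by simp
  qed
  have "((\<lambda>q::real. V * (\<Sum>i<N. q ^ i)) \<longlongrightarrow> V * (\<Sum>i<N. 1 ^ i)) (at_left 1)"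
    by (intro tendsto_intros)
  moreover have "\<forall>\<^sub>F q in at_left 1. V * (\<Sum>i<N. q ^ i) \<le> ?J"
  proof -
    have "\<forall>\<^sub>F q in at_left 1. q \<in> {0<..<1::real}" by (rule eventually_at_left_real) simp
    then show ?thesis by (rule eventually_mono) (rule ineq, auto)
  qed
  ultimately have "V * (\<Sum>i<N. 1 ^ i) \<le> ?J"
    by (rule tendsto_upperbound) simp
  then show ?thesis by (simp add: V_def N_def mult.commute)
qed

text \<open>With z = x - y the part where |z| < 1 is at most the integral centred at 0; on the rest
  the integrand is at most 1 and the volume of the ball suffices.\<close>

lemma nn_integral_shifted_norm_powr_le:
  fixes x :: "'a::euclidean_space"
  shows "(\<integral>\<^sup>+y. ennreal (norm (x - y) powr (1 - real DIM('a))) * indicator (ball 0 1) y \<partial>lborel)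
    \<le> ennreal (radial_mass TYPE('a) + unit_ball_vol (real DIM('a)))"
proof -
  let ?f = "\<lambda>z::'a. ennreal (norm z powr (1 - real DIM('a)))"
  have J0: "0 \<le> radial_mass TYPE('a)" by (simp add: radial_mass_def)
  have [measurable]: "ball (0::'a) r \<in> sets borel" for r by simp
  have le: "?f (x - y) * indicator (ball 0 1) y
      \<le> ?f (x + (-1) *\<^sub>R y) * indicator (ball 0 1) (x + (-1) *\<^sub>R y) + indicator (ball 0 1) y" for y
  proof (cases "x - y \<in> ball 0 1")
    case True
    then show ?thesis by (auto simp: indicator_def)
  next
    case False
    then have xy: "1 \<le> norm (x - y)" by (simp add: dist_norm norm_minus_commute)
    then have "norm (x - y) powr (1 - real DIM('a)) \<le> norm (x - y) powr 0"
      using DIM_positive[where 'a='a] by (intro powr_mono) auto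
    also have "\<dots> = 1" using xy by auto
    finally have "?f (x - y) \<le> 1" by simp
    then show ?thesis using False by (auto simp: indicator_def)
  qed
  have "(\<integral>\<^sup>+y. ?f (x - y) * indicator (ball 0 1) y \<partial>lborel)
      \<le> (\<integral>\<^sup>+y. ?f (x + (-1) *\<^sub>R y) * indicator (ball 0 1) (x + (-1) *\<^sub>R y) + indicator (ball 0 1) y \<partial>lborel)"
    by (intro nn_integral_mono le)
  also have "\<dots> = (\<integral>\<^sup>+y. ?f (x + (-1) *\<^sub>R y) * indicator (ball 0 1) (x + (-1) *\<^sub>R y) \<partial>lborel)
      + ennreal (unit_ball_vol (real DIM('a)))"
    by (subst nn_integral_add) (measurable, simp add: emeasure_ball)
  also have "(\<integral>\<^sup>+y. ?f (x + (-1) *\<^sub>R y) * indicator (ball 0 1) (x + (-1) *\<^sub>R y) \<partial>lborel)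
      = (\<integral>\<^sup>+z. ?f z * indicator (ball 0 1) z \<partial>lborel)"
    using nn_integral_lborel_affine[of "\<lambda>z. ?f z * indicator (ball 0 1) z" "-1" x] by simp
  finally show ?thesis
    using J0 by (simp add: nn_integral_ball_norm_powr)
qed

text \<open>A real supremum dominates the value at 0 only if the set is bounded above, so an upper
  bound for all x comes first. At x = 0 the integral is (J - integral of |y|) / (n \<omega>) with J
  \<ge> n \<omega> and the integral of |y| crudely at most \<omega>, the volume of the ball.\<close>

theorem green_const_ge:
  assumes dim: "3 \<le> DIM('a::euclidean_space)"
  shows "1 - 1 / real DIM('a) \<le> green_const TYPE('a)"
proof -
  define n where "n = real DIM('a)"
  define V where "V = unit_ball_vol n"
  define J where "J = radial_mass TYPE('a)"
  have n3: "3 \<le> n" using dim by (simp add: n_def)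
  have V: "0 < V" using n3 by (simp add: V_def)
  have J: "n * V \<le> J" unfolding n_def V_def J_def by (rule radial_mass_ge)
  have [measurable]: "ball (0::'a) r \<in> sets borel" for r by simp
  have c0: "0 \<le> 1 / (n * V)" using n3 V by simp
  have J0: "0 \<le> J" by (rule order_trans[OF _ J]) (use n3 V in simp)
  let ?g = "\<lambda>x y::'a. norm (grad (\<lambda>z. green_function (ball 0 1) z y) x)"
  define I where "I = (\<lambda>x::'a. LINT y:ball 0 1|lebesgue. ?g x y)"
  have upper: "I x \<le> 2 / (n * V) * (J + V)" if x: "x \<in> ball 0 1" for x
  proof -
    let ?e = "\<lambda>y. indicator (ball 0 1) y *\<^sub>R ?g x y"
    have B0: "0 \<le> 2 / (n * V) * (J + V)" by (rule mult_nonneg_nonneg) (use n3 V J0 in simp_all)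
    show ?thesis
    \<comment> \<open>If the integrand is not integrable, the integral is 0 by convention and the
      bound is trivial; so no measurability of the gradient has to be shown for general x.\<close>
    proof (cases "integrable lebesgue ?e")
      case True
      have "AE y in lborel. y \<noteq> x" by (rule AE_lborel_singleton)
      then have ae: "AE y in lebesgue. y \<noteq> x" by (rule AE_completion)
      have "(\<integral>\<^sup>+y. ennreal (?e y) \<partial>lebesgue)
          \<le> (\<integral>\<^sup>+y. ennreal (2 / (n * V)) * (ennreal (norm (x - y) powr (1 - n)) * indicator (ball 0 1) y) \<partial>lebesgue)"
      proof (rule nn_integral_mono_AE, rule AE_mp[OF ae], rule AE_I2, rule impI)
        fix y assume "y \<noteq> x"
        then show "ennreal (?e y) \<le> ennreal (2 / (n * V)) * (ennreal (norm (x - y) powr (1 - n)) * indicator (ball 0 1) y)"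
          using norm_grad_green_function_le[OF dim _ x, of y] c0
          by (auto simp: indicator_def n_def V_def ennreal_leI simp flip: ennreal_mult)
      qed
      also have "\<dots> = ennreal (2 / (n * V)) * (\<integral>\<^sup>+y. ennreal (norm (x - y) powr (1 - n)) * indicator (ball 0 1) y \<partial>lborel)"
        unfolding nn_integral_completion by (rule nn_integral_cmult) measurable
      also have "\<dots> \<le> ennreal (2 / (n * V)) * ennreal (J + V)"
        unfolding n_def J_def V_def by (intro mult_left_mono nn_integral_shifted_norm_powr_le) simp
      also have "\<dots> = ennreal (2 / (n * V) * (J + V))"
        by (rule ennreal_mult[symmetric]) (use n3 V J0 in simp_all)
      finally have "enn2real (\<integral>\<^sup>+y. ennreal (?e y) \<partial>lebesgue) \<le> 2 / (n * V) * (J + V)"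
        using B0 by (intro enn2real_leI)
      moreover have "integral\<^sup>L lebesgue ?e = enn2real (\<integral>\<^sup>+y. ennreal (?e y) \<partial>lebesgue)"
        using True by (intro integral_eq_nn_integral) auto
      ultimately show ?thesis by (simp add: I_def set_lebesgue_integral_def)
    next
      case False
      then have "I x = 0" by (simp add: I_def set_lebesgue_integral_def not_integrable_integral_eq)
      then show ?thesis using B0 by simp
    qed
  qed
  have "1 - 1 / n \<le> I 0"
  proof -
    let ?e = "\<lambda>y. indicator (ball 0 1) y *\<^sub>R ?g 0 y"
    let ?F = "\<lambda>y::'a. indicator (ball 0 1) y * norm y powr (1 - n)"
    let ?N = "\<lambda>y::'a. indicator (ball 0 1) y * norm y"
    let ?G = "\<lambda>y::'a. 1 / (n * V) * (?F y - ?N y)"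
    have eq: "?e y = ?G y" if "y \<noteq> 0" for y
      using norm_grad_green_function_0[OF dim _ that] by (auto simp: indicator_def n_def V_def)
    have mG: "?G \<in> borel_measurable borel" by measurable
    have mG': "?G \<in> borel_measurable lebesgue" by (rule measurable_completion) (simp add: mG)
    \<comment> \<open>The explicit formula holds off y = 0. Modifying a measurable function at a
      single point keeps it measurable.\<close>
    have eqf: "(\<lambda>y. if y \<in> {0} then ?e 0 else ?G y) = ?e" using eq by auto
    have "(\<lambda>y. if y \<in> {0} then ?e 0 else ?G y) \<in> borel_measurable lebesgue"
      by (intro measurable_If_set mG' measurable_const) (auto intro: sets_completionI_sets)
    then have me: "?e \<in> borel_measurable lebesgue" unfolding eqf .
    have "AE y in lborel. y \<noteq> (0::'a)" by (rule AE_lborel_singleton)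
    then have "AE y in lebesgue. y \<noteq> (0::'a)" by (rule AE_completion)
    then have "AE y in lebesgue. ?e y = ?G y" by (rule AE_mp) (rule AE_I2, rule impI, rule eq)
    then have "I 0 = integral\<^sup>L lebesgue ?G"
      unfolding I_def set_lebesgue_integral_def by (rule integral_cong_AE[OF me mG'])
    also have "\<dots> = integral\<^sup>L lborel ?G" by (rule integral_completion) (simp add: mG)
    finally have I0: "I 0 = integral\<^sup>L lborel ?G" .
    have nnF: "(\<integral>\<^sup>+y. ennreal (?F y) \<partial>lborel) = ennreal J"
    proof -
      have "(\<lambda>y::'a. ennreal (?F y)) = (\<lambda>y. ennreal (norm y powr (1 - n)) * indicator (ball 0 1) y)"
        by (auto simp: indicator_def)
      then show ?thesis using nn_integral_ball_norm_powr[where 'a='a] by (simp only: n_def J_def)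
    qed
    have hF: "has_bochner_integral lborel ?F J"
      by (rule has_bochner_integral_nn_integral[OF _ _ J0 nnF]) auto
    have hN: "integrable lborel ?N"
      using integrableI_bounded_set_indicator[of "ball (0::'a) 1" lborel norm 1]
      by (simp add: emeasure_ball)
    have iV: "integrable lborel (indicator (ball (0::'a) 1) :: 'a \<Rightarrow> real)"
      by (intro integrable_real_indicator) (simp_all add: emeasure_ball)
    have "integral\<^sup>L lborel ?N \<le> integral\<^sup>L lborel (indicator (ball (0::'a) 1))"
      by (rule integral_mono[OF hN iV]) (auto simp: indicator_def)
    also have "\<dots> = V" by (simp add: measure_def emeasure_ball n_def V_def)
    finally have N: "integral\<^sup>L lborel ?N \<le> V" .
    have "integral\<^sup>L lborel ?G = 1 / (n * V) * (J - integral\<^sup>L lborel ?N)"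
      using hF hN by (simp add: has_bochner_integral_iff)
    moreover have "1 / (n * V) * (n * V - V) \<le> 1 / (n * V) * (J - integral\<^sup>L lborel ?N)"
      by (rule mult_left_mono[OF _ c0]) (use J N in linarith)
    ultimately have "1 / (n * V) * (n * V - V) \<le> I 0" using I0 by linarith
    moreover have "1 / (n * V) * (n * V - V) = 1 - 1 / n" using n3 V by (simp add: field_simps)
    ultimately show ?thesis by simp
  qed
  also have "I 0 \<le> (SUP x\<in>ball 0 1. I x)"
    by (rule cSUP_upper) (use upper in \<open>auto intro!: bdd_aboveI2\<close>)
  also have "\<dots> = green_const TYPE('a)" by (simp add: green_const_def I_def)
  finally show ?thesis by (simp add: n_def)
qed

section \<open>The two geometric cases\<close>

lemma sup_norm_on_leD:
  assumes "sup_norm_on \<Omega> R \<le> ereal \<Lambda>" "x \<in> \<Omega>"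
  shows "\<bar>R x\<bar> \<le> \<Lambda>"
proof -
  have "ereal \<bar>R x\<bar> \<le> sup_norm_on \<Omega> R" unfolding sup_norm_on_def using assms(2) by (rule SUP_upper)
  then have "ereal \<bar>R x\<bar> \<le> ereal \<Lambda>" using assms(1) by (rule order_trans)
  then show ?thesis by simp
qed

text \<open>The parabola across the slab, divided by |u|^2, has Laplacian -2 and is at most
  (\<delta>/2)^2, so m = 1 and D = \<delta>/2. For n = 3 the general condition reads (\<delta>^2 /
  4) (\<gamma> + 5 e \<Lambda> / 4) < 1/2, and e \<le> 3 makes 5 e / 4 \<le> 4.\<close>

lemma conformal_dirichlet_slab:
  fixes \<Omega> :: "'a::euclidean_space set" and R S :: "'a \<Rightarrow> real"
  assumes dim: "DIM('a) = 3"
    and \<Omega>: "open \<Omega>" "convex \<Omega>" "bounded \<Omega>" "\<Omega> \<noteq> {}"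
    and RS: "smooth_on \<Omega> R" "smooth_on \<Omega> S"
    and bR: "\<And>x. x \<in> \<Omega> \<Longrightarrow> \<bar>R x\<bar> \<le> \<Lambda>" and bS: "\<And>x. x \<in> \<Omega> \<Longrightarrow> \<bar>S x\<bar> \<le> \<gamma>"
    and pos: "0 < \<Lambda>" "0 < \<gamma>" "0 < \<delta>"
    and slab: "u \<noteq> 0" "\<Omega> \<subseteq> {x. a \<le> u \<bullet> x \<and> u \<bullet> x \<le> b}" "b - a \<le> \<delta> * norm u"
    and small: "\<delta>\<^sup>2 * (\<gamma> + 4 * \<Lambda>) < 2"
  shows "\<exists>f. is_smooth_dirichlet_solution \<Omega> R S f"
proof -
  define k where "k = 1 / (u \<bullet> u)"
  have uu: "0 < u \<bullet> u" using slab(1) by simp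
  have k: "0 < k" "k * (u \<bullet> u) = 1" using uu by (simp_all add: k_def)
  let ?\<tau> = "\<lambda>x. k * ((u \<bullet> x - a) * (b - u \<bullet> x))"
  let ?D = "\<delta> / 2"
  have cl: "a \<le> u \<bullet> x \<and> u \<bullet> x \<le> b" if "x \<in> closure \<Omega>" for x
  proof -
    have "closed {x. a \<le> u \<bullet> x \<and> u \<bullet> x \<le> b}"
      by (intro closed_Collect_conj closed_Collect_le continuous_intros)
    from closure_minimal[OF slab(2) this] that show ?thesis by blast
  qed
  obtain x0 where "x0 \<in> \<Omega>" using \<Omega>(4) by blast
  then have ab: "0 \<le> b - a" using slab(2) by auto
  have w: "(b - a)\<^sup>2 \<le> \<delta>\<^sup>2 * (u \<bullet> u)"
    using power_mono[OF slab(3) ab, of 2] by (simp add: power_mult_distrib power2_norm_eq_inner)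
  have "k * (\<delta>\<^sup>2 * (u \<bullet> u)) = \<delta>\<^sup>2" unfolding mult.left_commute[of k] k(2) by (rule mult_1_right)
  with mult_left_mono[OF w less_imp_le[OF k(1)]] have kw: "k * (b - a)\<^sup>2 \<le> \<delta>\<^sup>2" by (rule ord_le_eq_trans)
  show ?thesis
  proof (rule conformal_dirichlet[OF _ \<Omega> RS bR bS pos(1,2), where D="?D" and m=1 and \<tau>="?\<tau>"])
    show "3 \<le> DIM('a)" using dim by simp
    show "0 < ?D" using pos(3) by simp
    show "higher_differentiable_on UNIV ?\<tau> 2" by (rule higher_differentiable_on_poly_deg[OF poly_deg_slab])
  next
    fix x assume "x \<in> closure \<Omega>"
    note x = cl[OF this]
    show "0 \<le> ?\<tau> x" using x k(1) by simp
    have "(u \<bullet> x - a) * (b - u \<bullet> x) \<le> (b - a)\<^sup>2 / 4"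
      using zero_le_power2[of "(u \<bullet> x - a) - (b - u \<bullet> x)"] by (simp add: power2_eq_square algebra_simps)
    from mult_left_mono[OF this less_imp_le[OF k(1)]] kw
    show "?\<tau> x \<le> ?D\<^sup>2" by (simp add: power_divide)
  next
    fix x assume "x \<in> \<Omega>"
    then have x: "a \<le> u \<bullet> x" "u \<bullet> x \<le> b" using slab(2) by auto
    show "laplacian ?\<tau> x = - 2 * 1" using k(2) by (simp add: laplacian_slab)
    have "(\<lambda>v. k * ((u \<bullet> v) * (b + a - 2 * (u \<bullet> x)))) = (\<lambda>v. (k * (a + b - 2 * (u \<bullet> x))) *\<^sub>R u \<bullet> v)"
      by (simp add: add.commute mult_ac)
    with slab_has_derivative[of k u a b x]
    have "(?\<tau> has_derivative (\<lambda>v. (k * (a + b - 2 * (u \<bullet> x))) *\<^sub>R u \<bullet> v)) (at x)" by (simp only:)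
    then have "grad ?\<tau> x = (k * (a + b - 2 * (u \<bullet> x))) *\<^sub>R u" by (rule grad_eqI)
    then have "(norm (grad ?\<tau> x))\<^sup>2 = k * (a + b - 2 * (u \<bullet> x))\<^sup>2 * (k * (u \<bullet> u))"
      unfolding power2_norm_eq_inner by (simp add: power2_eq_square)
    also have "\<dots> = k * (a + b - 2 * (u \<bullet> x))\<^sup>2" using k(2) by simp
    also have "\<dots> \<le> k * (b - a)\<^sup>2"
      using k(1) x by (intro mult_left_mono abs_le_square_iff[THEN iffD1]) auto
    also have "\<dots> \<le> 4 * ?D\<^sup>2" using kw by (simp add: power_divide)
    finally show "(norm (grad ?\<tau> x))\<^sup>2 \<le> 4 * ?D\<^sup>2" .
  next
    have "5 * exp 1 * \<Lambda> / 4 \<le> 4 * \<Lambda>" using exp_le pos(1) by simp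
    then have "?D\<^sup>2 * (\<gamma> + 5 * exp 1 * \<Lambda> / 4) \<le> ?D\<^sup>2 * (\<gamma> + 4 * \<Lambda>)" by (intro mult_left_mono) auto
    also have "\<dots> < 1 / 2" using small by (simp add: power_divide)
    finally show "?D\<^sup>2 * (\<gamma> + (real DIM('a) + 2) / (real DIM('a) - 2) * exp 1 * \<Lambda> / (2 * (real DIM('a) - 1)))
        < 1 - (real DIM('a) - 2) / 2"
      by (simp add: dim)
  qed
qed

text \<open>The slab diameter is an infimum, so only slabs of width slightly above \<delta> are
  supplied. The constant 1.06 is a rounded common bound for what the two size hypotheses give, 10 /
  9.52 and 6.4 / 9.52.\<close>

lemma conformal_dirichlet_thin:
  fixes \<Omega> :: "'a::euclidean_space set" and R S :: "'a \<Rightarrow> real"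
  assumes dim: "DIM('a) = 3"
    and \<Omega>: "open \<Omega>" "convex \<Omega>" "bounded \<Omega>" "\<Omega> \<noteq> {}"
    and RS: "smooth_on \<Omega> R" "smooth_on \<Omega> S"
    and bR: "\<And>x. x \<in> \<Omega> \<Longrightarrow> \<bar>R x\<bar> \<le> \<Lambda>" and bS: "\<And>x. x \<in> \<Omega> \<Longrightarrow> \<bar>S x\<bar> \<le> \<gamma>"
    and pos: "0 < \<Lambda>" "0 < \<gamma>" and \<delta>: "0 \<le> \<delta>" "\<delta> \<le> 1" "\<delta> * (4 * \<Lambda> + \<gamma>) \<le> 1.06"
    and slab: "\<And>\<epsilon>. \<delta> < \<epsilon> \<Longrightarrow> \<exists>u a b. u \<noteq> 0 \<and> \<Omega> \<subseteq> {x. a \<le> u \<bullet> x \<and> u \<bullet> x \<le> b} \<and> b - a \<le> \<epsilon> * norm u"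
  shows "\<exists>f. is_smooth_dirichlet_solution \<Omega> R S f"
proof -
  define M where "M = \<gamma> + 4 * \<Lambda>"
  have M: "0 < M" using pos by (simp add: M_def)
  \<comment> \<open>Raises \<delta> and \<delta> M by at most 1/10 each; 1.1 * 1.16 is still well
    below 2.\<close>
  define t where "t = min (1 / 10) (1 / (10 * M))"
  have t: "0 < t" "t \<le> 1 / 10" using M by (simp_all add: t_def)
  have "t * M \<le> 1 / (10 * M) * M" using M by (intro mult_right_mono) (simp_all add: t_def)
  then have tM: "t * M \<le> 1 / 10" using M by simp
  obtain u a b where s: "u \<noteq> 0" "\<Omega> \<subseteq> {x. a \<le> u \<bullet> x \<and> u \<bullet> x \<le> b}" "b - a \<le> (\<delta> + t) * norm u"
    using slab[of "\<delta> + t"] t(1) by auto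
  have dM: "(\<delta> + t) * M \<le> 1.16" using \<delta>(3) tM by (simp add: M_def algebra_simps)
  have "(\<delta> + t)\<^sup>2 * M = (\<delta> + t) * ((\<delta> + t) * M)" by (simp add: power2_eq_square)
  also have "\<dots> \<le> 1.1 * 1.16" using \<delta> t M dM by (intro mult_mono) auto
  finally have small: "(\<delta> + t)\<^sup>2 * (\<gamma> + 4 * \<Lambda>) < 2" by (simp add: M_def)
  have p: "0 < \<delta> + t" using \<delta>(1) t(1) by simp
  show ?thesis
    by (rule conformal_dirichlet_slab[OF dim \<Omega> RS bR bS pos p s small])
qed

text \<open>Parallel hyperplanes at levels a and b are at distance at least (b - a) / |u| by
  Cauchy-Schwarz, so a set distance below \<epsilon> gives a slab of width at most
  \<epsilon>.\<close>

lemma slab_diameter_slab: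
  fixes \<Omega> :: "'a::euclidean_space set"
  assumes \<Omega>: "bounded \<Omega>" "\<Omega> \<noteq> {}" and \<epsilon>: "slab_diameter \<Omega> < \<epsilon>"
  shows "\<exists>u a b. u \<noteq> 0 \<and> \<Omega> \<subseteq> {x. a \<le> u \<bullet> x \<and> u \<bullet> x \<le> b} \<and> b - a \<le> \<epsilon> * norm u"
proof -
  let ?W = "{setdist {x::'a. u \<bullet> x = a} {x. u \<bullet> x = b} | u a b. u \<noteq> 0 \<and> a \<le> b \<and> \<Omega> \<subseteq> {x. a \<le> u \<bullet> x \<and> u \<bullet> x \<le> b}}"
  obtain r where r: "\<And>x. x \<in> \<Omega> \<Longrightarrow> norm x \<le> r" using \<Omega>(1) by (auto simp: bounded_iff)
  obtain x0 where x0: "x0 \<in> \<Omega>" using \<Omega>(2) by blast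
  have r0: "0 \<le> r" using r[OF x0] norm_ge_zero[of x0] by linarith
  obtain e :: 'a where e: "e \<in> Basis" by (rule nonempty_Basis[THEN ex_in_conv[THEN iffD2], THEN exE])
  \<comment> \<open>A bounded set lies in some coordinate slab, so the infimum is over a nonempty
    set and can be approached.\<close>
  have "\<Omega> \<subseteq> {x. - r \<le> e \<bullet> x \<and> e \<bullet> x \<le> r}"
  proof
    fix x assume "x \<in> \<Omega>"
    from order_trans[OF Basis_le_norm[OF e, of x] r[OF this]]
    show "x \<in> {x. - r \<le> e \<bullet> x \<and> e \<bullet> x \<le> r}" by (simp add: inner_commute abs_le_iff)
  qed
  moreover have "- r \<le> r" using r0 by simp
  ultimately have "setdist {x. e \<bullet> x = - r} {x. e \<bullet> x = r} \<in> ?W" using nonzero_Basis[OF e] by blast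
  then have ne: "?W \<noteq> {}" by blast
  obtain w where w: "w \<in> ?W" "w < \<epsilon>" using cInf_lessD[OF ne \<epsilon>[unfolded slab_diameter_def]] by (elim bexE)
  from w(1) obtain u a b where s: "u \<noteq> 0" "a \<le> b" "\<Omega> \<subseteq> {x. a \<le> u \<bullet> x \<and> u \<bullet> x \<le> b}"
    and weq: "w = setdist {x. u \<bullet> x = a} {x. u \<bullet> x = b}" by blast
  have nu: "0 < norm u" using s(1) by simp
  have hp: "(t / (u \<bullet> u)) *\<^sub>R u \<in> {x. u \<bullet> x = t}" for t using s(1) by simp
  have "(b - a) / norm u \<le> w"
    unfolding weq
  proof (rule le_setdistI)
    show "{x. u \<bullet> x = a} \<noteq> {}" "{x. u \<bullet> x = b} \<noteq> {}" using hp by blast+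
    fix x y assume "x \<in> {x. u \<bullet> x = a}" "y \<in> {x. u \<bullet> x = b}"
    then have "b - a = u \<bullet> (y - x)" by (simp add: inner_diff_right)
    also have "\<dots> \<le> norm u * norm (y - x)" by (rule norm_cauchy_schwarz)
    finally show "(b - a) / norm u \<le> dist x y"
      using nu by (simp add: pos_divide_le_eq dist_norm norm_minus_commute mult.commute)
  qed
  then have "(b - a) / norm u \<le> \<epsilon>" using w(2) by simp
  then have "b - a \<le> \<epsilon> * norm u" using nu by (simp add: pos_divide_le_eq)
  then show ?thesis using s(1,3) by blast
qed

lemma slab_diameter_nonneg:
  fixes \<Omega> :: "'a::euclidean_space set"
  assumes "bounded \<Omega>" "\<Omega> \<noteq> {}"
  shows "0 \<le> slab_diameter \<Omega>"
proof (rule ccontr)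
  assume neg: "\<not> 0 \<le> slab_diameter \<Omega>"
  then obtain u :: 'a and a b where s: "u \<noteq> 0" "\<Omega> \<subseteq> {x. a \<le> u \<bullet> x \<and> u \<bullet> x \<le> b}" "b - a \<le> slab_diameter \<Omega> / 2 * norm u"
    using slab_diameter_slab[OF assms, of "slab_diameter \<Omega> / 2"] by auto
  have "slab_diameter \<Omega> / 2 * norm u < 0" using s(1) neg by (intro mult_neg_pos) auto
  moreover obtain x0 where "x0 \<in> \<Omega>" using assms(2) by blast
  ultimately show False using s(2,3) by fastforce
qed

text \<open>Any unit direction works: the extreme values of that coordinate are attained on the
  closure, at two points whose distance is at most the diameter.\<close>

lemma diameter_slab:
  fixes \<Omega> :: "'a::euclidean_space set"
  assumes \<Omega>: "bounded \<Omega>" "\<Omega> \<noteq> {}"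
  shows "\<exists>u a b. u \<noteq> 0 \<and> \<Omega> \<subseteq> {x. a \<le> u \<bullet> x \<and> u \<bullet> x \<le> b} \<and> b - a \<le> diameter \<Omega> * norm u"
proof -
  obtain e :: 'a where e: "e \<in> Basis" by (rule nonempty_Basis[THEN ex_in_conv[THEN iffD2], THEN exE])
  let ?C = "closure \<Omega>"
  have C: "compact ?C" "?C \<noteq> {}" using \<Omega> by (simp_all add: compact_closure)
  have c: "continuous_on ?C (\<lambda>x. e \<bullet> x)" by (intro continuous_intros)
  obtain p where p: "p \<in> ?C" "\<And>x. x \<in> ?C \<Longrightarrow> e \<bullet> p \<le> e \<bullet> x" using continuous_attains_inf[OF C c] by blast
  obtain q where q: "q \<in> ?C" "\<And>x. x \<in> ?C \<Longrightarrow> e \<bullet> x \<le> e \<bullet> q" using continuous_attains_sup[OF C c] by blast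
  have "e \<bullet> q - e \<bullet> p = e \<bullet> (q - p)" by (simp add: inner_diff_right)
  also have "\<dots> \<le> norm e * norm (q - p)" by (rule norm_cauchy_schwarz)
  also have "\<dots> = dist q p" using e by (simp add: dist_norm)
  also have "\<dots> \<le> diameter ?C"
    by (rule diameter_bounded_bound[OF bounded_closure[OF \<Omega>(1)] q(1) p(1)])
  also have "\<dots> = diameter \<Omega>" by (rule diameter_closure[OF \<Omega>(1)])
  finally have "e \<bullet> q - e \<bullet> p \<le> diameter \<Omega> * norm e" using e by simp
  moreover have "\<Omega> \<subseteq> {x. e \<bullet> p \<le> e \<bullet> x \<and> e \<bullet> x \<le> e \<bullet> q}"
    using p(2) q(2) closure_subset[of \<Omega>] by blast
  ultimately show ?thesis using nonzero_Basis[OF e] by blast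
qed

text \<open>With \<tau> = d^2 - |x - c|^2 one has m = n and D = d, so m - (n - 2) / 2 = n / 2 + 1 is
  available.\<close>

lemma conformal_dirichlet_ball:
  fixes c :: "'a::euclidean_space" and R S :: "'a \<Rightarrow> real"
  defines "n \<equiv> real DIM('a)"
  assumes dim: "4 \<le> DIM('a)"
    and RS: "smooth_on (ball c d) R" "smooth_on (ball c d) S"
    and bR: "\<And>x. x \<in> ball c d \<Longrightarrow> \<bar>R x\<bar> \<le> \<Lambda>" and bS: "\<And>x. x \<in> ball c d \<Longrightarrow> \<bar>S x\<bar> \<le> \<gamma>"
    and pos: "0 < \<Lambda>" "0 < \<gamma>" "0 < d"
    and small: "d\<^sup>2 * (\<gamma> + 2.5 * \<Lambda>) < n / 2 + 1"
  shows "\<exists>f. is_smooth_dirichlet_solution (ball c d) R S f"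
proof -
  let ?\<tau> = "\<lambda>x. 0 + 1 * (d\<^sup>2 - (x - c) \<bullet> (x - c))"
  have n4: "4 \<le> n" using dim by (simp add: n_def)
  have ne: "ball c d \<noteq> {}" using pos(3) by simp
  have nrm: "(x - c) \<bullet> (x - c) = (dist c x)\<^sup>2" for x
    by (metis dist_norm dist_commute power2_norm_eq_inner)
  show ?thesis
  proof (rule conformal_dirichlet[OF _ open_ball convex_ball bounded_ball ne RS bR bS pos, where m=n and \<tau>="?\<tau>"])
    show "3 \<le> DIM('a)" using dim by simp
    show "higher_differentiable_on UNIV ?\<tau> 2" by (rule higher_differentiable_on_poly_deg[OF poly_deg_quadratic])
  next
    fix x assume "x \<in> closure (ball c d)"
    then have "dist c x \<le> d" using pos(3) by simp
    then have "(dist c x)\<^sup>2 \<le> d\<^sup>2" by (intro power_mono) auto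
    then show "0 \<le> ?\<tau> x" by (simp add: nrm)
    show "?\<tau> x \<le> d\<^sup>2" by simp
  next
    fix x assume "x \<in> ball c d"
    then have "dist c x \<le> d" by simp
    then have x: "(dist c x)\<^sup>2 \<le> d\<^sup>2" by (intro power_mono) auto
    show "laplacian ?\<tau> x = - 2 * n" unfolding laplacian_quadratic n_def by simp
    have "(?\<tau> has_derivative (\<lambda>v. (-2) *\<^sub>R (x - c) \<bullet> v)) (at x)"
      by (auto intro!: derivative_eq_intros simp: inner_commute algebra_simps)
    then have "grad ?\<tau> x = (-2) *\<^sub>R (x - c)" by (rule grad_eqI)
    then have "(norm (grad ?\<tau> x))\<^sup>2 = 4 * (dist c x)\<^sup>2"
      by (simp only: norm_scaleR power_mult_distrib) (simp add: dist_norm norm_minus_commute)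
    then show "(norm (grad ?\<tau> x))\<^sup>2 \<le> 4 * d\<^sup>2" using x by simp
  next
    \<comment> \<open>For n \<ge> 4 this and e \<le> 3 bound the coefficient of \<Lambda> by 9 / 6 =
      1.5, below the 2.5 of the hypothesis.\<close>
    have "(n + 2) / (n - 2) \<le> 3" using n4 by (simp add: field_simps)
    then have "(n + 2) / (n - 2) * exp 1 \<le> 3 * 3" using exp_le n4 by (intro mult_mono) auto
    then have "(n + 2) / (n - 2) * exp 1 * \<Lambda> / (2 * (n - 1)) \<le> 3 * 3 * \<Lambda> / (2 * (4 - 1))"
      using n4 pos(1) by (intro frac_le mult_right_mono) auto
    then have "d\<^sup>2 * (\<gamma> + (n + 2) / (n - 2) * exp 1 * \<Lambda> / (2 * (n - 1))) \<le> d\<^sup>2 * (\<gamma> + 2.5 * \<Lambda>)"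
      using pos(1) by (intro mult_left_mono) auto
    also have "\<dots> < n - (n - 2) / 2" using small by (simp add: field_simps)
    finally show "d\<^sup>2 * (\<gamma> + (real DIM('a) + 2) / (real DIM('a) - 2) * exp 1 * \<Lambda> / (2 * (real DIM('a) - 1)))
        < n - (real DIM('a) - 2) / 2"
      by (simp only: n_def)
  qed
qed

text \<open>Cubing reduces the claim to pi^2 \<ge> 8. It is the only information on this factor that
  the size conditions need.\<close>

lemma two_le_pi_powr: "2 \<le> pi powr (2/3)"
proof (rule ccontr)
  assume "\<not> ?thesis"
  then have "(pi powr (2/3)) ^ 3 < 2 ^ 3" by (intro power_strict_mono) auto
  moreover have "(pi powr (2/3)) ^ 3 = pi\<^sup>2"
    by (simp add: powr_powr flip: powr_numeral)
  moreover have "3 ^ 2 \<le> pi\<^sup>2" using pi_approx by (intro power_mono) auto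
  ultimately show False by simp
qed

theorem theorem1:
  fixes \<Omega> :: "(real ^ 'n) set"
    and R S :: "real ^ 'n \<Rightarrow> real"
    and \<Lambda> \<gamma> :: real
  assumes "smooth_on \<Omega> R" and "smooth_on \<Omega> S"
    and "\<Lambda> > 0" and "\<gamma> > 0"
    and "sup_norm_on \<Omega> R \<le> ereal \<Lambda>"
    and "sup_norm_on \<Omega> S \<le> ereal \<gamma>"
    and "(CARD('n) = 3 \<and> open \<Omega> \<and> connected \<Omega> \<and> \<Omega> \<noteq> {} \<and> bounded \<Omega> \<and>
           convex \<Omega> \<and> smooth_boundary \<Omega> \<and>
           (measure lebesgue \<Omega>
              \<le> Min {1, (8 / (4.76 * pi powr (2/3) * (4 * \<Lambda> + \<gamma>))) ^ 3} \<and>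
            slab_diameter \<Omega>
              \<le> Min {1, 1.25 * measure lebesgue \<Omega> powr (1/3), 2 / (0.75 * \<Lambda> + 1)}
            \<or>
            diameter \<Omega>
              \<le> Min {1, 4 / (4.76 * pi powr (2/3) * (2.5 * \<Lambda> + \<gamma>)),
                       4 / (1.5 * \<Lambda> + sqrt 2)}))
         \<or>
         (CARD('n) \<ge> 4 \<and>
           (\<exists>c d. d > 0 \<and> \<Omega> = ball c d \<and>
              d \<le> Min {1/2,
                       (real CARD('n) - 1) / (green_const TYPE(real ^ 'n) * (2.5 * \<Lambda> + \<gamma>)),
                       (real CARD('n) - 1) / (1.5 * \<Lambda> + sqrt 2)}))"
  shows "\<exists>f :: real ^ 'n \<Rightarrow> real. is_smooth_dirichlet_solution \<Omega> R S f"
proof -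
  note RS = assms(1,2) and pos = assms(3,4)
  note bR = sup_norm_on_leD[OF assms(5)] and bS = sup_norm_on_leD[OF assms(6)]
  let ?Q = "4.76 * pi powr (2/3)"
  have Q: "9.52 \<le> ?Q" using two_le_pi_powr by simp
  from assms(7) show ?thesis
  proof (elim disjE conjE exE)
    assume "CARD('n) = 3" and \<Omega>: "open \<Omega>" "\<Omega> \<noteq> {}" "bounded \<Omega>" "convex \<Omega>"
      and V: "measure lebesgue \<Omega> \<le> Min {1, (8 / (?Q * (4 * \<Lambda> + \<gamma>))) ^ 3}"
      and \<delta>: "slab_diameter \<Omega> \<le> Min {1, 1.25 * measure lebesgue \<Omega> powr (1/3), 2 / (0.75 * \<Lambda> + 1)}"
    let ?M = "4 * \<Lambda> + \<gamma>"
    have dim: "DIM(real ^ 'n) = 3" using \<open>CARD('n) = 3\<close> by simp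
    have M: "0 < ?M" using pos by simp
    have d1: "slab_diameter \<Omega> \<le> 1" and d2: "slab_diameter \<Omega> \<le> 1.25 * measure lebesgue \<Omega> powr (1/3)"
      using \<delta> by simp_all
    have "measure lebesgue \<Omega> \<le> (8 / (?Q * ?M)) ^ 3" using V by simp
    then have "measure lebesgue \<Omega> powr (1/3) \<le> ((8 / (?Q * ?M)) ^ 3) powr (1/3)"
      by (intro powr_mono2) auto
    also have "\<dots> = 8 / (?Q * ?M)" using M by (simp add: powr_powr flip: powr_numeral)
    also have "\<dots> \<le> 8 / (9.52 * ?M)" using Q M by (intro divide_left_mono mult_right_mono mult_pos_pos) auto
    finally have "1.25 * measure lebesgue \<Omega> powr (1/3) \<le> 1.25 * (8 / (9.52 * ?M))" by (rule mult_left_mono) simp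
    with d2 have "slab_diameter \<Omega> \<le> 1.25 * (8 / (9.52 * ?M))" by (rule order_trans)
    also have "\<dots> = 1.25 * 8 / 9.52 / ?M" by (simp only: times_divide_eq_right divide_divide_eq_left)
    finally have "slab_diameter \<Omega> * ?M \<le> 1.25 * 8 / 9.52" by (simp only: pos_le_divide_eq[OF M])
    also have "\<dots> \<le> 1.06" by simp
    finally have d3: "slab_diameter \<Omega> * ?M \<le> 1.06" .
    show ?thesis
      by (rule conformal_dirichlet_thin[OF dim \<Omega>(1,4,3,2) RS bR bS pos
            slab_diameter_nonneg[OF \<Omega>(3,2)] d1 d3 slab_diameter_slab[OF \<Omega>(3,2)]])
  next
    assume "CARD('n) = 3" and \<Omega>: "open \<Omega>" "\<Omega> \<noteq> {}" "bounded \<Omega>" "convex \<Omega>"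
      and \<delta>: "diameter \<Omega> \<le> Min {1, 4 / (?Q * (2.5 * \<Lambda> + \<gamma>)), 4 / (1.5 * \<Lambda> + sqrt 2)}"
    let ?M = "2.5 * \<Lambda> + \<gamma>"
    have dim: "DIM(real ^ 'n) = 3" using \<open>CARD('n) = 3\<close> by simp
    have M: "0 < ?M" using pos by simp
    have d0: "0 \<le> diameter \<Omega>" by (rule diameter_ge_0[OF \<Omega>(3)])
    have d1: "diameter \<Omega> \<le> 1" and "diameter \<Omega> \<le> 4 / (?Q * ?M)" using \<delta> by simp_all
    note this(2)
    also have "4 / (?Q * ?M) \<le> 4 / (9.52 * ?M)" using Q M by (intro divide_left_mono mult_right_mono mult_pos_pos) auto
    also have "\<dots> = 4 / 9.52 / ?M" by (simp only: divide_divide_eq_left)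
    finally have d2: "diameter \<Omega> * ?M \<le> 4 / 9.52" by (simp only: pos_le_divide_eq[OF M])
    \<comment> \<open>1.6 = 4 / 2.5 converts the weight 2.5 \<Lambda> + \<gamma> of the diameter
      condition into that of the slab lemma.\<close>
    have "diameter \<Omega> * (4 * \<Lambda> + \<gamma>) \<le> diameter \<Omega> * (1.6 * ?M)"
      using pos d0 by (intro mult_left_mono) auto
    also have "\<dots> = 1.6 * (diameter \<Omega> * ?M)" by (rule mult.left_commute)
    also have "\<dots> \<le> 1.6 * (4 / 9.52)" by (rule mult_left_mono[OF d2]) simp
    also have "\<dots> \<le> 1.06" by simp
    finally have d3: "diameter \<Omega> * (4 * \<Lambda> + \<gamma>) \<le> 1.06" .
    obtain u a b where s: "u \<noteq> 0" "\<Omega> \<subseteq> {x. a \<le> u \<bullet> x \<and> u \<bullet> x \<le> b}" "b - a \<le> diameter \<Omega> * norm u"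
      using diameter_slab[OF \<Omega>(3,2)] by blast
    have sl: "\<exists>u a b. u \<noteq> 0 \<and> \<Omega> \<subseteq> {x. a \<le> u \<bullet> x \<and> u \<bullet> x \<le> b} \<and> b - a \<le> \<epsilon> * norm u"
      if "diameter \<Omega> < \<epsilon>" for \<epsilon>
    proof (intro exI conjI)
      show "b - a \<le> \<epsilon> * norm u"
        by (rule order_trans[OF s(3) mult_right_mono[OF less_imp_le[OF that] norm_ge_zero]])
    qed (use s in blast)+
    show ?thesis
      by (rule conformal_dirichlet_thin[OF dim \<Omega>(1,4,3,2) RS bR bS pos d0 d1 d3 sl])
  next
    fix c d
    let ?n = "real CARD('n)" and ?C = "green_const TYPE(real ^ 'n)" and ?M = "2.5 * \<Lambda> + \<gamma>"
    assume card: "4 \<le> CARD('n)" and d: "0 < d" and \<Omega>: "\<Omega> = ball c d"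
      and dm: "d \<le> Min {1/2, (?n - 1) / (?C * ?M), (?n - 1) / (1.5 * \<Lambda> + sqrt 2)}"
    have dim: "4 \<le> DIM(real ^ 'n)" using card by simp
    have n4: "4 \<le> ?n" using card by simp
    have M: "0 < ?M" using pos by simp
    have C: "1 - 1 / ?n \<le> ?C" using green_const_ge[where 'a="real ^ 'n"] dim by simp
    have C1: "0 < 1 - 1 / ?n" using n4 by simp
    then have C0: "0 < ?C" using C by linarith
    have d1: "d \<le> 1 / 2" and d2: "d \<le> (?n - 1) / (?C * ?M)" using dm by simp_all
    have "d \<le> (?n - 1) / ?C / ?M" using d2 by (simp only: divide_divide_eq_left)
    then have "d * ?M \<le> (?n - 1) / ?C" by (simp only: pos_le_divide_eq[OF M])
    \<comment> \<open>The lower bound for the constant enters here: it turns the hypothesis into d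
      (2.5 \<Lambda> + \<gamma>) \<le> n. With d \<le> 1/2 the product with another d is at most n /
      2, below n / 2 + 1.\<close>
    also have "\<dots> \<le> (?n - 1) / (1 - 1 / ?n)" using n4 C C1 C0 by (intro divide_left_mono mult_pos_pos) auto
    also have "\<dots> = ?n" using n4 by (simp add: field_simps)
    finally have "d * (d * ?M) \<le> 1 / 2 * ?n" using d d1 M by (intro mult_mono) auto
    then have small: "d\<^sup>2 * (\<gamma> + 2.5 * \<Lambda>) < real DIM(real ^ 'n) / 2 + 1"
      by (simp add: power2_eq_square algebra_simps)
    show ?thesis
      using conformal_dirichlet_ball[OF dim RS[unfolded \<Omega>] bR[unfolded \<Omega>] bS[unfolded \<Omega>] pos d small]
      by (simp only: \<Omega>)
  qed
qed

end
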